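(* Let $r>0$ and let $X:S^n(r)\to\mathbb{R}^{n+1}$ be the $n$-dimensional round sphere of radius $r$ centered at the origin, regarded as a critical point of the $\mathcal{F}$-functional with $X_0=0$, $t_0=1$ and $\lambda=\frac{n}{r}-r$. If $r\le\sqrt{n}$ or $r>\sqrt{n+1}$, then $X:S^n(r)\to\mathbb{R}^{n+1}$ is $\mathcal{F}$-stable. If $\sqrt{n}<r\le\sqrt{n+1}$, then $X:S^n(r)\to\mathbb{R}^{n+1}$ is $\mathcal{F}$-unstable.
   Context: Let $X:M\to\mathbb{R}^{n+1}$ be an immersed hypersurface with unit normal $N$ and area element $d\mu$; the mean curvature $H$ is the trace of $h_{ij}=-\langle D_{e_i}N,e_j\rangle$. On $S^n(r)$ take $N=-X/r$, so $H=\frac{n}{r}$ and $H+\langle X,N\rangle=\frac{n}{r}-r=\lambda$. Let $X(s):M\to\mathbb{R}^{n+1}$ be a (compactly supported) normal variation with $X(0)=X$, $\frac{\partial X(s)}{\partial s}=f(s)N(s)$, $f=f(0)$, where $N(s)$ is the unit normal of $X(s)$ and $d\mu_s$ its area element; let $X_s\in\mathbb{R}^{n+1}$ and $t_s>0$ be smooth variations of $X_0$ and $t_0$ (equal to $X_0$ and $t_0$ at $s=0$). The $\mathcal{F}$-functional is $$\mathcal{F}(s)=\mathcal{F}_{X_s,t_s}(s)=(4\pi t_s)^{-\frac n2}\int_M e^{-\frac{|X(s)-X_s|^2}{2t_s}}d\mu_s+\lambda(4\pi t_0)^{-\frac n2}\Bigl(\frac{t_0}{t_s}\Bigr)^{\frac12}\int_M\langle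 X(s)-X_s,N\rangle e^{-\frac{|X-X_0|^2}{2t_0}}d\mu,$$ where $N$ and $d\mu$ are those of $X=X(0)$. $X$ is a critical point if $\mathcal{F}'(0)=0$ for all normal variations of $X$ and all variations of $X_0,t_0$. A critical point is $\mathcal{F}$-stable if for every normal variation $fN$ there exist variations of $X_0$ and $t_0$ such that $\mathcal{F}''(0)\ge0$; it is $\mathcal{F}$-unstable if there exists a normal variation $fN$ such that $\mathcal{F}''(0)<0$ for all variations of $X_0$ and $t_0$. *)

theory Defs
  imports "HOL-Analysis.Analysis"
begin

text \<open>
  The ambient space \<open>\<real>\<^sup>n\<^sup>+\<^sup>1\<close> is \<^typ>\<open>real ^ ('n::finite) option\<close> with \<open>n = CARD('n) \<ge> 1\<close>: the index type
  \<^typ>\<open>'n option\<close> has exactly \<open>n + 1\<close> elements. The parameter manifold of every hypersurface is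
  \<open>M = S\<^sup>n(r) = sphere 0 r\<close>. Maps on \<open>M\<close> are total functions of which only the values on
  \<open>sphere 0 r\<close> matter.
\<close>

subsection \<open>Smooth maps\<close>

primrec Ck_on :: "nat \<Rightarrow> 'a::real_normed_vector set \<Rightarrow> ('a \<Rightarrow> 'b::real_normed_vector) \<Rightarrow> bool" where
  "Ck_on 0 U g \<longleftrightarrow> continuous_on U g"
| "Ck_on (Suc k) U g \<longleftrightarrow>
     (\<forall>x\<in>U. g differentiable (at x)) \<and> (\<forall>v. Ck_on k U (\<lambda>x. frechet_derivative g (at x) v))"

text \<open>Smoothness on a not necessarily open set \<open>S\<close> means having a smooth extension to an open
  neighbourhood. It is used for intervals \<open>I\<close>, for \<open>sphere 0 r\<close> and for \<open>I \<times> sphere 0 r\<close>.\<close>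

definition smooth_on :: "'a::real_normed_vector set \<Rightarrow> ('a \<Rightarrow> 'b::real_normed_vector) \<Rightarrow> bool" where
  "smooth_on S g \<longleftrightarrow>
     (\<exists>U G. open U \<and> S \<subseteq> U \<and> (\<forall>k. Ck_on k U G) \<and> (\<forall>x\<in>S. G x = g x))"


subsection \<open>Immersed hypersurfaces parametrized by the sphere\<close>

text \<open>The differential at \<open>p\<close> of a map on \<open>S\<^sup>n(r)\<close>. It is determined only on
  \<open>T\<^sub>p S\<^sup>n(r) = {v. v \<bullet> p = 0}\<close> and is only ever applied to such vectors.\<close>

definition sphere_D ::
    "real \<Rightarrow> (real ^ 'n::finite option \<Rightarrow> real ^ 'n option) \<Rightarrow>
     real ^ 'n option \<Rightarrow> real ^ 'n option \<Rightarrow> real ^ 'n option" where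
  "sphere_D r X p = frechet_derivative X (at p within sphere 0 r)"

definition immersed_hypersurface ::
    "real \<Rightarrow> (real ^ 'n::finite option \<Rightarrow> real ^ 'n option) \<Rightarrow>
     (real ^ 'n option \<Rightarrow> real ^ 'n option) \<Rightarrow> bool" where
  "immersed_hypersurface r X N \<longleftrightarrow>
     smooth_on (sphere 0 r) X \<and> smooth_on (sphere 0 r) N \<and>
     (\<forall>p\<in>sphere 0 r.
        inj_on (sphere_D r X p) {v. v \<bullet> p = 0} \<and>
        norm (N p) = 1 \<and> (\<forall>v. v \<bullet> p = 0 \<longrightarrow> N p \<bullet> sphere_D r X p v = 0))"

text \<open>Surface measure of the round sphere: the area of \<open>A \<subseteq> S\<^sup>n(r)\<close> is \<open>(n + 1) / r\<close> times the
  Lebesgue measure of the cone \<open>{c *\<^sub>R x | 0 < c \<le> 1, x \<in> A}\<close>, which is the preimage of \<open>A\<close> under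
  the radial projection of the punctured ball.\<close>

definition sphere_measure :: "real \<Rightarrow> (real ^ 'n::finite option) measure" where
  "sphere_measure r =
     scale_measure (ennreal ((real CARD('n) + 1) / r))
       (distr (restrict_space lborel (cball 0 r - {0})) (restrict_space borel (sphere 0 r))
         (\<lambda>x. (r / norm x) *\<^sub>R x))"

definition tangent_frame :: "real ^ 'n::finite option \<Rightarrow> ('n \<Rightarrow> real ^ 'n option) \<Rightarrow> bool" where
  "tangent_frame p e \<longleftrightarrow>
     (\<forall>i. e i \<bullet> p = 0) \<and> (\<forall>i j. e i \<bullet> e j = (if i = j then 1 else 0))"

text \<open>The density \<open>sqrt (det g\<^sub>i\<^sub>j)\<close> of the metric induced by \<open>X\<close>, where
  \<open>g\<^sub>i\<^sub>j = \<langle>dX(e\<^sub>i), dX(e\<^sub>j)\<rangle>\<close> for an orthonormal basis \<open>(e\<^sub>i)\<close> of \<open>T\<^sub>p S\<^sup>n(r)\<close> with respect to the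
  round metric. It does not depend on the basis.\<close>

definition area_density ::
    "real \<Rightarrow> (real ^ 'n::finite option \<Rightarrow> real ^ 'n option) \<Rightarrow> real ^ 'n option \<Rightarrow> real" where
  "area_density r X p =
     (let e = (SOME e. tangent_frame p e)
      in sqrt (det (\<chi> i j. sphere_D r X p (e i) \<bullet> sphere_D r X p (e j))))"

definition area_measure ::
    "real \<Rightarrow> (real ^ 'n::finite option \<Rightarrow> real ^ 'n option) \<Rightarrow> (real ^ 'n option) measure" where
  "area_measure r X = density (sphere_measure r) (\<lambda>p. ennreal (area_density r X p))"


subsection \<open>Variations\<close>

text \<open>Since \<open>S\<^sup>n(r)\<close> is compact, every variation is compactly supported.\<close>

definition normal_variation ::
    "real \<Rightarrow> (real ^ 'n::finite option \<Rightarrow> real ^ 'n option) \<Rightarrow>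
     (real ^ 'n option \<Rightarrow> real ^ 'n option) \<Rightarrow>
     (real \<Rightarrow> real ^ 'n option \<Rightarrow> real ^ 'n option) \<Rightarrow> bool" where
  "normal_variation r X N Xs \<longleftrightarrow>
     (\<exists>\<epsilon>>0. \<exists>(f :: real \<Rightarrow> real ^ 'n option \<Rightarrow> real) (Ns :: real \<Rightarrow> real ^ 'n option \<Rightarrow> real ^ 'n option).
        smooth_on ({-\<epsilon><..<\<epsilon>} \<times> sphere 0 r) (\<lambda>(s, p). Xs s p) \<and>
        smooth_on ({-\<epsilon><..<\<epsilon>} \<times> sphere 0 r) (\<lambda>(s, p). Ns s p) \<and>
        smooth_on ({-\<epsilon><..<\<epsilon>} \<times> sphere 0 r) (\<lambda>(s, p). f s p) \<and>
        (\<forall>s\<in>{-\<epsilon><..<\<epsilon>}. immersed_hypersurface r (Xs s) (Ns s)) \<and>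
        (\<forall>p\<in>sphere 0 r. Xs 0 p = X p \<and> Ns 0 p = N p) \<and>
        (\<forall>s\<in>{-\<epsilon><..<\<epsilon>}. \<forall>p\<in>sphere 0 r.
           ((\<lambda>s. Xs s p) has_vector_derivative f s p *\<^sub>R Ns s p) (at s)))"

definition point_variation :: "'a::real_normed_vector \<Rightarrow> (real \<Rightarrow> 'a) \<Rightarrow> bool" where
  "point_variation x0 x \<longleftrightarrow> (\<exists>\<epsilon>>0. smooth_on {-\<epsilon><..<\<epsilon>} x) \<and> x 0 = x0"

definition scale_variation :: "real \<Rightarrow> (real \<Rightarrow> real) \<Rightarrow> bool" where
  "scale_variation t0 t \<longleftrightarrow>
     (\<exists>\<epsilon>>0. smooth_on {-\<epsilon><..<\<epsilon>} t \<and> (\<forall>s\<in>{-\<epsilon><..<\<epsilon>}. t s > 0)) \<and> t 0 = t0"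


subsection \<open>The functional and its stability notions\<close>

definition F_functional ::
    "real \<Rightarrow> (real ^ 'n::finite option \<Rightarrow> real ^ 'n option) \<Rightarrow>
     (real ^ 'n option \<Rightarrow> real ^ 'n option) \<Rightarrow> real ^ 'n option \<Rightarrow> real \<Rightarrow> real \<Rightarrow>
     (real \<Rightarrow> real ^ 'n option \<Rightarrow> real ^ 'n option) \<Rightarrow> (real \<Rightarrow> real ^ 'n option) \<Rightarrow>
     (real \<Rightarrow> real) \<Rightarrow> real \<Rightarrow> real" where
  "F_functional r X N x0 t0 lam Xs x t s =
     (4 * pi * t s) powr (- real CARD('n) / 2) *
       (\<integral>p. exp (- (norm (Xs s p - x s))\<^sup>2 / (2 * t s)) \<partial>area_measure r (Xs s)) +
     lam * (4 * pi * t0) powr (- real CARD('n) / 2) * sqrt (t0 / t s) *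
       (\<integral>p. ((Xs s p - x s) \<bullet> N p) * exp (- (norm (X p - x0))\<^sup>2 / (2 * t0)) \<partial>area_measure r X)"

definition F_critical ::
    "real \<Rightarrow> (real ^ 'n::finite option \<Rightarrow> real ^ 'n option) \<Rightarrow>
     (real ^ 'n option \<Rightarrow> real ^ 'n option) \<Rightarrow> real ^ 'n option \<Rightarrow> real \<Rightarrow> real \<Rightarrow> bool" where
  "F_critical r X N x0 t0 lam \<longleftrightarrow>
     immersed_hypersurface r X N \<and>
     (\<forall>Xs x t. normal_variation r X N Xs \<and> point_variation x0 x \<and> scale_variation t0 t \<longrightarrow>
        (F_functional r X N x0 t0 lam Xs x t has_real_derivative 0) (at 0))"

definition has_second_derivative :: "(real \<Rightarrow> real) \<Rightarrow> real \<Rightarrow> real \<Rightarrow> bool" where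
  "has_second_derivative F d a \<longleftrightarrow>
     (\<exists>F'. (\<forall>\<^sub>F s in nhds a. (F has_real_derivative F' s) (at s)) \<and>
           (F' has_real_derivative d) (at a))"

definition F_stable ::
    "real \<Rightarrow> (real ^ 'n::finite option \<Rightarrow> real ^ 'n option) \<Rightarrow>
     (real ^ 'n option \<Rightarrow> real ^ 'n option) \<Rightarrow> real ^ 'n option \<Rightarrow> real \<Rightarrow> real \<Rightarrow> bool" where
  "F_stable r X N x0 t0 lam \<longleftrightarrow>
     F_critical r X N x0 t0 lam \<and>
     (\<forall>Xs. normal_variation r X N Xs \<longrightarrow>
        (\<exists>x t. point_variation x0 x \<and> scale_variation t0 t \<and>
           (\<exists>d. has_second_derivative (F_functional r X N x0 t0 lam Xs x t) d 0 \<and> d \<ge> 0)))"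

definition F_unstable ::
    "real \<Rightarrow> (real ^ 'n::finite option \<Rightarrow> real ^ 'n option) \<Rightarrow>
     (real ^ 'n option \<Rightarrow> real ^ 'n option) \<Rightarrow> real ^ 'n option \<Rightarrow> real \<Rightarrow> real \<Rightarrow> bool" where
  "F_unstable r X N x0 t0 lam \<longleftrightarrow>
     F_critical r X N x0 t0 lam \<and>
     (\<exists>Xs. normal_variation r X N Xs \<and>
        (\<forall>x t. point_variation x0 x \<and> scale_variation t0 t \<longrightarrow>
           (\<exists>d. has_second_derivative (F_functional r X N x0 t0 lam Xs x t) d 0 \<and> d < 0)))"

end

theory Submission
  imports Defs
begin

text \<open>
  Write \<open>R = r\<^sup>2\<close>, \<open>\<lambda> = n / r - r\<close>, let \<open>f\<close> be the initial normal speed of a variation \<open>X(s)\<close> of the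
  sphere, and let \<open>y\<close>, \<open>h\<close> be the initial velocities of the base point and of the scale. Differentiating
  the Gaussian weight and the area element twice gives, up to the positive factor
  \<open>(4 \<pi>)\<^sup>-\<^sup>n\<^sup>/\<^sup>2 e\<^sup>-\<^sup>R\<^sup>/\<^sup>2\<close>, the quadratic form
  \<open>\<integral> |\<nabla>f|\<^sup>2 + (\<lambda>\<^sup>2 - 1 - n/R) f\<^sup>2 + (Q/r) h f - 2 (\<lambda> + 1/r) f \<langle>y,p\<rangle> + \<langle>y,p\<rangle>\<^sup>2 - |y|\<^sup>2 + Q h\<^sup>2 / 4\<close>
  with \<open>Q = (n - R)\<^sup>2 - R - n\<close>. The acceleration \<open>X''(0)\<close> enters only through its tangential divergence and
  its normal component; the divergence theorem on the sphere turns the first into the second, and the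
  total coefficient vanishes. The acceleration of the scale has the coefficient zero, and that of the base point
  contributes a linear function of \<open>p\<close>, which has mean zero.
  This is \<open>second_variation\<close>. The first derivative vanishes because its integrand is linear in \<open>p\<close>.

  Split \<open>f = g + m + \<langle>z,p\<rangle>\<close> with \<open>g\<close> orthogonal to constants and to linear functions. The form becomes a
  sum of three independent parts (\<open>second_variation_form_decomposition\<close>):
  \<open>(\<integral> R|\<nabla>g|\<^sup>2 + Q g\<^sup>2) / R\<close>, then \<open>(Q/R) (m + h r/2)\<^sup>2\<close> times the area, and
  \<open>(n (n - R) |z|\<^sup>2 - (n + 1 - R) |y + r z|\<^sup>2) / (n + 1)\<close> times the area. The scale can always cancel the second
  part by \<open>h = - 2 m / r\<close>, and \<open>y = - r z\<close> cancels the square in the third.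

  If \<open>R \<le> n\<close>, what then remains of the third part is nonnegative. So is the first, because the second
  nonzero eigenvalue of the sphere gives \<open>\<integral> R|\<nabla>g|\<^sup>2 \<ge> 2 (n + 1) \<integral> g\<^sup>2\<close> (\<open>sphere_spectral_gap\<close>), and
  \<open>2 (n + 1) + Q = (n - R)\<^sup>2 + (n - R) + 2\<close>. If
  \<open>R > n + 1\<close>, the third part tends to \<open>+\<infinity>\<close> with \<open>|y|\<close>, whatever \<open>f\<close> is. If \<open>n < R \<le> n + 1\<close>, then
  \<open>Q < 0\<close>, so every variation with \<open>g = 0\<close> and \<open>z \<noteq> 0\<close> has a negative form for all \<open>y\<close> and \<open>h\<close>. The speed has
  to be normal at all times and not only at the start; moving the sphere through an Apollonian pencil of
  spheres along the orthogonal circles is such a variation, and its initial speed is affine.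

  The spectral gap rests on the powers \<open>(a \<bullet> p)\<^sup>d\<close> of linear forms. The Laplacian of the sphere is triangular on
  them, which splits their span into eigenspaces, and this span is dense.
\<close>

section \<open>Calculus of smooth maps on open sets\<close>

abbreviation diff_at ::
    "('a::real_normed_vector \<Rightarrow> 'b::real_normed_vector) \<Rightarrow> 'a \<Rightarrow> 'a \<Rightarrow> 'b" where
  "diff_at f x \<equiv> frechet_derivative f (at x)"

lemma Ck_on_cong:
  assumes "open U" "\<And>x. x \<in> U \<Longrightarrow> f x = g x" "Ck_on k U f"
  shows "Ck_on k U g"
  using assms(2,3)
proof (induction k arbitrary: f g)
  case 0
  then show ?case by (metis Ck_on.simps(1) continuous_on_cong)
next
  case (Suc k)
  have D: "g differentiable (at x)" "diff_at f x = diff_at g x"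
    if x: "x \<in> U" for x
  proof -
    have d: "f differentiable (at x)" using Suc.prems x by simp
    then have "(f has_derivative diff_at f x) (at x)"
      by (simp add: frechet_derivative_works)
    then have g: "(g has_derivative diff_at f x) (at x)"
      by (rule has_derivative_transform_within_open[OF _ \<open>open U\<close> x]) (use Suc.prems in auto)
    then show "g differentiable (at x)" by (auto simp: differentiable_def)
    show "diff_at f x = diff_at g x"
      using frechet_derivative_at[OF g] .
  qed
  have "Ck_on k U (\<lambda>x. diff_at g x v)" for v
    by (rule Suc.IH[of "\<lambda>x. diff_at f x v"]) (use D Suc.prems in auto)
  then show ?case using D by simp
qed

lemma Ck_on_Suc_imp: "Ck_on (Suc k) U f \<Longrightarrow> Ck_on k U f"
proof (induction k arbitrary: f)
  case 0
  then show ?case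
    by (auto intro!: continuous_at_imp_continuous_on differentiable_imp_continuous_within)
next
  case (Suc k)
  from Suc.prems have "Ck_on (Suc k) U (\<lambda>x. diff_at f x v)" for v
    unfolding Ck_on.simps(2)[of "Suc k"] by blast
  then have "Ck_on k U (\<lambda>x. diff_at f x v)" for v by (rule Suc.IH)
  moreover have "\<forall>x\<in>U. f differentiable (at x)" 
    using Suc.prems unfolding Ck_on.simps(2)[of "Suc k"] by blast
  ultimately show ?case unfolding Ck_on.simps(2)[of k] by blast
qed

lemma Ck_on_subset: "Ck_on k U f \<Longrightarrow> V \<subseteq> U \<Longrightarrow> Ck_on k V f"
  by (induction k arbitrary: f) (auto intro: continuous_on_subset)

text \<open>Derivatives are unique at points of an open set, so any derivative that can be exhibited there may stand in for
  \<open>frechet_derivative\<close>. The closure properties below follow from this rule by induction on the order.\<close>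

lemma Ck_on_SucI:
  assumes "open U" "\<And>x. x \<in> U \<Longrightarrow> (f has_derivative D x) (at x)"
    and "\<And>v. Ck_on k U (\<lambda>x. D x v)"
  shows "Ck_on (Suc k) U f"
proof -
  have "diff_at f x = D x" if "x \<in> U" for x
    using frechet_derivative_at[OF assms(2)[OF that]] by simp
  then have "Ck_on k U (\<lambda>x. diff_at f x v)" for v
    by (intro Ck_on_cong[OF assms(1) _ assms(3)]) auto
  then show ?thesis using assms(2) by (auto simp: differentiable_def)
qed

lemma Ck_on_SucD:
  assumes "Ck_on (Suc k) U f" "x \<in> U"
  shows "(f has_derivative diff_at f x) (at x)"
  using assms by (simp add: frechet_derivative_works)

lemma Ck_on_const: "open U \<Longrightarrow> Ck_on k U (\<lambda>x. c)"
proof (induction k arbitrary: c)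
  case (Suc k) then show ?case by (intro Ck_on_SucI[where D="\<lambda>_ _. 0"]) auto
qed simp

lemma Ck_on_linear:
  assumes "open U" "bounded_linear h" shows "Ck_on k U h"
proof (cases k)
  case 0 then show ?thesis using assms by (simp add: linear_continuous_on)
next
  case (Suc j) then show ?thesis using assms
    by (simp only:) (intro Ck_on_SucI[where D="\<lambda>_. h"] Ck_on_const bounded_linear_imp_has_derivative)
qed

lemma Ck_on_add:
  assumes "open U" "Ck_on k U f" "Ck_on k U g" shows "Ck_on k U (\<lambda>x. f x + g x)"
  using assms(2,3)
proof (induction k arbitrary: f g)
  case 0 then show ?case by (auto intro: continuous_intros)
next
  case (Suc k)
  show ?case
  proof (rule Ck_on_SucI[OF assms(1)])
    show "((\<lambda>x. f x + g x) has_derivative (\<lambda>v. diff_at f x v + diff_at g x v)) (at x)"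
      if "x \<in> U" for x using that Suc.prems by (intro has_derivative_add Ck_on_SucD)
    show "Ck_on k U (\<lambda>x. diff_at f x v + diff_at g x v)" for v
      using Suc.prems by (intro Suc.IH) simp_all
  qed
qed

lemma Ck_on_bilinear:
  assumes "bounded_bilinear b" "open U" "Ck_on k U f" "Ck_on k U g"
  shows "Ck_on k U (\<lambda>x. b (f x) (g x))"
  using assms(3,4)
proof (induction k arbitrary: f g)
  case 0 then show ?case using bounded_bilinear.continuous_on[OF assms(1)] by auto
next
  case (Suc k)
  note u = Suc.prems[THEN Ck_on_Suc_imp]
  have D: "Ck_on k U (\<lambda>x. diff_at f x v)" "Ck_on k U (\<lambda>x. diff_at g x v)" for v
    using Suc.prems by simp_all
  show ?case
  proof (rule Ck_on_SucI[OF assms(2)])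
    show "((\<lambda>x. b (f x) (g x)) has_derivative
        (\<lambda>v. b (f x) (diff_at g x v) + b (diff_at f x v) (g x))) (at x)"
      if "x \<in> U" for x using that Suc.prems by (intro bounded_bilinear.FDERIV[OF assms(1)] Ck_on_SucD)
    show "Ck_on k U (\<lambda>x. b (f x) (diff_at g x v) + b (diff_at f x v) (g x))" for v
      using D[of v] u by (intro Ck_on_add assms(2) Suc.IH)
  qed
qed

lemma Ck_on_compose_linear:
  assumes "bounded_linear h" "open V" "Ck_on k V f"
  shows "Ck_on k (h -` V) (\<lambda>x. f (h x))"
proof -
  have op: "open (h -` V)" using assms by (intro open_vimage) (auto simp: linear_continuous_on)
  show ?thesis using assms(3)
  proof (induction k arbitrary: f)
    case 0 then show ?case using assms(1)
      by (auto intro!: continuous_on_compose2[of V f "h -` V" h] linear_continuous_on[of h])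
  next
    case (Suc k)
    show ?case
    proof (rule Ck_on_SucI[OF op])
      fix x assume "x \<in> h -` V"
      then have "h x \<in> V" by simp
      from Ck_on_SucD[OF Suc.prems this]
      show "((\<lambda>x. f (h x)) has_derivative (\<lambda>v. diff_at f (h x) (h v))) (at x)"
        by (intro has_derivative_compose[OF bounded_linear_imp_has_derivative[OF assms(1)]])
    next
      show "Ck_on k (h -` V) (\<lambda>x. diff_at f (h x) (h v))" for v
        using Suc.prems by (intro Suc.IH) simp
    qed
  qed
qed

lemma Ck_on_exp:
  fixes u :: "'a::real_normed_vector \<Rightarrow> real"
  assumes "open U" "Ck_on k U u" shows "Ck_on k U (\<lambda>x. exp (u x))"
  using assms(2)
proof (induction k)
  case 0 then show ?case by (auto intro: continuous_intros)
next
  case (Suc k)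
  note u = Ck_on_Suc_imp[OF Suc.prems]
  have D: "Ck_on k U (\<lambda>x. diff_at u x v)" for v using Suc.prems by simp
  show ?case
  proof (rule Ck_on_SucI[OF assms(1)])
    show "((\<lambda>x. exp (u x)) has_derivative (\<lambda>v. exp (u x) * diff_at u x v)) (at x)"
      if "x \<in> U" for x using Ck_on_SucD[OF Suc.prems that] by (auto intro!: derivative_eq_intros)
    show "Ck_on k U (\<lambda>x. exp (u x) * diff_at u x v)" for v
      using D[of v] by (intro Ck_on_bilinear[OF bounded_bilinear_mult] assms(1) Suc.IH[OF u])
  qed
qed

text \<open>Real powers have derivatives of the same kind, so the induction closes over all exponents at once. This one
  rule yields reciprocals and square roots.\<close>

lemma Ck_on_powr:
  fixes u :: "'a::real_normed_vector \<Rightarrow> real"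
  assumes "open U" "\<And>x. x \<in> U \<Longrightarrow> u x > 0" "Ck_on k U u" shows "Ck_on k U (\<lambda>x. u x powr a)"
  using assms(3)
proof (induction k arbitrary: a)
  case 0 then show ?case using assms(2) by (force intro!: continuous_intros)
next
  case (Suc k)
  note u = Ck_on_Suc_imp[OF Suc.prems]
  have D: "Ck_on k U (\<lambda>x. diff_at u x v)" for v using Suc.prems by simp
  show ?case
  proof (rule Ck_on_SucI[OF assms(1)])
    show "((\<lambda>x. u x powr a) has_derivative (\<lambda>v. (a * u x powr (a - 1)) * diff_at u x v)) (at x)"
      if "x \<in> U" for x 
      using Ck_on_SucD[OF Suc.prems that] assms(2)[OF that] 
      by (auto intro!: derivative_eq_intros simp: powr_diff)
    show "Ck_on k U (\<lambda>x. (a * u x powr (a - 1)) * diff_at u x v)" for v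
      using D[of v] by (intro Ck_on_bilinear[OF bounded_bilinear_mult] assms(1) Suc.IH[OF u] Ck_on_const)
  qed
qed


definition Cinf_on :: "'a::real_normed_vector set \<Rightarrow> ('a \<Rightarrow> 'b::real_normed_vector) \<Rightarrow> bool" where
  "Cinf_on U f \<longleftrightarrow> open U \<and> (\<forall>k. Ck_on k U f)"

lemma Cinf_on_open: "Cinf_on U f \<Longrightarrow> open U" by (simp add: Cinf_on_def)

lemma Cinf_on_has_derivative:
  "Cinf_on U f \<Longrightarrow> x \<in> U \<Longrightarrow> (f has_derivative diff_at f x) (at x)"
  unfolding Cinf_on_def using Ck_on_SucD by blast

lemma frechet_derivative_eq: "(f has_derivative D) (at x) \<Longrightarrow> diff_at f x v = D v"
  by (simp add: frechet_derivative_at[symmetric])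

lemma Cinf_on_frechet_linear: "Cinf_on U f \<Longrightarrow> x \<in> U \<Longrightarrow> linear (diff_at f x)"
  by (rule has_derivative_linear[OF Cinf_on_has_derivative])

lemma Cinf_on_frechet: "Cinf_on U f \<Longrightarrow> Cinf_on U (\<lambda>x. diff_at f x v)"
  unfolding Cinf_on_def by (metis Ck_on.simps(2))

lemma Cinf_on_continuous: "Cinf_on U f \<Longrightarrow> continuous_on U f"
  unfolding Cinf_on_def using Ck_on.simps(1) by blast

lemma Cinf_on_subset: "Cinf_on U f \<Longrightarrow> open V \<Longrightarrow> V \<subseteq> U \<Longrightarrow> Cinf_on V f"
  unfolding Cinf_on_def using Ck_on_subset by blast

lemma Cinf_on_cong: "Cinf_on U f \<Longrightarrow> (\<And>x. x \<in> U \<Longrightarrow> f x = g x) \<Longrightarrow> Cinf_on U g"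
  unfolding Cinf_on_def using Ck_on_cong by blast

lemma Cinf_on_const: "open U \<Longrightarrow> Cinf_on U (\<lambda>x. c)"
  by (simp add: Cinf_on_def Ck_on_const)

lemma Cinf_on_linear: "open U \<Longrightarrow> bounded_linear h \<Longrightarrow> Cinf_on U h"
  by (simp add: Cinf_on_def Ck_on_linear)

lemma Cinf_on_add: "Cinf_on U f \<Longrightarrow> Cinf_on U g \<Longrightarrow> Cinf_on U (\<lambda>x. f x + g x)"
  by (simp add: Cinf_on_def Ck_on_add)

lemma Cinf_on_bilinear: "bounded_bilinear b \<Longrightarrow> Cinf_on U f \<Longrightarrow> Cinf_on U g \<Longrightarrow> Cinf_on U (\<lambda>x. b (f x) (g x))"
  by (simp add: Cinf_on_def Ck_on_bilinear)

lemmas Cinf_on_mult = Cinf_on_bilinear[OF bounded_bilinear_mult]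
lemmas Cinf_on_scaleR = Cinf_on_bilinear[OF bounded_bilinear_scaleR]
lemmas Cinf_on_inner = Cinf_on_bilinear[OF bounded_bilinear_inner]

lemma Cinf_on_exp: "Cinf_on U u \<Longrightarrow> Cinf_on U (\<lambda>x. exp (u x :: real))"
  by (simp add: Cinf_on_def Ck_on_exp)

lemma Cinf_on_powr: "Cinf_on U u \<Longrightarrow> (\<And>x. x \<in> U \<Longrightarrow> u x > 0) \<Longrightarrow> Cinf_on U (\<lambda>x. u x powr (a::real))"
  by (simp add: Cinf_on_def Ck_on_powr)

lemma Cinf_on_compose_linear:
  "Cinf_on V f \<Longrightarrow> bounded_linear h \<Longrightarrow> Cinf_on (h -` V) (\<lambda>x. f (h x))"
  by (auto simp: Cinf_on_def Ck_on_compose_linear intro!: open_vimage linear_continuous_on)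

lemma Cinf_on_cmult: "Cinf_on U f \<Longrightarrow> Cinf_on U (\<lambda>x. (c::real) * f x)"
  by (intro Cinf_on_mult Cinf_on_const Cinf_on_open)

lemma Cinf_on_minus: "Cinf_on U f \<Longrightarrow> Cinf_on U (\<lambda>x. - f x)"
  using Cinf_on_scaleR[OF Cinf_on_const[of U "-1"], of f] by (simp add: Cinf_on_open)

lemma Cinf_on_diff: "Cinf_on U f \<Longrightarrow> Cinf_on U g \<Longrightarrow> Cinf_on U (\<lambda>x. f x - g x)"
  using Cinf_on_add[OF _ Cinf_on_minus, of U f g] by simp

lemma Cinf_on_sum: "open U \<Longrightarrow> (\<And>i. i \<in> I \<Longrightarrow> Cinf_on U (f i)) \<Longrightarrow> Cinf_on U (\<lambda>x. \<Sum>i\<in>I. f i x)"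
  by (induction I rule: infinite_finite_induct) (auto intro: Cinf_on_const Cinf_on_add)

lemma Cinf_on_prod:
  fixes f :: "'i \<Rightarrow> 'a::real_normed_vector \<Rightarrow> real"
  shows "open U \<Longrightarrow> (\<And>i. i \<in> I \<Longrightarrow> Cinf_on U (f i)) \<Longrightarrow> Cinf_on U (\<lambda>x. \<Prod>i\<in>I. f i x)"
  by (induction I rule: infinite_finite_induct) (auto intro: Cinf_on_const Cinf_on_mult)

lemma Cinf_on_power: "Cinf_on U f \<Longrightarrow> Cinf_on U (\<lambda>x. (f x :: real) ^ d)"
  by (induction d) (auto intro: Cinf_on_const Cinf_on_mult Cinf_on_open)

lemma Cinf_on_inverse:
  "Cinf_on U u \<Longrightarrow> (\<And>x. x \<in> U \<Longrightarrow> u x > (0::real)) \<Longrightarrow> Cinf_on U (\<lambda>x. inverse (u x))"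
  using Cinf_on_powr[of U u "-1"] by (rule Cinf_on_cong) (auto simp: powr_minus abs_of_pos)

lemma Cinf_on_det:
  fixes A :: "'a::real_normed_vector \<Rightarrow> real ^ 'n::finite ^ 'n"
  assumes "open U" "\<And>i j. Cinf_on U (\<lambda>x. A x $ i $ j)"
  shows "Cinf_on U (\<lambda>x. det (A x))"
  unfolding det_def by (intro Cinf_on_sum Cinf_on_mult Cinf_on_const Cinf_on_prod assms)


lemma smooth_on_E:
  assumes "smooth_on S g" obtains U G where "Cinf_on U G" "S \<subseteq> U" "\<And>x. x \<in> S \<Longrightarrow> G x = g x"
  using assms unfolding smooth_on_def Cinf_on_def by blast

lemma smooth_on_I: "Cinf_on U G \<Longrightarrow> S \<subseteq> U \<Longrightarrow> (\<And>x. x \<in> S \<Longrightarrow> G x = g x) \<Longrightarrow> smooth_on S g"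
  unfolding smooth_on_def Cinf_on_def by blast

lemma Cinf_on_time_derivative:
  fixes f :: "real \<times> 'a::real_normed_vector \<Rightarrow> 'b::real_normed_vector"
  assumes "Cinf_on U f" "(s, p) \<in> U"
  shows "((\<lambda>s. f (s, p)) has_vector_derivative diff_at f (s, p) (1, 0)) (at s)"
proof -
  have D: "(f has_derivative diff_at f (s, p)) (at (s, p))" 
    by (rule Cinf_on_has_derivative[OF assms])
  have "((\<lambda>s. (s, p)) has_derivative (\<lambda>h. (h, 0))) (at s)" by (auto intro!: derivative_eq_intros)
  from has_derivative_compose[OF this D]
  have "((\<lambda>s. f (s, p)) has_derivative (\<lambda>h. diff_at f (s, p) (h, 0))) (at s)" .
  moreover have "(\<lambda>h. diff_at f (s, p) (h, 0)) = (\<lambda>h. h *\<^sub>R diff_at f (s, p) (1, 0))"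
  proof
    show "diff_at f (s, p) (h, 0) = h *\<^sub>R diff_at f (s, p) (1, 0)" for h
      using linear_scale[OF has_derivative_linear[OF D], of h "(1,0)"] by simp
  qed
  ultimately show ?thesis by (simp only: has_vector_derivative_def)
qed

lemma Cinf_on_space_derivative:
  fixes f :: "'c::real_normed_vector \<times> 'a::real_normed_vector \<Rightarrow> 'b::real_normed_vector"
  assumes "Cinf_on U f" "(s, p) \<in> U"
  shows "((\<lambda>p. f (s, p)) has_derivative (\<lambda>v. diff_at f (s, p) (0, v))) (at p)"
proof -
  have D: "(f has_derivative diff_at f (s, p)) (at (s, p))" 
    by (rule Cinf_on_has_derivative[OF assms])
  have "((\<lambda>p. (s, p)) has_derivative (\<lambda>h. (0, h))) (at p)" by (auto intro!: derivative_eq_intros)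
  from has_derivative_compose[OF this D] show ?thesis .
qed

text \<open>The second difference over a small parallelogram is \<open>t\<^sup>2\<close> times the mixed second derivative up to
  \<open>o(t\<^sup>2)\<close>: apply the mean value inequality to the difference of \<open>f\<close> along the two sides parallel to \<open>v\<close>,
  corrected by its expected linear growth.\<close>

lemma Cinf_on_second_difference:
  fixes f :: "'a::real_normed_vector \<Rightarrow> 'b::real_normed_vector"
  assumes f: "Cinf_on U f" and x: "x \<in> U" and e: "e > 0"
  shows "\<exists>\<delta>>0. \<forall>t. 0 < t \<and> t < \<delta> \<longrightarrow>
     norm (f (x + t *\<^sub>R v + t *\<^sub>R w) - f (x + t *\<^sub>R v) - f (x + t *\<^sub>R w) + f x
        - t\<^sup>2 *\<^sub>R diff_at (\<lambda>q. diff_at f q v) x w) \<le> e * t\<^sup>2"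
proof -
  define h where "h = (\<lambda>q. diff_at f q v)"
  define C where "C = norm v + norm w + 1"
  have C: "C > 0" by (simp add: C_def add_nonneg_pos)
  have h: "(h has_derivative diff_at h x) (at x)"
    unfolding h_def by (rule Cinf_on_has_derivative[OF Cinf_on_frechet[OF f] x])
  let ?H = "diff_at h x"
  have lH: "linear ?H" using has_derivative_linear[OF h] .
  have "e / (2 * C) > 0" using e C by simp
  then obtain d1 where d1: "d1 > 0" and
    hb0: "\<And>y. norm (y - x) < d1 \<Longrightarrow> norm (h y - h x - ?H (y - x)) \<le> e / (2 * C) * norm (y - x)"
    using h unfolding has_derivative_at_alt by blast
  obtain d2 where d2: "d2 > 0" "ball x d2 \<subseteq> U"
    using Cinf_on_open[OF f] x openE by blast
  define \<delta> where "\<delta> = min d1 d2 / C"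
  have \<delta>: "\<delta> > 0" using d1 d2 C by (simp add: \<delta>_def)
  have "norm (f (x + t *\<^sub>R v + t *\<^sub>R w) - f (x + t *\<^sub>R v) - f (x + t *\<^sub>R w) + f x - t\<^sup>2 *\<^sub>R ?H w) \<le> e * t\<^sup>2"
    if t: "0 < t" "t < \<delta>" for t
  proof -
    have tC: "t * C < min d1 d2" using t C by (simp add: \<delta>_def field_simps)
    have small: "norm (u *\<^sub>R v + s *\<^sub>R w) \<le> t * C" if "0 \<le> u" "u \<le> t" "0 \<le> s" "s \<le> t" for u s
    proof -
      have "norm (u *\<^sub>R v + s *\<^sub>R w) \<le> u * norm v + s * norm w"
        using norm_triangle_ineq[of "u *\<^sub>R v" "s *\<^sub>R w"] that by simp
      also have "\<dots> \<le> t * norm v + t * norm w" using that by (intro add_mono mult_right_mono) auto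
      also have "\<dots> \<le> t * C" using t by (simp add: C_def algebra_simps)
      finally show ?thesis .
    qed
    have inU: "x + (u *\<^sub>R v + s *\<^sub>R w) \<in> U" if "0 \<le> u" "u \<le> t" "0 \<le> s" "s \<le> t" for u s
      using small[OF that] tC d2(2) by (auto simp: subset_iff dist_norm norm_minus_commute)
    have hb: "norm (h (x + z) - h x - ?H z) \<le> e / (2 * C) * (t * C)" if "norm z \<le> t * C" for z
    proof -
      have "norm (h (x + z) - h x - ?H z) \<le> e / (2 * C) * norm z" using hb0[of "x + z"] that tC by simp
      also have "\<dots> \<le> e / (2 * C) * (t * C)" using that e C by (intro mult_left_mono) auto
      finally show ?thesis .
    qed
    define \<phi> where "\<phi> u = f (x + (u *\<^sub>R v + t *\<^sub>R w)) - f (x + (u *\<^sub>R v + 0 *\<^sub>R w)) - (u * t) *\<^sub>R ?H w" for u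
    have "norm (\<phi> t - \<phi> 0) \<le> (e * t) * norm (t - 0)"
    proof (rule differentiable_bound[where S="{0..t}" and f'="\<lambda>u k. k *\<^sub>R (h (x + (u *\<^sub>R v + t *\<^sub>R w)) - h (x + (u *\<^sub>R v + 0 *\<^sub>R w)) - t *\<^sub>R ?H w)"])
      fix u assume u: "u \<in> {0..t}"
      have line: "((\<lambda>u. f (x + (u *\<^sub>R v + s *\<^sub>R w))) has_derivative (\<lambda>k. k *\<^sub>R h (x + (u *\<^sub>R v + s *\<^sub>R w)))) (at u within {0..t})"
        if "0 \<le> s" "s \<le> t" for s
      proof -
        have q: "x + (u *\<^sub>R v + s *\<^sub>R w) \<in> U" using inU u that by auto
        have 1: "((\<lambda>u. x + (u *\<^sub>R v + s *\<^sub>R w)) has_derivative (\<lambda>k. k *\<^sub>R v)) (at u within {0..t})"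
          by (auto intro!: derivative_eq_intros)
        have "((\<lambda>u. f (x + (u *\<^sub>R v + s *\<^sub>R w))) has_derivative (\<lambda>k. diff_at f (x + (u *\<^sub>R v + s *\<^sub>R w)) (k *\<^sub>R v))) (at u within {0..t})"
          by (rule has_derivative_compose[OF 1 Cinf_on_has_derivative[OF f q]])
        then show ?thesis by (simp add: h_def linear_scale[OF Cinf_on_frechet_linear[OF f q]])
      qed
      show "(\<phi> has_derivative (\<lambda>k. k *\<^sub>R (h (x + (u *\<^sub>R v + t *\<^sub>R w)) - h (x + (u *\<^sub>R v + 0 *\<^sub>R w)) - t *\<^sub>R ?H w))) (at u within {0..t})"

      proof -
        have l: "((\<lambda>u. (u * t) *\<^sub>R ?H w) has_derivative (\<lambda>k. (k * t) *\<^sub>R ?H w)) (at u within {0..t})"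
          by (auto intro!: derivative_eq_intros)
        have "(\<phi> has_derivative (\<lambda>k. k *\<^sub>R h (x + (u *\<^sub>R v + t *\<^sub>R w)) - k *\<^sub>R h (x + (u *\<^sub>R v + 0 *\<^sub>R w)) - (k * t) *\<^sub>R ?H w)) (at u within {0..t})"
          unfolding \<phi>_def using t by (intro has_derivative_diff line l) auto
        then show ?thesis by (simp add: scaleR_diff_right)
      qed
      have "norm (h (x + (u *\<^sub>R v + t *\<^sub>R w)) - h (x + (u *\<^sub>R v + 0 *\<^sub>R w)) - t *\<^sub>R ?H w) =
        norm ((h (x + (u *\<^sub>R v + t *\<^sub>R w)) - h x - ?H (u *\<^sub>R v + t *\<^sub>R w)) - (h (x + (u *\<^sub>R v + 0 *\<^sub>R w)) - h x - ?H (u *\<^sub>R v + 0 *\<^sub>R w)))"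
        by (simp add: linear_add[OF lH] linear_scale[OF lH] linear_0[OF lH] algebra_simps)
      also have "\<dots> \<le> e / (2 * C) * (t * C) + e / (2 * C) * (t * C)"
        by (rule order_trans[OF norm_triangle_ineq4], intro add_mono hb small) (use u t in auto)
      also have "\<dots> = e * t" using C by (simp add: field_simps)
      finally have *: "norm (h (x + (u *\<^sub>R v + t *\<^sub>R w)) - h (x + (u *\<^sub>R v + 0 *\<^sub>R w)) - t *\<^sub>R ?H w) \<le> e * t" .
      show "onorm (\<lambda>k. k *\<^sub>R (h (x + (u *\<^sub>R v + t *\<^sub>R w)) - h (x + (u *\<^sub>R v + 0 *\<^sub>R w)) - t *\<^sub>R ?H w)) \<le> e * t"
        using * by (intro onorm_le) (simp add: mult.commute mult_left_mono)
    qed (use t in auto)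
    then show ?thesis using t by (simp add: \<phi>_def power2_eq_square algebra_simps)
  qed
  then show ?thesis using \<delta> unfolding h_def by blast
qed

text \<open>Both mixed derivatives are the limit of the same second difference, which is symmetric in \<open>v\<close> and \<open>w\<close>.\<close>

lemma Cinf_on_derivative_commute:
  fixes f :: "'a::real_normed_vector \<Rightarrow> 'b::real_normed_vector"
  assumes f: "Cinf_on U f" and x: "x \<in> U"
  shows "diff_at (\<lambda>q. diff_at f q v) x w =
         diff_at (\<lambda>q. diff_at f q w) x v" (is "?L = ?R")
proof (rule ccontr)
  assume ne: "?L \<noteq> ?R"
  define e where "e = norm (?L - ?R) / 4"
  have e: "e > 0" using ne by (simp add: e_def)
  obtain d1 where d1: "d1 > 0" "\<And>t. 0 < t \<Longrightarrow> t < d1 \<Longrightarrow> 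
     norm (f (x + t *\<^sub>R v + t *\<^sub>R w) - f (x + t *\<^sub>R v) - f (x + t *\<^sub>R w) + f x - t\<^sup>2 *\<^sub>R ?L) \<le> e * t\<^sup>2"
    using Cinf_on_second_difference[OF f x e, of v w] by blast
  obtain d2 where d2: "d2 > 0" "\<And>t. 0 < t \<Longrightarrow> t < d2 \<Longrightarrow> 
     norm (f (x + t *\<^sub>R w + t *\<^sub>R v) - f (x + t *\<^sub>R w) - f (x + t *\<^sub>R v) + f x - t\<^sup>2 *\<^sub>R ?R) \<le> e * t\<^sup>2"
    using Cinf_on_second_difference[OF f x e, of w v] by blast
  define t where "t = min d1 d2 / 2"
  have t: "0 < t" "t < d1" "t < d2" using d1(1) d2(1) by (auto simp: t_def)
  define A where "A = f (x + t *\<^sub>R v + t *\<^sub>R w) - f (x + t *\<^sub>R v) - f (x + t *\<^sub>R w) + f x"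
  have A': "f (x + t *\<^sub>R w + t *\<^sub>R v) - f (x + t *\<^sub>R w) - f (x + t *\<^sub>R v) + f x = A"
    by (simp add: A_def algebra_simps)
  have "norm (t\<^sup>2 *\<^sub>R (?L - ?R)) = norm ((A - t\<^sup>2 *\<^sub>R ?R) - (A - t\<^sup>2 *\<^sub>R ?L))" by (simp add: algebra_simps)
  also have "\<dots> \<le> norm (A - t\<^sup>2 *\<^sub>R ?R) + norm (A - t\<^sup>2 *\<^sub>R ?L)" by (rule norm_triangle_ineq4)
  also have "\<dots> \<le> e * t\<^sup>2 + e * t\<^sup>2"
    using d1(2)[OF t(1,2)] d2(2)[OF t(1,3)] unfolding A' A_def[symmetric] by linarith
  finally have "t\<^sup>2 * norm (?L - ?R) \<le> t\<^sup>2 * (2 * e)" by (simp add: mult_ac)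
  then have "norm (?L - ?R) \<le> 2 * e" using t by simp
  then show False using e by (simp add: e_def)
qed


section \<open>Tangential derivatives, frames and the area density\<close>

text \<open>A derivative within the sphere is determined on tangent vectors, because each tangent vector is, up to
  scaling, the velocity of a great circle, and a derivative along a curve is unique. So the differential of a map on the
  sphere can be computed from any differentiable extension.\<close>

lemma tangential_derivative_unique:
  fixes X :: "'a::real_inner \<Rightarrow> 'b::real_normed_vector"
  assumes r: "r > 0" and p: "p \<in> sphere 0 r" and v: "v \<bullet> p = 0"
    and A: "(X has_derivative A) (at p within sphere 0 r)"
    and B: "(X has_derivative B) (at p within sphere 0 r)"
  shows "A v = B v"
proof (cases "v = 0")
  case True then show ?thesis using linear_0 has_derivative_linear A B by metis
next
  case False
  have pp: "p \<bullet> p = r\<^sup>2" using p by (auto simp: power2_norm_eq_inner[symmetric])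
  \<comment> \<open>The factor \<open>k\<close> gives \<open>v\<close> the length \<open>r\<close>, so that the curve stays on the sphere.\<close>
  define k where "k = r / norm v"
  have k: "k \<noteq> 0" using r False by (simp add: k_def)
  have kv: "k\<^sup>2 * (v \<bullet> v) = r\<^sup>2" using False by (simp add: k_def power_divide power2_norm_eq_inner)
  define c where "c t = cos t *\<^sub>R p + sin t *\<^sub>R k *\<^sub>R v" for t
  have ct: "c t \<bullet> c t = (cos t)\<^sup>2 * (p \<bullet> p) + (sin t)\<^sup>2 * (k\<^sup>2 * (v \<bullet> v))" for t
    using v by (simp add: c_def inner_simps inner_commute[of p v] power2_eq_square algebra_simps)
  have "c t \<bullet> c t = ((cos t)\<^sup>2 + (sin t)\<^sup>2) * r\<^sup>2" for t using ct[of t] by (simp only: pp kv distrib_right)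
  then have "c t \<bullet> c t = r\<^sup>2" for t by (simp only: sin_cos_squared_add2 mult_1)
  then have cS: "range c \<subseteq> sphere 0 r" using r by (auto simp: norm_eq_sqrt_inner)
  have c0: "c 0 = p" by (simp add: c_def)
  have cd: "(c has_derivative (\<lambda>h. h *\<^sub>R k *\<^sub>R v)) (at 0)"
    unfolding c_def by (auto intro!: derivative_eq_intros)
  have *: "((\<lambda>t. X (c t)) has_derivative (\<lambda>h. D (h *\<^sub>R k *\<^sub>R v))) (at 0)"
    if "(X has_derivative D) (at p within sphere 0 r)" for D
    using has_derivative_in_compose[OF cd, of X D] has_derivative_subset[OF that cS] by (simp add: c0)
  have "(\<lambda>h. A (h *\<^sub>R k *\<^sub>R v)) = (\<lambda>h. B (h *\<^sub>R k *\<^sub>R v))"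
    using has_derivative_unique[OF *[OF A] *[OF B]] .
  from fun_cong[OF this, of "1/k"] show ?thesis using k by simp
qed

lemma sphere_D_eq:
  assumes r: "r > 0" and p: "p \<in> sphere 0 r" and v: "v \<bullet> p = 0"
    and G: "(G has_derivative A) (at p)" and eq: "\<And>q. q \<in> sphere 0 r \<Longrightarrow> X q = G q"
  shows "sphere_D r X p v = A v"
proof -
  have "(X has_derivative A) (at p within sphere 0 r)"
    by (rule has_derivative_transform[OF p eq has_derivative_at_withinI[OF G]])
  moreover from this have "(X has_derivative sphere_D r X p) (at p within sphere 0 r)"
    unfolding sphere_D_def using frechet_derivative_works differentiable_def by blast
  ultimately show ?thesis using tangential_derivative_unique[OF r p v] by blast
qed


lemma norm_axis_real: "norm (axis k (c::real) :: real^'m::finite) = \<bar>c\<bar>"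
  by (simp add: norm_eq_sqrt_inner inner_axis_axis)

text \<open>Rotate the coordinate frame so that the coordinate axis of the index \<open>None\<close> points in the direction of \<open>p\<close>.\<close>

lemma tangent_frame_exists:
  fixes p :: "real^'n::finite option"
  assumes "p \<noteq> 0" shows "\<exists>e. tangent_frame p e"
proof -
  obtain T :: "real^'n option \<Rightarrow> real^'n option" where T: "orthogonal_transformation T" "T (axis None (norm p)) = p"
    using orthogonal_transformation_exists[of "axis None (norm p)" p] by (auto simp: norm_axis_real)
  have "tangent_frame p (\<lambda>i. T (axis (Some i) 1))"
    unfolding tangent_frame_def
  proof (intro conjI allI)
    fix i
    have "T (axis (Some i) 1) \<bullet> T (axis None (norm p)) = axis (Some i) 1 \<bullet> (axis None (norm p) :: real^'n option)"
      using T(1) unfolding orthogonal_transformation_def by blast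
    then show "T (axis (Some i) 1) \<bullet> p = 0" using T(2) by (simp add: inner_axis_axis)
  next
    fix i j
    have "T (axis (Some i) 1) \<bullet> T (axis (Some j) 1) = axis (Some i) 1 \<bullet> (axis (Some j) 1 :: real^'n option)"
      using T(1) unfolding orthogonal_transformation_def by blast
    then show "T (axis (Some i) 1) \<bullet> T (axis (Some j) 1) = (if i = j then 1 else 0)" by (simp add: inner_axis_axis)
  qed
  then show ?thesis by blast
qed

text \<open>The unit normal \<open>p / |p|\<close> completes a tangent frame to an orthonormal basis of the ambient space.\<close>

definition frame_column :: "real^'n::finite option \<Rightarrow> ('n \<Rightarrow> real^'n option) \<Rightarrow> 'n option \<Rightarrow> real^'n option" where
  "frame_column p e a = (case a of None \<Rightarrow> (1 / norm p) *\<^sub>R p | Some i \<Rightarrow> e i)"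

definition frame_matrix :: "real^'n::finite option \<Rightarrow> ('n \<Rightarrow> real^'n option) \<Rightarrow> real^'n option^'n option" where
  "frame_matrix p e = (\<chi> k a. frame_column p e a $ k)"

lemma frame_matrix_orthogonal:
  assumes e: "tangent_frame p e" and p: "p \<noteq> 0"
  shows "transpose (frame_matrix p e) ** frame_matrix p e = mat 1"
    and "frame_matrix p e ** transpose (frame_matrix p e) = mat 1"
proof -
  have "frame_column p e a \<bullet> frame_column p e b = (if a = b then 1 else 0)" for a b
    using e p by (cases a; cases b)
      (auto simp: frame_column_def tangent_frame_def inner_commute[of p] dot_square_norm power2_eq_square)
  then show 1: "transpose (frame_matrix p e) ** frame_matrix p e = mat 1"
    by (simp add: vec_eq_iff matrix_matrix_mult_def transpose_def frame_matrix_def mat_def inner_vec_def)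
  then show "frame_matrix p e ** transpose (frame_matrix p e) = mat 1"
    using matrix_left_right_inverse by blast
qed

lemma sum_option:
  "(\<Sum>a\<in>(UNIV :: 'n::finite option set). F a) = F None + (\<Sum>i\<in>UNIV. F (Some i))"
  by (simp add: UNIV_option_conv sum.reindex)

text \<open>The columns of the frame matrix are orthonormal, hence so are its rows.\<close>

lemma frame_completeness:
  assumes e: "tangent_frame p e" and p: "p \<noteq> 0"
  shows "(\<Sum>i\<in>UNIV. e i $ k * e i $ l) + p $ k * p $ l / (norm p)\<^sup>2 = (if k = l then 1 else 0)"
proof -
  have "(frame_matrix p e ** transpose (frame_matrix p e)) $ k $ l = (mat 1 :: real^'a option^'a option) $ k $ l"
    using frame_matrix_orthogonal(2)[OF assms] by simp
  then show ?thesis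
    by (simp add: matrix_matrix_mult_def transpose_def frame_matrix_def mat_def sum_option frame_column_def power2_eq_square)
qed

lemma bilinear_axis_expansion:
  fixes B :: "real^'m::finite \<Rightarrow> real^'m \<Rightarrow> real"
  assumes "bilinear B"
  shows "B v w = (\<Sum>k\<in>UNIV. \<Sum>l\<in>UNIV. v $ k * w $ l * B (axis k 1) (axis l 1))"
proof -
  have v: "v = (\<Sum>k\<in>UNIV. v $ k *\<^sub>R axis k 1)" for v :: "real^'m"
    by (simp add: basis_expansion scalar_mult_eq_scaleR[symmetric])
  have "B v w = B (\<Sum>k\<in>UNIV. v $ k *\<^sub>R axis k 1) (\<Sum>l\<in>UNIV. w $ l *\<^sub>R axis l 1)"
    using v[of v] v[of w] by simp
  also have "\<dots> = (\<Sum>k\<in>UNIV. \<Sum>l\<in>UNIV. B (v $ k *\<^sub>R axis k 1) (w $ l *\<^sub>R axis l 1))"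
    by (subst bilinear_sum[OF assms]) (simp add: sum.cartesian_product)
  finally show ?thesis by (simp add: bilinear_lmul[OF assms] bilinear_rmul[OF assms] mult_ac)
qed

text \<open>This replaces sums over a frame, which depends on the point in an uncontrolled way, by expressions in the
  coordinates, which are smooth in the point.\<close>

lemma frame_trace:
  fixes B :: "real^'n::finite option \<Rightarrow> real^'n option \<Rightarrow> real"
  assumes e: "tangent_frame p e" and p: "p \<noteq> 0" and B: "bilinear B"
  shows "(\<Sum>i\<in>UNIV. B (e i) (e i)) = (\<Sum>k\<in>UNIV. B (axis k 1) (axis k 1)) - B p p / (norm p)\<^sup>2"
proof -
  let ?b = "\<lambda>k l. B (axis k 1) (axis l 1)"
  have "(\<Sum>i\<in>UNIV. B (e i) (e i)) + B p p / (norm p)\<^sup>2 =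
    (\<Sum>k\<in>UNIV. \<Sum>l\<in>UNIV. ((\<Sum>i\<in>UNIV. e i $ k * e i $ l) + p $ k * p $ l / (norm p)\<^sup>2) * ?b k l)"
  proof -
    have "(\<Sum>i\<in>UNIV. B (e i) (e i)) = (\<Sum>i\<in>UNIV. \<Sum>k\<in>UNIV. \<Sum>l\<in>UNIV. e i $ k * e i $ l * ?b k l)"
      by (intro sum.cong refl bilinear_axis_expansion[OF B])
    also have "\<dots> = (\<Sum>k\<in>UNIV. \<Sum>i\<in>UNIV. \<Sum>l\<in>UNIV. e i $ k * e i $ l * ?b k l)" by (rule sum.swap)
    also have "\<dots> = (\<Sum>k\<in>UNIV. \<Sum>l\<in>UNIV. \<Sum>i\<in>UNIV. e i $ k * e i $ l * ?b k l)" 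
      by (intro sum.cong refl sum.swap)
    also have "\<dots> = (\<Sum>k\<in>UNIV. \<Sum>l\<in>UNIV. (\<Sum>i\<in>UNIV. e i $ k * e i $ l) * ?b k l)"
      by (simp only: sum_distrib_right)
    finally have 1: "(\<Sum>i\<in>UNIV. B (e i) (e i)) = (\<Sum>k\<in>UNIV. \<Sum>l\<in>UNIV. (\<Sum>i\<in>UNIV. e i $ k * e i $ l) * ?b k l)" .
    have 2: "B p p / (norm p)\<^sup>2 = (\<Sum>k\<in>UNIV. \<Sum>l\<in>UNIV. (p $ k * p $ l / (norm p)\<^sup>2) * ?b k l)"
      by (subst bilinear_axis_expansion[OF B]) (simp add: sum_divide_distrib)
    show ?thesis unfolding 1 2 by (simp add: sum.distrib distrib_right)
  qed
  also have "\<dots> = (\<Sum>k\<in>UNIV. \<Sum>l\<in>UNIV. if k = l then ?b k k else 0)"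
    unfolding frame_completeness[OF e p] by (intro sum.cong refl) auto
  also have "\<dots> = (\<Sum>k\<in>UNIV. ?b k k)" by simp
  finally show ?thesis by simp
qed

text \<open>Only permutations that fix \<open>None\<close> contribute to the Leibniz formula, and these are the permutations of the
  remaining indices, with the same sign.\<close>

lemma det_option_block:
  fixes M :: "real^'n::finite option^'n option"
  assumes M: "\<And>i. M $ Some i $ None = 0" "M $ None $ None = 1"
  shows "det M = det (\<chi> i j. M $ Some i $ Some j)"
proof -
  let ?P = "{\<pi>. \<pi> permutes (UNIV :: 'n option set)}"
  let ?Fix = "{\<pi> \<in> ?P. \<pi> None = None}"
  let ?Q = "{\<pi>. \<pi> permutes (UNIV :: 'n set)}"
  let ?t = "\<lambda>\<pi>. of_int (sign \<pi>) * (\<Prod>a\<in>UNIV. M $ a $ \<pi> a)"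
  have z: "?t \<pi> = 0" if "\<pi> \<in> ?P - ?Fix" for \<pi>
  proof -
    have \<pi>: "\<pi> permutes UNIV" "\<pi> None \<noteq> None" using that by auto
    obtain a where a: "\<pi> a = None" using permutes_surj[OF \<pi>(1)] by (metis surjD)
    then obtain i where "a = Some i" using \<pi>(2) by (cases a) auto
    then have "M $ a $ \<pi> a = 0" using M(1) a by simp
    then have "(\<Prod>a\<in>UNIV. M $ a $ \<pi> a) = 0" by (intro prod_zero) auto
    then show ?thesis by simp
  qed
  have "det M = (\<Sum>\<pi>\<in>?Fix. ?t \<pi>)"
    unfolding det_def
  proof (rule sum.mono_neutral_right)
    show "finite ?P" by (simp add: finite_permutations)
    show "?Fix \<subseteq> ?P" by blast
    show "\<forall>\<pi>\<in>?P - ?Fix. ?t \<pi> = 0" using z by (rule ballI)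
  qed
  also have "\<dots> = (\<Sum>\<sigma>\<in>?Q. ?t (map_option \<sigma>))"
  proof (rule sum.reindex_bij_betw[symmetric])
    have "inj_on map_option ?Q" 
    proof (rule inj_onI)
      fix \<sigma> \<tau> :: "'n \<Rightarrow> 'n" assume eq: "map_option \<sigma> = map_option \<tau>"
      show "\<sigma> = \<tau>"
      proof
        show "\<sigma> i = \<tau> i" for i using fun_cong[OF eq, of "Some i"] by simp
      qed
    qed
    moreover have "map_option \<sigma> \<in> ?Fix" if "\<sigma> \<in> ?Q" for \<sigma>
    proof -
      have "inj (map_option \<sigma>)" using that permutes_inj by (blast intro: option.inj_map)
      then have "bij (map_option \<sigma>)" using finite_UNIV_inj_surj[of "map_option \<sigma>"] by (simp add: bij_def)
      then show ?thesis using bij_imp_permutes[of "map_option \<sigma>" UNIV] by simp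
    qed
    moreover have "\<pi> \<in> map_option ` ?Q" if "\<pi> \<in> ?Fix" for \<pi>
    proof -
      have inj: "inj \<pi>" and N: "\<pi> None = None" using that permutes_inj by auto
      have S: "\<pi> (Some i) = Some (the (\<pi> (Some i)))" for i
        using inj N by (metis injD option.collapse option.distinct(1))
      define \<sigma> where "\<sigma> i = the (\<pi> (Some i))" for i
      have "inj \<sigma>" by (rule injI) (metis S \<sigma>_def inj injD option.inject)
      then have "bij \<sigma>" using finite_UNIV_inj_surj[of \<sigma>] by (simp add: bij_def)
      then have "\<sigma> \<in> ?Q" using bij_imp_permutes[of \<sigma> UNIV] by simp
      moreover have "\<pi> = map_option \<sigma>"
      proof
        fix a show "\<pi> a = map_option \<sigma> a" using N S by (cases a) (auto simp: \<sigma>_def)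
      qed
      ultimately show ?thesis by blast
    qed
    ultimately show "bij_betw map_option ?Q ?Fix" unfolding bij_betw_def by blast
  qed
  also have "\<dots> = (\<Sum>\<sigma>\<in>?Q. of_int (sign \<sigma>) * (\<Prod>i\<in>UNIV. M $ Some i $ Some (\<sigma> i)))"
  proof (rule sum.cong[OF refl])
    fix \<sigma> assume "\<sigma> \<in> ?Q"
    then have \<sigma>: "\<sigma> permutes UNIV" by simp
    have "map_option \<sigma> = map_permutation UNIV Some \<sigma>"
    proof
      show "map_option \<sigma> a = map_permutation UNIV Some \<sigma> a" for a
        by (cases a) (auto simp: map_permutation_def restrict_id_def)
    qed
    then have "sign (map_option \<sigma>) = sign \<sigma>" using sign_map_permutation[of Some UNIV \<sigma>] \<sigma> by simp
    moreover have "(\<Prod>a\<in>UNIV. M $ a $ map_option \<sigma> a) = (\<Prod>i\<in>UNIV. M $ Some i $ Some (\<sigma> i))"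
      by (simp add: UNIV_option_conv prod.reindex M)
    ultimately show "?t (map_option \<sigma>) = of_int (sign \<sigma>) * (\<Prod>i\<in>UNIV. M $ Some i $ Some (\<sigma> i))" by simp
  qed
  finally show ?thesis by (simp add: det_def)
qed

text \<open>The form \<open>\<langle>A(Pv), A(Pw)\<rangle> + \<langle>v,p\<rangle>\<langle>w,p\<rangle> / r\<^sup>2\<close> in the standard coordinates, where \<open>P\<close> is the projection
  onto the tangent space at \<open>p\<close>. Its determinant is the squared area density and is smooth in \<open>p\<close>, whereas the frame in the
  definition of the area density is an arbitrary choice at each point.\<close>

definition gram_matrix :: "real \<Rightarrow> (real^'n::finite option \<Rightarrow> real^'n option) \<Rightarrow> real^'n option \<Rightarrow> real^'n option^'n option" where
  "gram_matrix r A p = (\<chi> k l.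
     A (axis k 1 - (p $ k / r\<^sup>2) *\<^sub>R p) \<bullet> A (axis l 1 - (p $ l / r\<^sup>2) *\<^sub>R p) + p $ k * p $ l / r\<^sup>2)"

text \<open>In the orthonormal basis formed by the frame and the unit normal, the matrix is the block sum of the Gram matrix
  of the frame and the number one.\<close>

lemma det_gram_matrix:
  fixes A :: "real^'n::finite option \<Rightarrow> real^'n option"
  assumes r: "r > 0" and p: "p \<in> sphere 0 r" and A: "linear A" and e: "tangent_frame p e"
  shows "det (gram_matrix r A p) = det (\<chi> i j. A (e i) \<bullet> A (e j))"
proof -
  have np: "norm p = r" and p0: "p \<noteq> 0" and pp: "p \<bullet> p = r\<^sup>2" 
    using p r by (auto simp: power2_norm_eq_inner[symmetric])
  let ?Q = "frame_matrix p e" and ?M = "gram_matrix r A p"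
  define P where "P v = v - (v \<bullet> p / r\<^sup>2) *\<^sub>R p" for v
  define B where "B v w = A (P v) \<bullet> A (P w) + (v \<bullet> p) * (w \<bullet> p) / r\<^sup>2" for v w
  have lP: "linear P" unfolding P_def by (rule linearI) (simp_all add: inner_add_left add_divide_distrib algebra_simps)
  have lAP: "linear (\<lambda>v. A (P v))" using linear_compose[OF lP A] by (simp add: o_def)
  have bB: "bilinear B"
    unfolding bilinear_def B_def
    by (auto intro!: linearI simp: linear_add[OF lAP] linear_scale[OF lAP] inner_simps add_divide_distrib algebra_simps)
  have M: "?M $ k $ l = B (axis k 1) (axis l 1)" for k l
    by (simp add: gram_matrix_def B_def P_def inner_axis')
  have "(transpose ?Q ** ?M ** ?Q) $ a $ b = B (frame_column p e a) (frame_column p e b)" for a b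
    unfolding bilinear_axis_expansion[OF bB, of "frame_column p e a"]
    by (simp add: matrix_matrix_mult_def transpose_def frame_matrix_def M sum_distrib_right sum_distrib_left mult_ac)
       (subst sum.swap, simp add: mult_ac)
  then have Q: "transpose ?Q ** ?M ** ?Q = (\<chi> a b. B (frame_column p e a) (frame_column p e b))"
    by (simp add: vec_eq_iff)
  have Pe: "P (e i) = e i" "e i \<bullet> p = 0" for i using e by (simp_all add: P_def tangent_frame_def)
  have P0: "P ((1 / r) *\<^sub>R p) = 0" using r pp by (simp add: P_def power2_eq_square)
  have A0: "A 0 = 0" using linear_0[OF A] .
  have d: "det (transpose ?Q) * det ?Q = 1"
    using frame_matrix_orthogonal(1)[OF e p0] by (metis det_I det_mul)
  have "det (transpose ?Q ** ?M ** ?Q) = det ?M" 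
    using d by (simp add: det_mul mult.commute mult.left_commute)
  then have "det ?M = det (\<chi> a b. B (frame_column p e a) (frame_column p e b))" using Q by simp
  also have "\<dots> = det (\<chi> i j. B (e i) (e j))"
    by (subst det_option_block) (use r np pp in \<open>simp_all add: frame_column_def B_def P0 A0 Pe power2_eq_square\<close>)
  also have "(\<chi> i j. B (e i) (e j)) = (\<chi> i j. A (e i) \<bullet> A (e j))"
    by (simp add: B_def Pe)
  finally show ?thesis .
qed

lemma area_density_eq:
  fixes X :: "real^'n::finite option \<Rightarrow> real^'n option"
  assumes r: "r > 0" and p: "p \<in> sphere 0 r"
    and G: "(G has_derivative A) (at p)" and eq: "\<And>q. q \<in> sphere 0 r \<Longrightarrow> X q = G q"
  shows "area_density r X p = sqrt (det (gram_matrix r A p))"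
proof -
  have "p \<noteq> 0" using p r by auto
  then have e: "tangent_frame p (SOME e. tangent_frame p e)" using someI_ex[OF tangent_frame_exists] by blast
  then have "sphere_D r X p ((SOME e. tangent_frame p e) i) = A ((SOME e. tangent_frame p e) i)" for i
    using sphere_D_eq[OF r p _ G eq] by (simp add: tangent_frame_def)
  then show ?thesis
    unfolding area_density_def Let_def det_gram_matrix[OF r p has_derivative_linear[OF G] e] by simp
qed

section \<open>The surface measure of the round sphere\<close>

lemma sphere_measure_space [simp]: "space (sphere_measure r) = sphere 0 r"
  by (simp add: sphere_measure_def space_scale_measure)

lemma sphere_measure_sets: "sets (sphere_measure r) = sets (restrict_space borel (sphere 0 r))"
  by (simp add: sphere_measure_def)

lemma radial_projection_measurable:
  assumes "r > 0"
  shows "(\<lambda>x. (r / norm x) *\<^sub>R x) \<in> restrict_space lborel (cball 0 r - {0})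
           \<rightarrow>\<^sub>M restrict_space borel (sphere 0 r :: (real^'n::finite option) set)"
proof (rule measurable_restrict_space2)
  show "(\<lambda>x. (r / norm x) *\<^sub>R x) \<in> space (restrict_space lborel (cball 0 r - {0})) \<rightarrow> sphere 0 r"
    using assms by (auto simp: space_restrict_space)
  show "(\<lambda>x. (r / norm x) *\<^sub>R x) \<in> restrict_space lborel (cball 0 r - {0}) \<rightarrow>\<^sub>M borel"
    by (intro measurable_restrict_space1) measurable
qed

lemma emeasure_sphere_measure:
  assumes "r > 0" "A \<in> sets borel" "A \<subseteq> (sphere 0 r :: (real^'n::finite option) set)"
  shows "emeasure (sphere_measure r) A = ennreal ((real CARD('n) + 1) / r) *
     emeasure lborel {x \<in> cball 0 r - {0}. (r / norm x) *\<^sub>R x \<in> A}"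
    and "{x \<in> cball 0 r - {0}. (r / norm x) *\<^sub>R x \<in> A} \<in> sets borel"
proof -
  have A: "A \<in> sets (restrict_space borel (sphere 0 r))"
    using assms by (auto simp: sets_restrict_space_iff)
  have c: "cball 0 r - {0} \<in> sets (borel :: (real^'n option) measure)" by auto
  have *: "(\<lambda>x. (r / norm x) *\<^sub>R x) -` A \<inter> space (restrict_space lborel (cball 0 r - {0}))
    = {x \<in> cball 0 r - {0}. (r / norm x) *\<^sub>R x \<in> A}" 
    by (auto simp: space_restrict_space)
  show "emeasure (sphere_measure r) A = ennreal ((real CARD('n) + 1) / r) *
     emeasure lborel {x \<in> cball 0 r - {0}. (r / norm x) *\<^sub>R x \<in> A}"
    unfolding sphere_measure_def emeasure_scale_measure
      emeasure_distr[OF radial_projection_measurable[OF assms(1)] A] *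
    by (subst emeasure_restrict_space) (use c in auto)
  have "(\<lambda>x. (r / norm x) *\<^sub>R x) -` A \<inter> space (restrict_space lborel (cball 0 r - {0})) 
      \<in> sets (restrict_space lborel (cball 0 r - {0}))"
    by (rule measurable_sets[OF radial_projection_measurable[OF assms(1)] A])
  then show "{x \<in> cball 0 r - {0}. (r / norm x) *\<^sub>R x \<in> A} \<in> sets borel"
    unfolding * using c by (subst (asm) sets_restrict_space_iff) auto
qed

lemma sphere_measure_finite_pos:
  assumes "r > 0"
  shows "finite_measure (sphere_measure r :: (real^'n::finite option) measure)"
    and "measure (sphere_measure r :: (real^'n::finite option) measure) (sphere 0 r) > 0"
proof -
  have "{x \<in> cball 0 r - {0}. (r / norm x) *\<^sub>R x \<in> sphere 0 r} = (cball 0 r - {0} :: (real^'n option) set)"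
    using assms by auto
  moreover have "emeasure lborel (cball 0 r - {0} :: (real^'n option) set) = emeasure lborel (cball 0 r :: (real^'n option) set)"
    by (rule emeasure_Diff_null_set) auto
  ultimately have e: "emeasure (sphere_measure r :: (real^'n option) measure) (sphere 0 r)
     = ennreal ((real CARD('n) + 1) / r) * emeasure lborel (cball 0 r :: (real^'n option) set)"
    using emeasure_sphere_measure(1)[of r "sphere 0 r :: (real^'n option) set"] assms by simp
  also have "\<dots> = ennreal ((real CARD('n) + 1) / r * measure lborel (cball 0 r :: (real^'n option) set))"
    using emeasure_lborel_cball_finite[of "0::real^'n option" r] assms
    by (subst emeasure_eq_ennreal_measure) (auto simp: ennreal_mult[symmetric])
  finally have e: "emeasure (sphere_measure r :: (real^'n option) measure) (sphere 0 r) = 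
     ennreal ((real CARD('n) + 1) / r * measure lborel (cball 0 r :: (real^'n option) set))" .
  show "finite_measure (sphere_measure r :: (real^'n::finite option) measure)"
    using e by (intro finite_measureI) auto
  have "0 < (real CARD('n) + 1) / r * measure lborel (cball 0 r :: (real^'n option) set)"
    using content_cball_pos[of r "0::real^'n option"] assms by (intro mult_pos_pos) auto
  then show "measure (sphere_measure r :: (real^'n::finite option) measure) (sphere 0 r) > 0"
    using e by (simp add: measure_def)
qed

lemma sphere_measurable_continuous:
  "continuous_on (sphere 0 r) g \<Longrightarrow> g \<in> borel_measurable (sphere_measure r)"
  using borel_measurable_continuous_on_restrict measurable_cong_sets[OF sphere_measure_sets refl] by blast

lemma sphere_integrable_continuous:
  fixes g :: "real^'n::finite option \<Rightarrow> real"
  assumes "r > 0" "continuous_on (sphere 0 r) g"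
  shows "integrable (sphere_measure r) g"
proof -
  interpret finite_measure "sphere_measure r :: (real^'n option) measure"
    by (rule sphere_measure_finite_pos[OF assms(1)])
  have "compact (g ` sphere 0 r)" using assms by (intro compact_continuous_image) auto
  then obtain B where B: "\<And>x. x \<in> sphere 0 r \<Longrightarrow> norm (g x) \<le> B"
    by (meson bounded_iff compact_imp_bounded imageI)
  show ?thesis
    by (rule integrable_const_bound[where B=B])
       (use B assms sphere_measurable_continuous in auto)
qed

text \<open>The uniqueness argument for Haar measure. With \<open>A\<close> the unit ball, the integral of
  \<open>1\<^sub>A(x) 1\<^sub>B(T y)\<close> over \<open>x\<close> and \<open>y\<close> is transformed by translations and Fubini into that of \<open>1\<^sub>A(T y) 1\<^sub>B(x)\<close>. As \<open>T\<close>
  preserves the ball, its positive finite volume cancels.\<close>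

lemma emeasure_lborel_orthogonal_vimage:
  fixes T :: "'a::euclidean_space \<Rightarrow> 'a"
  assumes T: "orthogonal_transformation T" and B: "B \<in> sets borel"
  shows "emeasure lborel (T -` B) = emeasure lborel B"
proof -
  have lin: "linear T" and nT: "norm (T x) = norm x" for x 
    using T orthogonal_transformation_linear orthogonal_transformation_norm by auto
  have surjT: "T (inv T x) = x" for x
    using orthogonal_transformation_surj[OF T] by (simp add: surj_f_inv_f)
  have [measurable]: "T \<in> borel_measurable borel"
    using lin linear_conv_bounded_linear linear_continuous_on
    by (intro borel_measurable_continuous_onI) blast
  have shift: "(\<integral>\<^sup>+x. g x \<partial>lborel) = (\<integral>\<^sup>+x. g (c + x) \<partial>lborel)" if [measurable]: "g \<in> borel_measurable borel"
    for c and g :: "'a \<Rightarrow> ennreal"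
    by (subst lborel_distr_plus[of c, symmetric]) (simp add: nn_integral_distr)
  have refl: "(\<integral>\<^sup>+x. g x \<partial>lborel) = (\<integral>\<^sup>+x. g (c - x) \<partial>lborel)" if [measurable]: "g \<in> borel_measurable borel"
    for c and g :: "'a \<Rightarrow> ennreal"
    by (subst lborel_affine[of "-1" c]) (simp_all add: nn_integral_density nn_integral_distr)
  let ?A = "ball (0::'a) 1"
  let ?i = "indicator :: 'a set \<Rightarrow> 'a \<Rightarrow> ennreal"
  have [measurable]: "B \<in> sets borel" "?A \<in> sets borel" using B by auto
  have vB: "T -` B \<in> sets borel" using measurable_sets[OF \<open>T \<in> borel_measurable borel\<close> B] by simp
  have iB: "(\<integral>\<^sup>+y. ?i B (T y) \<partial>lborel) = emeasure lborel (T -` B)"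
  proof -
    have "(\<integral>\<^sup>+y. ?i B (T y) \<partial>lborel) = (\<integral>\<^sup>+y. ?i (T -` B) y \<partial>lborel)" by (simp add: indicator_def)
    then show ?thesis using vB by simp
  qed
  have iA: "(\<integral>\<^sup>+y. ?i ?A (T y) \<partial>lborel) = emeasure lborel ?A"
  proof -
    have "(\<integral>\<^sup>+y. ?i ?A (T y) \<partial>lborel) = (\<integral>\<^sup>+y. ?i ?A y \<partial>lborel)" by (simp add: indicator_def nT)
    also have "\<dots> = emeasure lborel ?A" by (rule nn_integral_indicator) simp
    finally show "(\<integral>\<^sup>+y. ?i ?A (T y) \<partial>lborel) = emeasure lborel ?A" .
  qed
  have "emeasure lborel ?A * emeasure lborel (T -` B) = (\<integral>\<^sup>+y. (\<integral>\<^sup>+x. ?i ?A x * ?i B (T y) \<partial>lborel) \<partial>lborel)"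
    by (simp add: nn_integral_multc nn_integral_cmult iB)
  also have "\<dots> = (\<integral>\<^sup>+y. (\<integral>\<^sup>+x. ?i ?A (T y + x) * ?i B (T y) \<partial>lborel) \<partial>lborel)"
    by (intro nn_integral_cong shift[where g="\<lambda>x. ?i ?A x * ?i B (T _)"]) measurable
  also have "\<dots> = (\<integral>\<^sup>+x. (\<integral>\<^sup>+y. ?i ?A (T y + x) * ?i B (T y) \<partial>lborel) \<partial>lborel)"
    by (rule lborel_pair.Fubini') measurable
  also have "\<dots> = (\<integral>\<^sup>+x. (\<integral>\<^sup>+y. ?i ?A (T y) * ?i B (T y - x) \<partial>lborel) \<partial>lborel)"
  proof (rule nn_integral_cong)
    fix x
    show "(\<integral>\<^sup>+y. ?i ?A (T y + x) * ?i B (T y) \<partial>lborel) = (\<integral>\<^sup>+y. ?i ?A (T y) * ?i B (T y - x) \<partial>lborel)"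
      by (subst shift[where g="\<lambda>y. ?i ?A (T y + x) * ?i B (T y)" and c="- inv T x"], measurable)
         (simp add: linear_diff[OF lin] surjT linear_add[OF lin] linear_neg[OF lin])
  qed
  also have "\<dots> = (\<integral>\<^sup>+y. (\<integral>\<^sup>+x. ?i ?A (T y) * ?i B (T y - x) \<partial>lborel) \<partial>lborel)"
    by (rule lborel_pair.Fubini') measurable
  also have "\<dots> = (\<integral>\<^sup>+y. ?i ?A (T y) * emeasure lborel B \<partial>lborel)"
    by (intro nn_integral_cong) (simp add: nn_integral_cmult refl[symmetric])
  also have "\<dots> = emeasure lborel ?A * emeasure lborel B"
    by (simp add: nn_integral_multc iA)
  finally have "emeasure lborel ?A * emeasure lborel (T -` B) = emeasure lborel ?A * emeasure lborel B" .
  moreover have "emeasure lborel ?A \<noteq> 0" "emeasure lborel ?A \<noteq> top"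
    using emeasure_bounded_finite[of ?A] content_ball_pos[of 1 "0::'a"] by (auto simp: measure_def)
  ultimately show ?thesis by (simp add: ennreal_mult_cancel_left)
qed

text \<open>The radial projection that defines the surface measure commutes with orthogonal maps, which preserve the ball
  and Lebesgue measure.\<close>

lemma sphere_integral_orthogonal:
  fixes T :: "real^'n::finite option \<Rightarrow> real^'n option" and g :: "real^'n option \<Rightarrow> real"
  assumes "r > 0" "orthogonal_transformation T" "continuous_on (sphere 0 r) g"
  shows "(\<integral>p. g (T p) \<partial>sphere_measure r) = (\<integral>p. g p \<partial>sphere_measure r)"
proof -
  let ?S = "sphere 0 r :: (real^'n option) set"
  have nT: "norm (T x) = norm x" for x using orthogonal_transformation_norm[OF assms(2)] .
  have cT: "continuous_on A T" for A
    using orthogonal_transformation_linear[OF assms(2)] linear_conv_bounded_linear linear_continuous_on by blast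
  have mT0: "T \<in> restrict_space borel ?S \<rightarrow>\<^sub>M restrict_space borel ?S"
    by (intro measurable_restrict_space2 borel_measurable_continuous_on_restrict cT) (auto simp: nT)
  then have mT: "T \<in> sphere_measure r \<rightarrow>\<^sub>M sphere_measure r"
    by (simp add: measurable_cong_sets[OF sphere_measure_sets sphere_measure_sets])
  have "distr (sphere_measure r) (sphere_measure r) T = sphere_measure r"
  proof (rule measure_eqI)
    fix A assume A: "A \<in> sets (distr (sphere_measure r) (sphere_measure r) T)"
    then have A1: "A \<in> sets (sphere_measure r)" by simp
    then have A2: "A \<in> sets borel" "A \<subseteq> ?S"
      by (simp_all add: sphere_measure_sets sets_restrict_space_iff)
    have "T -` A \<inter> ?S \<in> sets (sphere_measure r)"
      using measurable_sets[OF mT A1] by simp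
    then have B: "T -` A \<inter> ?S \<in> sets borel"
      by (simp add: sphere_measure_sets sets_restrict_space_iff)
    let ?C = "{x \<in> cball 0 r - {0}. (r / norm x) *\<^sub>R x \<in> A}"
    have T0: "T x = 0 \<longleftrightarrow> x = 0" for x using nT[of x] by (metis norm_eq_zero)
    have "{x \<in> cball 0 r - {0}. (r / norm x) *\<^sub>R x \<in> T -` A \<inter> ?S} = T -` ?C"
      using assms(1) by (auto simp: nT T0 orthogonal_transformation_scaleR[OF assms(2)])
    then have "emeasure (sphere_measure r) (T -` A \<inter> ?S) = emeasure (sphere_measure r) A"
      using emeasure_lborel_orthogonal_vimage[OF assms(2) emeasure_sphere_measure(2)[OF assms(1) A2]]
      by (simp add: emeasure_sphere_measure(1)[OF assms(1) A2] emeasure_sphere_measure(1)[OF assms(1) B])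
    then show "emeasure (distr (sphere_measure r) (sphere_measure r) T) A = emeasure (sphere_measure r) A"
      by (simp add: emeasure_distr[OF mT A1])
  qed simp
  then show ?thesis
    using integral_distr[OF mT sphere_measurable_continuous[OF assms(3)]] by simp
qed

text \<open>The sphere is compact, so the difference quotients converge uniformly, and the measure is finite.\<close>

lemma sphere_integral_has_derivative:
  fixes \<Phi> \<Phi>' :: "real \<Rightarrow> real^'n::finite option \<Rightarrow> real"
  assumes r: "r > 0" and s: "\<bar>s\<bar> < \<delta>"
    and c: "\<And>s. \<bar>s\<bar> < \<delta> \<Longrightarrow> continuous_on (sphere 0 r) (\<Phi> s)"
    and c': "continuous_on ({-\<delta><..<\<delta>} \<times> sphere 0 r) (\<lambda>(s, p). \<Phi>' s p)"
    and D: "\<And>s p. \<bar>s\<bar> < \<delta> \<Longrightarrow> p \<in> sphere 0 r \<Longrightarrow> ((\<lambda>s. \<Phi> s p) has_real_derivative \<Phi>' s p) (at s)"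
  shows "((\<lambda>s. \<integral>p. \<Phi> s p \<partial>sphere_measure r) has_real_derivative (\<integral>p. \<Phi>' s p \<partial>sphere_measure r)) (at s)"
proof -
  let ?M = "sphere_measure r :: (real^'n option) measure"
  interpret finite_measure ?M by (rule sphere_measure_finite_pos[OF r])
  define \<rho> where "\<rho> = (\<delta> - \<bar>s\<bar>) / 2"
  have \<rho>: "\<rho> > 0" "\<bar>s\<bar> + \<rho> < \<delta>" using s by (auto simp: \<rho>_def field_simps)
  let ?I = "{s-\<rho>..s+\<rho>}"
  have I: "\<bar>x\<bar> < \<delta>" if "x \<in> ?I" for x using that \<rho> by auto
  have uc: "uniformly_continuous_on (?I \<times> sphere 0 r) (\<lambda>(s, p). \<Phi>' s p)"
    using \<rho> by (intro compact_uniformly_continuous compact_Times continuous_on_subset[OF c']) auto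
  have c1: "continuous_on (sphere 0 r) (\<Phi>' x)" if "x \<in> ?I" for x
    using I[OF that] by (intro continuous_on_compose2[OF c', of _ "\<lambda>p. (x, p)", simplified] continuous_intros) (auto simp: abs_less_iff)
  define V where "V = measure ?M (sphere 0 r)"
  have V: "V > 0" unfolding V_def using sphere_measure_finite_pos(2)[OF r] .
  let ?F = "\<lambda>s. \<integral>p. \<Phi> s p \<partial>?M"
  have "\<exists>d>0. \<forall>x. norm (x - s) < d \<longrightarrow> norm (?F x - ?F s - (x - s) * (\<integral>p. \<Phi>' s p \<partial>?M)) \<le> e * norm (x - s)"
    if "e > 0" for e
  proof -
    have "e / V > 0" using that V by simp
    then obtain d where d: "d > 0" and dd: "\<And>a b. a \<in> ?I \<times> sphere 0 r \<Longrightarrow> b \<in> ?I \<times> sphere 0 r \<Longrightarrow> dist b a < d \<Longrightarrow>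
       dist ((\<lambda>(s, p). \<Phi>' s p) b) ((\<lambda>(s, p). \<Phi>' s p) a) < e / V"
      using uc unfolding uniformly_continuous_on_def by metis
    have "norm (?F x - ?F s - (x - s) * (\<integral>p. \<Phi>' s p \<partial>?M)) \<le> e * norm (x - s)" if x: "norm (x - s) < min d \<rho>" for x
    proof -
      have xI: "x \<in> ?I" and sI: "s \<in> ?I" using x \<rho> by (auto simp: abs_less_iff)
      have bound: "norm (\<Phi> x p - \<Phi> s p - (x - s) * \<Phi>' s p) \<le> e / V * norm (x - s)" if p: "p \<in> sphere 0 r" for p
      proof -
        let ?J = "closed_segment s x"
        have J: "?J \<subseteq> ?I" using xI sI by (auto simp: closed_segment_eq_real_ivl split: if_splits)
        have "norm ((\<Phi> x p - x * \<Phi>' s p) - (\<Phi> s p - s * \<Phi>' s p)) \<le> e / V * norm (x - s)"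
        proof (rule field_differentiable_bound[where S="?J" and f'="\<lambda>z. \<Phi>' z p - \<Phi>' s p"])
          fix z assume z: "z \<in> ?J"
          have zI: "z \<in> ?I" using z J by auto
          show "((\<lambda>z. \<Phi> z p - z * \<Phi>' s p) has_field_derivative \<Phi>' z p - \<Phi>' s p) (at z within ?J)"
            using D[OF I[OF zI] p] by (auto intro!: derivative_eq_intros intro: has_field_derivative_at_within)
          have "\<bar>z - s\<bar> < d" using z x by (auto simp: closed_segment_eq_real_ivl split: if_splits)
          then show "norm (\<Phi>' z p - \<Phi>' s p) \<le> e / V"
            using dd[of "(s, p)" "(z, p)"] zI sI p by (auto simp: dist_Pair_Pair dist_real_def)
        qed auto
        then show ?thesis by (simp add: algebra_simps)
      qed
      have i: "integrable ?M (\<Phi> x)" "integrable ?M (\<Phi> s)" "integrable ?M (\<Phi>' s)"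
        using c[OF I[OF xI]] c[OF I[OF sI]] c1[OF sI] by (auto intro!: sphere_integrable_continuous r)
      have "?F x - ?F s - (x - s) * (\<integral>p. \<Phi>' s p \<partial>?M) = (\<integral>p. \<Phi> x p - \<Phi> s p - (x - s) * \<Phi>' s p \<partial>?M)"
        using i by simp
      also have "norm \<dots> \<le> (\<integral>p. norm (\<Phi> x p - \<Phi> s p - (x - s) * \<Phi>' s p) \<partial>?M)"
        by (rule integral_norm_bound)
      also have "\<dots> \<le> (\<integral>p. e / V * norm (x - s) \<partial>?M)"
        using i bound by (intro integral_mono) auto
      also have "\<dots> = e * norm (x - s)" using V by (simp add: V_def)
      finally show ?thesis .
    qed
    then show ?thesis using d \<rho> by (intro exI[of _ "min d \<rho>"]) auto
  qed
  then show ?thesis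
    unfolding has_field_derivative_def has_derivative_at_alt
    by (auto simp: bounded_linear_mult_right mult.commute)
qed

section \<open>The divergence theorem on the sphere\<close>

text \<open>The rotation by the angle \<open>\<theta>\<close> in the plane spanned by the orthonormal vectors \<open>e\<close> and \<open>f\<close>; it fixes the
  orthogonal complement of that plane.\<close>

definition rotation :: "'a::real_inner \<Rightarrow> 'a \<Rightarrow> real \<Rightarrow> 'a \<Rightarrow> 'a" where
  "rotation e f \<theta> p = p + (cos \<theta> - 1) *\<^sub>R ((p \<bullet> e) *\<^sub>R e + (p \<bullet> f) *\<^sub>R f)
     + sin \<theta> *\<^sub>R ((p \<bullet> f) *\<^sub>R e - (p \<bullet> e) *\<^sub>R f)"

lemma rotation_orthogonal:
  assumes "e \<bullet> e = 1" "f \<bullet> f = 1" "e \<bullet> f = 0"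
  shows "orthogonal_transformation (rotation e f \<theta>)"
proof -
  have fe: "f \<bullet> e = 0" using assms by (simp add: inner_commute)
  have "linear (rotation e f \<theta>)"
    unfolding rotation_def by (rule linearI) (simp_all add: inner_simps algebra_simps)
  moreover have "rotation e f \<theta> p \<bullet> rotation e f \<theta> p = p \<bullet> p" for p
  proof -
    define a b where "a = p \<bullet> e" and "b = p \<bullet> f"
    define c s where "c = cos \<theta>" and "s = sin \<theta>"
    have ab: "e \<bullet> p = a" "f \<bullet> p = b" "p \<bullet> e = a" "p \<bullet> f = b" by (simp_all add: a_def b_def inner_commute)
    have "rotation e f \<theta> p \<bullet> rotation e f \<theta> p = p \<bullet> p + (a\<^sup>2 + b\<^sup>2) * (c\<^sup>2 + s\<^sup>2 - 1)"
      unfolding rotation_def c_def[symmetric] s_def[symmetric] 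
      by (simp add: inner_simps ab assms fe) algebra
    then show ?thesis by (simp add: c_def s_def)
  qed
  ultimately show ?thesis unfolding orthogonal_transformation by (simp add: norm_eq_sqrt_inner)
qed

text \<open>The integral of \<open>g\<close> along a one-parameter group of rotations is constant, and the integrand here is its derivative
  at the identity.\<close>

lemma integral_rotation_field:
  fixes g :: "real^'n::finite option \<Rightarrow> real"
  assumes r: "r > 0" and g: "Cinf_on U g" and U: "sphere 0 r \<subseteq> U"
    and e: "e \<bullet> e = 1" "f \<bullet> f = 1" "e \<bullet> f = 0"
  shows "(\<integral>p. diff_at g p ((p \<bullet> f) *\<^sub>R e - (p \<bullet> e) *\<^sub>R f) \<partial>sphere_measure r) = 0"
proof -
  let ?w = "\<lambda>\<theta> p. (cos \<theta> * (p \<bullet> f) - sin \<theta> * (p \<bullet> e)) *\<^sub>R e - (sin \<theta> * (p \<bullet> f) + cos \<theta> * (p \<bullet> e)) *\<^sub>R f"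
  let ?D = "\<lambda>x. diff_at g x"
  have n: "rotation e f \<theta> p \<in> U" if "p \<in> sphere 0 r" for \<theta> p
    using that U orthogonal_transformation_norm[OF rotation_orthogonal[OF e]] by auto
  have cg: "continuous_on U g" and cD: "\<And>v. continuous_on U (\<lambda>x. ?D x v)"
    using g Cinf_on_frechet Cinf_on_continuous by blast+
  have lin: "linear (?D x)" if "x \<in> U" for x
    using Cinf_on_frechet_linear[OF g that] .
  have "((\<lambda>\<theta>. \<integral>p. g (rotation e f \<theta> p) \<partial>sphere_measure r) has_real_derivative
      (\<integral>p. ?D (rotation e f 0 p) (?w 0 p) \<partial>sphere_measure r)) (at 0)"
  proof (rule sphere_integral_has_derivative[where \<delta>=1 and \<Phi>'="\<lambda>\<theta> p. ?D (rotation e f \<theta> p) (?w \<theta> p)"])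
    show "continuous_on (sphere 0 r) (\<lambda>p. g (rotation e f \<theta> p))" for \<theta>
      unfolding rotation_def by (intro continuous_on_compose2[OF cg] continuous_intros) (use n in \<open>auto simp: rotation_def\<close>)
    have "continuous_on ({-1<..<1} \<times> sphere 0 r) (\<lambda>x. ?D (rotation e f (fst x) (snd x)) v)" for v
      unfolding rotation_def by (intro continuous_on_compose2[OF cD] continuous_intros) (use n in \<open>auto simp: rotation_def\<close>)
    then have "continuous_on ({-1<..<1} \<times> sphere 0 r) (\<lambda>x. 
        (cos (fst x) * (snd x \<bullet> f) - sin (fst x) * (snd x \<bullet> e)) * ?D (rotation e f (fst x) (snd x)) e - 
        (sin (fst x) * (snd x \<bullet> f) + cos (fst x) * (snd x \<bullet> e)) * ?D (rotation e f (fst x) (snd x)) f)"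
      by (intro continuous_intros)
    then show "continuous_on ({-1<..<1} \<times> sphere 0 r) (\<lambda>(\<theta>, p). ?D (rotation e f \<theta> p) (?w \<theta> p))"
      by (rule continuous_on_eq) (auto simp: linear_diff[OF lin[OF n]] linear_scale[OF lin[OF n]])
    fix \<theta> p assume p: "p \<in> sphere (0::real^'n option) r"
    have "((\<lambda>\<theta>. rotation e f \<theta> p) has_vector_derivative ?w \<theta> p) (at \<theta>)"
      unfolding rotation_def by (auto intro!: derivative_eq_intros simp: algebra_simps)
    then have d: "((\<lambda>\<theta>. rotation e f \<theta> p) has_derivative (\<lambda>h. h *\<^sub>R ?w \<theta> p)) (at \<theta>)"
      by (simp add: has_vector_derivative_def)
    have "((\<lambda>\<theta>. g (rotation e f \<theta> p)) has_derivative (\<lambda>h. ?D (rotation e f \<theta> p) (h *\<^sub>R ?w \<theta> p))) (at \<theta>)"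
      using has_derivative_compose[OF d Cinf_on_has_derivative[OF g n[OF p]]] .
    then show "((\<lambda>\<theta>. g (rotation e f \<theta> p)) has_real_derivative ?D (rotation e f \<theta> p) (?w \<theta> p)) (at \<theta>)"
      unfolding has_field_derivative_def by (simp add: linear_scale[OF lin[OF n[OF p]]] mult.commute[of _ "?D _ _"])
  qed (use r in auto)
  moreover have "(\<lambda>\<theta>. \<integral>p. g (rotation e f \<theta> p) \<partial>sphere_measure r) = (\<lambda>\<theta>. \<integral>p. g p \<partial>sphere_measure r)"
    using sphere_integral_orthogonal[OF r rotation_orthogonal[OF e] continuous_on_subset[OF cg U]] by blast
  ultimately have "((\<lambda>\<theta>::real. \<integral>p. g p \<partial>sphere_measure r) has_real_derivative
      (\<integral>p. ?D (rotation e f 0 p) (?w 0 p) \<partial>sphere_measure r)) (at 0)" by simp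
  from DERIV_unique[OF this DERIV_const] show ?thesis by (simp add: rotation_def)
qed

lemma frechet_axis_expansion:
  fixes g :: "real^'m::finite \<Rightarrow> real"
  assumes "linear (diff_at g p)"
  shows "diff_at g p v = (\<Sum>k\<in>UNIV. v $ k * diff_at g p (axis k 1))"
proof -
  have "v = (\<Sum>k\<in>UNIV. v $ k *\<^sub>R axis k 1)" by (simp add: basis_expansion scalar_mult_eq_scaleR[symmetric])
  then have "diff_at g p v = diff_at g p (\<Sum>k\<in>UNIV. v $ k *\<^sub>R axis k 1)" by simp
  then show ?thesis by (simp add: linear_sum[OF assms] linear_scale[OF assms])
qed

lemma sphere_inner_self: "p \<in> sphere 0 r \<Longrightarrow> p \<bullet> p = r\<^sup>2"
  by (auto simp: power2_norm_eq_inner[symmetric])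

lemma sphere_integrable_derivative:
  fixes g :: "real^'n::finite option \<Rightarrow> real"
  assumes r: "r > 0" and g: "Cinf_on U g" and U: "sphere 0 r \<subseteq> U"
    and v: "continuous_on (sphere 0 r) v"
  shows "integrable (sphere_measure r) (\<lambda>p. diff_at g p (v p))"
    and "continuous_on (sphere 0 r) (\<lambda>p. diff_at g p (v p))"
proof -
  have "continuous_on (sphere 0 r) (\<lambda>p. \<Sum>k\<in>UNIV. v p $ k * diff_at g p (axis k 1))"
    using continuous_on_subset[OF Cinf_on_continuous[OF Cinf_on_frechet[OF g]] U] v by (intro continuous_intros)
  moreover have "(\<Sum>k\<in>UNIV. v p $ k * diff_at g p (axis k 1)) = diff_at g p (v p)"
    if "p \<in> sphere 0 r" for p
    using frechet_axis_expansion[OF Cinf_on_frechet_linear[OF g], of p "v p"] that U by auto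
  ultimately show c: "continuous_on (sphere 0 r) (\<lambda>p. diff_at g p (v p))"
    by (rule continuous_on_eq)
  show "integrable (sphere_measure r) (\<lambda>p. diff_at g p (v p))"
    by (rule sphere_integrable_continuous[OF r c])
qed

text \<open>With \<open>e\<^sub>i\<close> the coordinate vectors, the tangential part of \<open>e\<^sub>i\<close> is \<open>r\<^sup>-\<^sup>2\<close> times the sum over \<open>k\<close> of \<open>p\<^sub>k\<close> times
  the infinitesimal rotation in the plane of \<open>e\<^sub>i\<close> and \<open>e\<^sub>k\<close>. Hence the sum over \<open>k\<close> of the rotation identities for the
  functions \<open>g(p) p\<^sub>k\<close> is the claim.\<close>

theorem sphere_divergence_axis:
  fixes g :: "real^'n::finite option \<Rightarrow> real"
  assumes r: "r > 0" and g: "Cinf_on U g" and U: "sphere 0 r \<subseteq> U"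
  shows "(\<integral>p. r\<^sup>2 * diff_at g p (axis i 1) - p $ i * diff_at g p p \<partial>sphere_measure r)
    = real CARD('n) * (\<integral>p. g p * p $ i \<partial>sphere_measure r)"
proof -
  let ?M = "sphere_measure r :: (real^'n option) measure"
  let ?D = "\<lambda>p. diff_at g p"
  have cU: "continuous_on (sphere 0 r) g" using continuous_on_subset[OF Cinf_on_continuous[OF g] U] .
  \<comment> \<open>The second term comes from the factor \<open>p\<^sub>k\<close> in \<open>g(p) p\<^sub>k\<close>; the case \<open>k = i\<close> is trivial.\<close>
  let ?h = "\<lambda>k p. p $ k * ?D p (p $ k *\<^sub>R axis i 1 - p $ i *\<^sub>R axis k 1) 
     + g p * (p $ k * (if k = i then 1 else 0) - p $ i)"
  have z: "(\<integral>p. ?h k p \<partial>?M) = 0" for k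
  proof (cases "k = i")
    case True
    have "?h k p = 0" if "p \<in> sphere 0 r" for p
    proof -
      have "linear (?D p)" using Cinf_on_frechet_linear[OF g] that U by blast
      then show ?thesis using True linear_0 by auto
    qed
    then have "(\<integral>p. ?h k p \<partial>?M) = (\<integral>p. 0 \<partial>?M)" by (intro Bochner_Integration.integral_cong) auto
    then show ?thesis by simp
  next
    case False
    have bl: "bounded_linear (\<lambda>p::real^'n option. p $ k)" by (rule bounded_linear_vec_nth)
    have sg: "Cinf_on U (\<lambda>p. g p * p $ k)" by (intro Cinf_on_mult g Cinf_on_linear bl Cinf_on_open[OF g])
    have D: "diff_at (\<lambda>p. g p * p $ k) p v = g p * v $ k + ?D p v * p $ k" if "p \<in> U" for p v
    proof -
      have "((\<lambda>p. g p * p $ k) has_derivative (\<lambda>v. g p * v $ k + ?D p v * p $ k)) (at p)"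
        by (intro has_derivative_mult Cinf_on_has_derivative[OF g that] bounded_linear_imp_has_derivative bl)
      from frechet_derivative_eq[OF this] show ?thesis by simp
    qed
    have "(\<integral>p. diff_at (\<lambda>p. g p * p $ k) p ((p \<bullet> axis k 1) *\<^sub>R axis i 1 - (p \<bullet> axis i 1) *\<^sub>R axis k 1) \<partial>?M) = 0"
      by (rule integral_rotation_field[OF r sg U]) (use False in \<open>auto simp: inner_axis_axis\<close>)
    moreover have "diff_at (\<lambda>p. g p * p $ k) p ((p \<bullet> axis k 1) *\<^sub>R axis i 1 - (p \<bullet> axis i 1) *\<^sub>R axis k 1) = ?h k p"
      if "p \<in> sphere 0 r" for p
    proof -
      have "(axis i 1 :: real^'n option) $ k = 0" "(axis k 1 :: real^'n option) $ k = 1" 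
        using False by (simp_all add: axis_def)
      moreover have "p \<in> U" using that U by blast
      ultimately show ?thesis using False by (simp add: D inner_axis)
    qed
    ultimately show ?thesis by (subst (asm) Bochner_Integration.integral_cong[OF refl, where g="?h k"]) simp_all
  qed
  have int: "integrable ?M (?h k)" for k
    by (intro sphere_integrable_continuous r continuous_intros cU sphere_integrable_derivative(2)[OF r g U])
  have sum: "(\<Sum>k\<in>UNIV. ?h k p) = (r\<^sup>2 * ?D p (axis i 1) - p $ i * ?D p p) - real CARD('n) * (g p * p $ i)"
    if p: "p \<in> sphere 0 r" for p
  proof -
    have l: "linear (?D p)" using Cinf_on_frechet_linear[OF g] p U by blast
    have r2: "(\<Sum>k\<in>UNIV. p $ k * p $ k) = r\<^sup>2"
      using sphere_inner_self[OF p] by (simp add: inner_vec_def)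
    note Dp = frechet_axis_expansion[OF l, of p]
    have "?h k p = p $ k * p $ k * ?D p (axis i 1) - p $ i * (p $ k * ?D p (axis k 1)) 
        + (if k = i then g p * p $ i else 0) - g p * p $ i" for k
      by (simp add: linear_diff[OF l] linear_scale[OF l] algebra_simps)
    then have "(\<Sum>k\<in>UNIV. ?h k p) = (\<Sum>k\<in>UNIV. p $ k * p $ k) * ?D p (axis i 1) - p $ i * (\<Sum>k\<in>UNIV. p $ k * ?D p (axis k 1))
        + g p * p $ i - real (CARD('n option)) * (g p * p $ i)"
      by (simp add: sum.distrib sum_subtractf sum_distrib_left sum_distrib_right)
    then show ?thesis unfolding r2 Dp[symmetric] by (simp add: algebra_simps)
  qed
  have "0 = (\<Sum>k\<in>UNIV. \<integral>p. ?h k p \<partial>?M)" by (simp only: z sum.neutral_const)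
  also have "\<dots> = (\<integral>p. (\<Sum>k\<in>UNIV. ?h k p) \<partial>?M)" using int by (subst Bochner_Integration.integral_sum) auto
  also have "\<dots> = (\<integral>p. (r\<^sup>2 * ?D p (axis i 1) - p $ i * ?D p p) - real CARD('n) * (g p * p $ i) \<partial>?M)"
    by (rule Bochner_Integration.integral_cong) (simp_all only: sum sphere_measure_space)
  also have "\<dots> = (\<integral>p. r\<^sup>2 * ?D p (axis i 1) - p $ i * ?D p p \<partial>?M) - real CARD('n) * (\<integral>p. g p * p $ i \<partial>?M)"
  proof (subst Bochner_Integration.integral_diff)
    show "integrable ?M (\<lambda>p. r\<^sup>2 * ?D p (axis i 1) - p $ i * ?D p p)"
      "integrable ?M (\<lambda>p. real CARD('n) * (g p * p $ i))"
      by (intro sphere_integrable_continuous r continuous_intros cU sphere_integrable_derivative(2)[OF r g U])+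
  qed simp
  finally show ?thesis by simp
qed

text \<open>The divergence theorem on the sphere for the field \<open>g a\<close> with a constant vector \<open>a\<close>: after division by \<open>r\<^sup>2\<close>, the left
  integrand is its tangential divergence, and \<open>- n p / r\<^sup>2\<close> is the mean curvature vector.\<close>

theorem sphere_divergence:
  fixes g :: "real^'n::finite option \<Rightarrow> real"
  assumes r: "r > 0" and g: "Cinf_on U g" and U: "sphere 0 r \<subseteq> U"
  shows "(\<integral>p. r\<^sup>2 * diff_at g p a - (a \<bullet> p) * diff_at g p p \<partial>sphere_measure r)
    = real CARD('n) * (\<integral>p. g p * (a \<bullet> p) \<partial>sphere_measure r)"
proof -
  let ?M = "sphere_measure r :: (real^'n option) measure"
  let ?D = "\<lambda>p. diff_at g p"
  have cU: "continuous_on (sphere 0 r) g" using continuous_on_subset[OF Cinf_on_continuous[OF g] U] .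
  let ?h = "\<lambda>k p. r\<^sup>2 * ?D p (axis k 1) - p $ k * ?D p p"
  have int: "integrable ?M (\<lambda>p. a $ k * ?h k p)" "integrable ?M (\<lambda>p. a $ k * (g p * p $ k))" for k
    by (intro sphere_integrable_continuous r continuous_intros cU sphere_integrable_derivative(2)[OF r g U])+
  have "(\<integral>p. r\<^sup>2 * ?D p a - (a \<bullet> p) * ?D p p \<partial>?M) = (\<integral>p. (\<Sum>k\<in>UNIV. a $ k * ?h k p) \<partial>?M)"
  proof (rule Bochner_Integration.integral_cong)
    fix p assume "p \<in> space ?M"
    then have l: "linear (?D p)" using Cinf_on_frechet_linear[OF g, of p] U by auto
    note Da = frechet_axis_expansion[OF l, of a]
    show "r\<^sup>2 * ?D p a - (a \<bullet> p) * ?D p p = (\<Sum>k\<in>UNIV. a $ k * ?h k p)"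
      unfolding Da inner_vec_def
      by (simp add: sum_distrib_left sum_distrib_right algebra_simps sum_subtractf)
  qed simp
  also have "\<dots> = (\<Sum>k\<in>UNIV. a $ k * (\<integral>p. ?h k p \<partial>?M))"
    using int by (subst Bochner_Integration.integral_sum) auto
  also have "\<dots> = (\<Sum>k\<in>UNIV. real CARD('n) * (a $ k * (\<integral>p. g p * p $ k \<partial>?M)))"
    by (simp add: sphere_divergence_axis[OF r g U] mult.left_commute)
  also have "\<dots> = real CARD('n) * (\<integral>p. (\<Sum>k\<in>UNIV. a $ k * (g p * p $ k)) \<partial>?M)"
    using int by (subst Bochner_Integration.integral_sum) (auto simp: sum_distrib_left)
  also have "(\<lambda>p. \<Sum>k\<in>UNIV. a $ k * (g p * p $ k)) = (\<lambda>p. g p * (a \<bullet> p))"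
    by (simp add: inner_vec_def sum_distrib_left mult.left_commute)
  finally show ?thesis .
qed

lemma sphere_first_moment:
  assumes r: "r > 0"
  shows "(\<integral>p. a \<bullet> p \<partial>(sphere_measure r :: (real^'n::finite option) measure)) = 0"
  using sphere_divergence[OF r Cinf_on_const[OF open_UNIV, of 1], of a] by simp

lemma sphere_second_moment:
  fixes a b :: "real^'n::finite option"
  assumes r: "r > 0"
  shows "(\<integral>p. (a \<bullet> p) * (b \<bullet> p) \<partial>sphere_measure r) =
    r\<^sup>2 / (real CARD('n) + 1) * (a \<bullet> b) * measure (sphere_measure r :: (real^'n::finite option) measure) (sphere 0 r)"
proof -
  let ?M = "sphere_measure r :: (real^'n option) measure"
  interpret finite_measure ?M by (rule sphere_measure_finite_pos[OF r])
  have bl: "bounded_linear (\<lambda>p. b \<bullet> p)" by (rule bounded_linear_inner_right)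
  have D: "diff_at (\<lambda>p. b \<bullet> p) p = (\<lambda>p. b \<bullet> p)" for p
    using frechet_derivative_eq[OF bounded_linear_imp_has_derivative[OF bl]] by auto
  have i: "integrable ?M (\<lambda>p. (a \<bullet> p) * (b \<bullet> p))" 
    by (intro sphere_integrable_continuous r continuous_intros)
  have "(\<integral>p. r\<^sup>2 * (b \<bullet> a) - (a \<bullet> p) * (b \<bullet> p) \<partial>?M) = real CARD('n) * (\<integral>p. (a \<bullet> p) * (b \<bullet> p) \<partial>?M)"
    using sphere_divergence[OF r Cinf_on_linear[OF open_UNIV bl], of a] by (simp add: D mult.commute)
  then have "r\<^sup>2 * (a \<bullet> b) * measure ?M (sphere 0 r) = (real CARD('n) + 1) * (\<integral>p. (a \<bullet> p) * (b \<bullet> p) \<partial>?M)"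
    using i by (simp add: algebra_simps inner_commute)
  then show ?thesis by (simp add: field_simps)
qed

section \<open>The spectral gap of the sphere\<close>

text \<open>At a point of the sphere of radius \<open>r\<close> this is \<open>r\<^sup>2\<close> times the inner product of the tangential gradients: the
  radial parts cancel.\<close>

definition grad_pairing :: "real \<Rightarrow> (real^'m::finite \<Rightarrow> real) \<Rightarrow> (real^'m \<Rightarrow> real) \<Rightarrow> real^'m \<Rightarrow> real" where
  "grad_pairing r f h p =
     r\<^sup>2 * (\<Sum>k\<in>UNIV. diff_at f p (axis k 1) * diff_at h p (axis k 1))
     - diff_at f p p * diff_at h p p"

lemma grad_pairing_commute: "grad_pairing r f h p = grad_pairing r h f p"
  by (simp add: grad_pairing_def mult.commute)

lemma grad_pairing_nonneg:
  fixes f :: "real^'m::finite \<Rightarrow> real"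
  assumes "linear (diff_at f p)" "p \<in> sphere 0 r"
  shows "grad_pairing r f f p \<ge> 0"
proof -
  define G where "G = (\<chi> k. diff_at f p (axis k 1))"
  have "diff_at f p p = p \<bullet> G"
    using frechet_axis_expansion[OF assms(1), of p] by (simp add: G_def inner_vec_def)
  moreover have "(\<Sum>k\<in>UNIV. diff_at f p (axis k 1) * diff_at f p (axis k 1)) = G \<bullet> G"
    by (simp add: G_def inner_vec_def)
  moreover have "(p \<bullet> G) * (p \<bullet> G) \<le> (p \<bullet> p) * (G \<bullet> G)"
    using Cauchy_Schwarz_ineq[of p G] by (simp add: power2_eq_square)
  ultimately show ?thesis using sphere_inner_self[OF assms(2)] by (simp add: grad_pairing_def)
qed

lemma Cinf_on_lin:
  "Cinf_on U f \<Longrightarrow> Cinf_on U h \<Longrightarrow> Cinf_on U (\<lambda>x. a * f x + b * (h x :: real))"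
  by (intro Cinf_on_add Cinf_on_cmult)

lemma frechet_lin:
  assumes "Cinf_on U f" "Cinf_on U h" "p \<in> U"
  shows "diff_at (\<lambda>x. a * f x + b * (h x :: real)) p v =
     a * diff_at f p v + b * diff_at h p v"
  by (rule frechet_derivative_eq)
     (intro has_derivative_add has_derivative_mult_right Cinf_on_has_derivative[OF assms(1,3)] Cinf_on_has_derivative[OF assms(2,3)])

lemma grad_pairing_lin:
  assumes "Cinf_on U h" "Cinf_on U k" "p \<in> U"
  shows "grad_pairing r f (\<lambda>x. a * h x + b * k x) p = a * grad_pairing r f h p + b * grad_pairing r f k p"
  unfolding grad_pairing_def frechet_lin[OF assms]
  by (simp add: sum.distrib sum_distrib_left algebra_simps)

definition sphere_inner :: "real \<Rightarrow> (real^'n::finite option \<Rightarrow> real) \<Rightarrow> (real^'n option \<Rightarrow> real) \<Rightarrow> real" where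
  "sphere_inner r f h = (\<integral>p. f p * h p \<partial>sphere_measure r)"

text \<open>It carries the factor \<open>r\<^sup>2\<close> of the pairing, which makes the eigenvalues independent of the radius.\<close>

definition dirichlet :: "real \<Rightarrow> (real^'n::finite option \<Rightarrow> real) \<Rightarrow> (real^'n option \<Rightarrow> real) \<Rightarrow> real" where
  "dirichlet r f h = (\<integral>p. grad_pairing r f h p \<partial>sphere_measure r)"

lemma sphere_inner_commute: "sphere_inner r f h = sphere_inner r h f"
  by (simp add: sphere_inner_def mult.commute)

lemma dirichlet_commute: "dirichlet r f h = dirichlet r h f"
proof -
  have "grad_pairing r f h = grad_pairing r h f" by (rule ext) (rule grad_pairing_commute)
  then show ?thesis by (simp only: dirichlet_def)
qed

context
  fixes r :: real and U :: "(real^'n::finite option) set"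
  assumes r: "r > 0" and U: "sphere 0 r \<subseteq> U"
begin

lemma Cinf_on_cont_sphere: "Cinf_on U f \<Longrightarrow> continuous_on (sphere 0 r) (f :: _ \<Rightarrow> real)"
  using continuous_on_subset[OF Cinf_on_continuous U] by blast

lemma grad_pairing_integrable:
  assumes f: "Cinf_on U f" and h: "Cinf_on U h"
  shows "integrable (sphere_measure r) (grad_pairing r f h)"
  unfolding grad_pairing_def[abs_def]
  by (intro sphere_integrable_continuous r continuous_intros 
      sphere_integrable_derivative(2)[OF r f U] sphere_integrable_derivative(2)[OF r h U])

lemma sphere_inner_lin:
  assumes "Cinf_on U f" "Cinf_on U h" "Cinf_on U k"
  shows "sphere_inner r f (\<lambda>x. a * h x + b * k x) = a * sphere_inner r f h + b * sphere_inner r f k"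
proof -
  have "integrable (sphere_measure r) (\<lambda>p. f p * h p)" "integrable (sphere_measure r) (\<lambda>p. f p * k p)"
    by (intro sphere_integrable_continuous r continuous_intros Cinf_on_cont_sphere assms)+
  then show ?thesis by (simp add: sphere_inner_def distrib_left mult.left_commute)
qed

lemma dirichlet_lin:
  assumes "Cinf_on U f" "Cinf_on U h" "Cinf_on U k"
  shows "dirichlet r f (\<lambda>x. a * h x + b * k x) = a * dirichlet r f h + b * dirichlet r f k"
proof -
  have "dirichlet r f (\<lambda>x. a * h x + b * k x) = (\<integral>p. a * grad_pairing r f h p + b * grad_pairing r f k p \<partial>sphere_measure r)"
    unfolding dirichlet_def
    by (intro Bochner_Integration.integral_cong) (use grad_pairing_lin[OF assms(2,3)] U in auto)
  then show ?thesis using grad_pairing_integrable assms by (simp add: dirichlet_def)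
qed

lemma sphere_inner_sum:
  assumes "Cinf_on U f" "\<And>j. j \<in> J \<Longrightarrow> Cinf_on U (h j)" "finite J"
  shows "sphere_inner r f (\<lambda>x. \<Sum>j\<in>J. c j * h j x) = (\<Sum>j\<in>J. c j * sphere_inner r f (h j))"
  using assms(3,2)
proof (induction J)
  case empty then show ?case by (simp add: sphere_inner_def)
next
  case (insert i J)
  have "Cinf_on U (\<lambda>x. \<Sum>j\<in>J. c j * h j x)"
    using insert.prems by (intro Cinf_on_sum Cinf_on_cmult Cinf_on_open[OF assms(1)]) auto
  from sphere_inner_lin[OF assms(1) insert.prems[of i] this, of "c i" 1] insert show ?case by simp
qed

lemma dirichlet_sum:
  assumes "Cinf_on U f" "\<And>j. j \<in> J \<Longrightarrow> Cinf_on U (h j)" "finite J"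
  shows "dirichlet r f (\<lambda>x. \<Sum>j\<in>J. c j * h j x) = (\<Sum>j\<in>J. c j * dirichlet r f (h j))"
  using assms(3,2)
proof (induction J)
  case empty 
  have "dirichlet r f (\<lambda>x. 0 * f x + 0 * f x) = 0" using dirichlet_lin[OF assms(1,1,1), of 0 0] by simp
  then show ?case by simp
next
  case (insert i J)
  have "Cinf_on U (\<lambda>x. \<Sum>j\<in>J. c j * h j x)"
    using insert.prems by (intro Cinf_on_sum Cinf_on_cmult Cinf_on_open[OF assms(1)]) auto
  from dirichlet_lin[OF assms(1) insert.prems[of i] this, of "c i" 1] insert show ?case by simp
qed

text \<open>Apply the divergence theorem to the field \<open>f (a \<bullet> p)\<^sup>d\<^sup>-\<^sup>1 a\<close>. This is the weak form of the Laplacian of a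
  power of a linear form.\<close>

lemma dirichlet_ridge:
  assumes f: "Cinf_on U f"
  shows "dirichlet r f (\<lambda>x. (a \<bullet> x) ^ d) = real d * (real d + real CARD('n) - 1) * sphere_inner r f (\<lambda>x. (a \<bullet> x) ^ d)
     - real d * (real d - 1) * r\<^sup>2 * (a \<bullet> a) * sphere_inner r f (\<lambda>x. (a \<bullet> x) ^ (d - 2))"
proof (cases d)
  case 0
  then show ?thesis by (simp add: dirichlet_def grad_pairing_def)
next
  case (Suc m)
  let ?M = "sphere_measure r :: (real^'n option) measure"
  let ?D = "\<lambda>p. diff_at f p"
  note sU = Cinf_on_open[OF f]
  have sa: "Cinf_on U (\<lambda>x. (a \<bullet> x) ^ j)" for j by (intro Cinf_on_power Cinf_on_linear[OF sU] bounded_linear_inner_right)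
  have Da: "((\<lambda>x. (a \<bullet> x) ^ j) has_derivative (\<lambda>v. real j * (a \<bullet> v) * (a \<bullet> p) ^ (j - 1))) (at p)" for j p
    by (auto intro!: derivative_eq_intros simp: mult_ac)
  have gp: "grad_pairing r f (\<lambda>x. (a \<bullet> x) ^ d) p = real d * (a \<bullet> p) ^ m * (r\<^sup>2 * ?D p a - (a \<bullet> p) * ?D p p)"
    if "p \<in> U" for p
  proof -
    have "?D p a = (\<Sum>k\<in>UNIV. a $ k * ?D p (axis k 1))"
      by (rule frechet_axis_expansion[OF Cinf_on_frechet_linear[OF f that]])
    then show ?thesis
      unfolding grad_pairing_def frechet_derivative_eq[OF Da]
      by (simp add: Suc inner_axis sum_distrib_left sum_distrib_right algebra_simps)
  qed
  have Dg: "diff_at (\<lambda>x. f x * (a \<bullet> x) ^ m) p v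
     = f p * (real m * (a \<bullet> v) * (a \<bullet> p) ^ (m - 1)) + ?D p v * (a \<bullet> p) ^ m" if "p \<in> U" for p v
    by (rule frechet_derivative_eq) (intro has_derivative_mult Cinf_on_has_derivative[OF f that] Da)
  have pm: "real m * x ^ (m - 1) * x = real m * x ^ m" for x :: real
    by (cases m) auto
  let ?X = "\<lambda>p. (a \<bullet> p) ^ m * (r\<^sup>2 * ?D p a - (a \<bullet> p) * ?D p p)"
  let ?u = "\<lambda>p. f p * (a \<bullet> p) ^ (d - 2)" and ?v = "\<lambda>p. f p * (a \<bullet> p) ^ d"
  have eq: "r\<^sup>2 * diff_at (\<lambda>x. f x * (a \<bullet> x) ^ m) p a - (a \<bullet> p) * diff_at (\<lambda>x. f x * (a \<bullet> x) ^ m) p p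
    = ?X p + (real m * r\<^sup>2 * (a \<bullet> a)) * ?u p - real m * ?v p" if "p \<in> U" for p
  proof -
    have e: "(a \<bullet> p) * (f p * (real m * (a \<bullet> p) * (a \<bullet> p) ^ (m - 1))) = real m * ?v p"
    proof -
      have "(a \<bullet> p) * (f p * (real m * (a \<bullet> p) * (a \<bullet> p) ^ (m - 1))) = f p * (a \<bullet> p) * (real m * (a \<bullet> p) ^ (m - 1) * (a \<bullet> p))"
        by (simp only: mult_ac)
      also have "\<dots> = real m * ?v p" unfolding pm by (simp add: Suc mult_ac)
      finally show ?thesis .
    qed
    show ?thesis unfolding Dg[OF that] distrib_left e by (simp add: Suc algebra_simps)
  qed
  have int: "integrable ?M ?X" "integrable ?M ?u" "integrable ?M ?v"
    by (intro sphere_integrable_continuous r continuous_intros Cinf_on_cont_sphere f sphere_integrable_derivative(2)[OF r f U])+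
  have "real CARD('n) * sphere_inner r f (\<lambda>x. (a \<bullet> x) ^ d) = real CARD('n) * (\<integral>p. f p * (a \<bullet> p) ^ m * (a \<bullet> p) \<partial>?M)"
    by (simp add: sphere_inner_def Suc mult_ac)
  also have "\<dots> = (\<integral>p. r\<^sup>2 * diff_at (\<lambda>x. f x * (a \<bullet> x) ^ m) p a - (a \<bullet> p) * diff_at (\<lambda>x. f x * (a \<bullet> x) ^ m) p p \<partial>?M)"
    by (rule sphere_divergence[OF r Cinf_on_mult[OF f sa] U, symmetric])
  also have "\<dots> = (\<integral>p. ?X p + (real m * r\<^sup>2 * (a \<bullet> a)) * ?u p - real m * ?v p \<partial>?M)"
    by (intro Bochner_Integration.integral_cong) (use eq U in auto)
  also have "\<dots> = (\<integral>p. ?X p \<partial>?M) + (real m * r\<^sup>2 * (a \<bullet> a)) * (\<integral>p. ?u p \<partial>?M) - real m * (\<integral>p. ?v p \<partial>?M)"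
    using int by simp
  finally have X: "(\<integral>p. ?X p \<partial>?M) = (real CARD('n) + real m) * sphere_inner r f (\<lambda>x. (a \<bullet> x) ^ d)
     - (real m * r\<^sup>2 * (a \<bullet> a)) * sphere_inner r f (\<lambda>x. (a \<bullet> x) ^ (d - 2))"
    unfolding sphere_inner_def by (simp add: algebra_simps)
  have "dirichlet r f (\<lambda>x. (a \<bullet> x) ^ d) = (\<integral>p. real d * ?X p \<partial>?M)"
    unfolding dirichlet_def by (intro Bochner_Integration.integral_cong) (use gp U in \<open>auto simp: mult.assoc\<close>)
  also have "\<dots> = real d * (\<integral>p. ?X p \<partial>?M)" by simp
  finally show ?thesis unfolding X by (simp add: Suc algebra_simps)
qed

end

text \<open>Sums of powers of linear forms. They span all polynomials, but the Laplacian acts on them by a formula in one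
  variable, so that no calculus of multivariate polynomials is needed.\<close>

inductive ridge_poly :: "nat \<Rightarrow> (real^'m::finite \<Rightarrow> real) \<Rightarrow> bool" for d where
  ridge: "j \<le> d \<Longrightarrow> ridge_poly d (\<lambda>x. c * (a \<bullet> x) ^ j)"
| add: "ridge_poly d p \<Longrightarrow> ridge_poly d q \<Longrightarrow> ridge_poly d (\<lambda>x. p x + q x)"

lemma ridge_poly_Cinf_on: "ridge_poly d p \<Longrightarrow> open U \<Longrightarrow> Cinf_on U p"
  by (induction rule: ridge_poly.induct)
     (auto intro!: Cinf_on_cmult Cinf_on_power Cinf_on_linear bounded_linear_inner_right Cinf_on_add)

lemma ridge_poly_mono: "ridge_poly d p \<Longrightarrow> d \<le> d' \<Longrightarrow> ridge_poly d' p"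
  by (induction rule: ridge_poly.induct) (auto intro: ridge_poly.intros)

lemma ridge_poly_cmult: "ridge_poly d p \<Longrightarrow> ridge_poly d (\<lambda>x. c * p x)"
proof (induction rule: ridge_poly.induct)
  case (ridge j b a)
  then show ?case using ridge_poly.ridge[of j d "c * b" a] by (simp add: mult.assoc)
next
  case (add p q)
  then show ?case using ridge_poly.add[OF add.IH] by (simp add: distrib_left)
qed

lemma ridge_poly_const: "ridge_poly d (\<lambda>x. c)"
  using ridge_poly.ridge[of 0 d c 0] by simp

lemma ridge_poly_sum: "(\<And>j. j \<in> J \<Longrightarrow> ridge_poly d (p j)) \<Longrightarrow> ridge_poly d (\<lambda>x. \<Sum>j\<in>J. p j x)"
  by (induction J rule: infinite_finite_induct) (auto intro: ridge_poly_const ridge_poly.add)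

text \<open>The eigenvalues of the Laplacian of the unit sphere of dimension \<open>n\<close>, with the sign that makes them nonnegative.\<close>

definition sphere_eigenvalue :: "'n::finite itself \<Rightarrow> nat \<Rightarrow> real" where
  "sphere_eigenvalue _ j = real j * (real j + real CARD('n) - 1)"

text \<open>Eigenfunctions of the Laplacian, expressed by testing with smooth functions. Only this weak form is used, so that the
  operator itself need not be defined.\<close>

definition weak_eigenfunction :: "real \<Rightarrow> real \<Rightarrow> (real^'n::finite option \<Rightarrow> real) \<Rightarrow> bool" where
  "weak_eigenfunction r \<mu> h \<longleftrightarrow>
     (\<forall>U f. Cinf_on U f \<longrightarrow> sphere 0 r \<subseteq> U \<longrightarrow> dirichlet r f h = \<mu> * sphere_inner r f h)"

lemma sphere_eigenvalue_strict_mono: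
  "i < j \<Longrightarrow> sphere_eigenvalue TYPE('n::finite) i < sphere_eigenvalue TYPE('n) j"
proof -
  assume ij: "i < j"
  have c: "real CARD('n) \<ge> 1" using zero_less_card_finite[where 'a='n] by linarith
  have "real i * (real i + real CARD('n) - 1) \<le> real i * (real j + real CARD('n) - 1)"
    using ij by (intro mult_left_mono) auto
  also have "\<dots> < real j * (real j + real CARD('n) - 1)"
  proof (rule mult_strict_right_mono)
    show "0 < real j + real CARD('n) - 1" using ij c zero_less_card_finite[where 'a='n] by linarith
  qed (use ij in simp)
  finally show ?thesis by (simp add: sphere_eigenvalue_def)
qed

text \<open>On powers of degree at most \<open>d + 1\<close>, the Laplacian minus the top eigenvalue lowers the degree.\<close>

lemma ridge_poly_lower_order:
  fixes p :: "real^'n::finite option \<Rightarrow> real"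
  assumes r: "r > 0" and p: "ridge_poly (Suc d) p"
  shows "\<exists>q. ridge_poly d q \<and> (\<forall>U f. Cinf_on U f \<longrightarrow> sphere 0 r \<subseteq> U \<longrightarrow>
     dirichlet r f p = sphere_eigenvalue TYPE('n) (Suc d) * sphere_inner r f p - sphere_inner r f q)"
  using p
proof (induction rule: ridge_poly.induct)
  case (ridge j c a)
  let ?l = "sphere_eigenvalue TYPE('n)"
  let ?k = "c * (real j * (real j - 1) * r\<^sup>2 * (a \<bullet> a))"
  \<comment> \<open>For \<open>j = d + 1\<close> the first coefficient vanishes, so the degree is at most \<open>d\<close> in all cases.\<close>
  let ?q = "\<lambda>x. (?l (Suc d) - ?l j) * (c * (a \<bullet> x) ^ j) + ?k * (a \<bullet> x) ^ (j - 2)"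
  have "ridge_poly d (\<lambda>x. (?l (Suc d) - ?l j) * (c * (a \<bullet> x) ^ j))"
  proof (cases "j \<le> d")
    case True then show ?thesis by (intro ridge_poly_cmult ridge_poly.ridge)
  next
    case False then have "j = Suc d" using ridge by simp
    then show ?thesis using ridge_poly_const[of d 0] by simp
  qed
  moreover have "ridge_poly d (\<lambda>x. ?k * (a \<bullet> x) ^ (j - 2))"
    using ridge by (intro ridge_poly.ridge) auto
  ultimately have q: "ridge_poly d ?q" by (rule ridge_poly.add)
  have "dirichlet r f (\<lambda>x. c * (a \<bullet> x) ^ j) = ?l (Suc d) * sphere_inner r f (\<lambda>x. c * (a \<bullet> x) ^ j) - sphere_inner r f ?q"
    if f: "Cinf_on U f" and U: "sphere 0 r \<subseteq> U" for U f
  proof -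
    have s: "Cinf_on U (\<lambda>x. (a \<bullet> x) ^ i)" for i
      by (intro Cinf_on_power Cinf_on_linear Cinf_on_open[OF f] bounded_linear_inner_right)
    have "dirichlet r f (\<lambda>x. c * (a \<bullet> x) ^ j) = c * dirichlet r f (\<lambda>x. (a \<bullet> x) ^ j)"
      using dirichlet_lin[OF r U f s s, of c j 0 j] by simp
    moreover have "sphere_inner r f (\<lambda>x. c * (a \<bullet> x) ^ j) = c * sphere_inner r f (\<lambda>x. (a \<bullet> x) ^ j)"
      using sphere_inner_lin[OF r U f s s, of c j 0 j] by simp
    moreover have "sphere_inner r f ?q = ((?l (Suc d) - ?l j) * c) * sphere_inner r f (\<lambda>x. (a \<bullet> x) ^ j) 
        + ?k * sphere_inner r f (\<lambda>x. (a \<bullet> x) ^ (j - 2))"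
      using sphere_inner_lin[OF r U f s s, of "(?l (Suc d) - ?l j) * c" j ?k "j - 2"] by (simp only: mult.assoc)
    ultimately show ?thesis unfolding dirichlet_ridge[OF r U f] by (simp add: sphere_eigenvalue_def algebra_simps)
  qed
  with q show ?case by blast
next
  case (add p1 p2)
  then obtain q1 q2 where q: "ridge_poly d q1" "ridge_poly d q2" and
    1: "\<And>U f. Cinf_on U f \<Longrightarrow> sphere 0 r \<subseteq> U \<Longrightarrow> dirichlet r f p1 = sphere_eigenvalue TYPE('n) (Suc d) * sphere_inner r f p1 - sphere_inner r f q1" and
    2: "\<And>U f. Cinf_on U f \<Longrightarrow> sphere 0 r \<subseteq> U \<Longrightarrow> dirichlet r f p2 = sphere_eigenvalue TYPE('n) (Suc d) * sphere_inner r f p2 - sphere_inner r f q2"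
    by blast
  have "dirichlet r f (\<lambda>x. p1 x + p2 x) = sphere_eigenvalue TYPE('n) (Suc d) * sphere_inner r f (\<lambda>x. p1 x + p2 x) - sphere_inner r f (\<lambda>x. q1 x + q2 x)"
    if f: "Cinf_on U f" and U: "sphere 0 r \<subseteq> U" for U f
  proof -
    note s = ridge_poly_Cinf_on[OF add.hyps(1) Cinf_on_open[OF f]] ridge_poly_Cinf_on[OF add.hyps(2) Cinf_on_open[OF f]]
      ridge_poly_Cinf_on[OF q(1) Cinf_on_open[OF f]] ridge_poly_Cinf_on[OF q(2) Cinf_on_open[OF f]]
    show ?thesis
      using dirichlet_lin[OF r U f s(1,2), of 1 1] sphere_inner_lin[OF r U f s(1,2), of 1 1] 
        sphere_inner_lin[OF r U f s(3,4), of 1 1] 1[OF f U] 2[OF f U] by (simp add: algebra_simps)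
  qed
  then show ?case using ridge_poly.add[OF q] by blast
qed

text \<open>The Laplacian is triangular with distinct diagonal entries \<open>\<lambda>\<^sub>j\<close>. If \<open>(T - \<lambda>\<^sub>d\<^sub>+\<^sub>1) p = - q\<close> with
  \<open>q = \<Sum> h\<^sub>j\<close> of degree at most \<open>d\<close>, then the function \<open>w = \<Sum> h\<^sub>j / (\<lambda>\<^sub>d\<^sub>+\<^sub>1 - \<lambda>\<^sub>j)\<close> solves \<open>(T - \<lambda>\<^sub>d\<^sub>+\<^sub>1) w = - q\<close>, and \<open>p - w\<close> is an
  eigenfunction for the top eigenvalue.\<close>

lemma ridge_poly_eigen_decomposition:
  fixes p :: "real^'n::finite option \<Rightarrow> real"
  assumes r: "r > 0" and p: "ridge_poly d p"
  shows "\<exists>h. (\<forall>j\<le>d. ridge_poly j (h j) \<and> weak_eigenfunction r (sphere_eigenvalue TYPE('n) j) (h j)) \<and>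
     p = (\<lambda>x. \<Sum>j\<le>d. h j x)"
  using p
proof (induction d arbitrary: p)
  case 0
  have c: "\<exists>c. p = (\<lambda>x. c)" using 0
    by (induction rule: ridge_poly.induct) auto
  then obtain c where "p = (\<lambda>x. c)" by blast
  moreover have "weak_eigenfunction r (sphere_eigenvalue TYPE('n) 0) (\<lambda>x. c)"
    by (simp add: weak_eigenfunction_def sphere_eigenvalue_def dirichlet_def grad_pairing_def)
  ultimately show ?case using 0 by (intro exI[of _ "\<lambda>_ _. c"]) auto
next
  case (Suc d)
  let ?l = "sphere_eigenvalue TYPE('n)"
  obtain q where q: "ridge_poly d q" and E: "\<And>U f. Cinf_on U f \<Longrightarrow> sphere 0 r \<subseteq> U \<Longrightarrow>
     dirichlet r f p = ?l (Suc d) * sphere_inner r f p - sphere_inner r f q"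
    using ridge_poly_lower_order[OF r Suc.prems] by blast
  obtain h where h: "\<And>j. j \<le> d \<Longrightarrow> ridge_poly j (h j)" "\<And>j. j \<le> d \<Longrightarrow> weak_eigenfunction r (?l j) (h j)"
    and qh: "q = (\<lambda>x. \<Sum>j\<le>d. h j x)" using Suc.IH[OF q] by blast
  define c where "c j = 1 / (?l (Suc d) - ?l j)" for j
  have c: "c j * (?l (Suc d) - ?l j) = 1" if "j \<le> d" for j
    using sphere_eigenvalue_strict_mono[of j "Suc d", where 'n='n] that by (simp add: c_def)
  define w where "w = (\<lambda>x. \<Sum>j\<le>d. c j * h j x)"
  define h' where "h' j = (if j = Suc d then (\<lambda>x. p x - w x) else (\<lambda>x. c j * h j x))" for j
  have rw: "ridge_poly (Suc d) w" unfolding w_def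

  proof (intro ridge_poly_sum ridge_poly_cmult)
    show "ridge_poly (Suc d) (h j)" if "j \<in> {..d}" for j
      using ridge_poly_mono[OF h(1)[of j], of "Suc d"] that by auto
  qed
  have pw: "(\<lambda>x. p x - w x) = (\<lambda>x. 1 * p x + (-1) * w x)" by auto
  have "weak_eigenfunction r (?l (Suc d)) (\<lambda>x. p x - w x)"
    unfolding weak_eigenfunction_def
  proof (intro allI impI)
    fix U and f :: "real^'n option \<Rightarrow> real" assume f: "Cinf_on U f" and U: "sphere 0 r \<subseteq> U"
    note o = Cinf_on_open[OF f]
    have sh: "Cinf_on U (h j)" if "j \<in> {..d}" for j using h(1)[of j] ridge_poly_Cinf_on o that by blast
    have sp: "Cinf_on U p" "Cinf_on U w" using ridge_poly_Cinf_on[OF Suc.prems o] ridge_poly_Cinf_on[OF rw o] .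
    have dw: "dirichlet r f w = (\<Sum>j\<le>d. c j * (?l j * sphere_inner r f (h j)))"

    proof -
      have "dirichlet r f w = (\<Sum>j\<le>d. c j * dirichlet r f (h j))"
        unfolding w_def by (rule dirichlet_sum[OF r U f sh finite_atMost])
      also have "\<dots> = (\<Sum>j\<le>d. c j * (?l j * sphere_inner r f (h j)))"
        by (intro sum.cong refl) (use h(2) f U in \<open>auto simp: weak_eigenfunction_def\<close>)
      finally show ?thesis .
    qed
    have iw: "sphere_inner r f w = (\<Sum>j\<le>d. c j * sphere_inner r f (h j))"
      unfolding w_def by (rule sphere_inner_sum[OF r U f sh finite_atMost])
    have iq: "sphere_inner r f q = (\<Sum>j\<le>d. sphere_inner r f (h j))"
      using sphere_inner_sum[OF r U f sh, of "{..d}" "\<lambda>j. j" "\<lambda>_. 1"] by (simp add: qh)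
    have "?l (Suc d) * sphere_inner r f w - dirichlet r f w = (\<Sum>j\<le>d. (c j * (?l (Suc d) - ?l j)) * sphere_inner r f (h j))"
      unfolding dw iw by (simp add: sum_distrib_left sum_subtractf algebra_simps)
    also have "\<dots> = sphere_inner r f q" unfolding iq by (intro sum.cong) (auto simp: c)
    finally have "?l (Suc d) * sphere_inner r f w - dirichlet r f w = sphere_inner r f q" .
    then show "dirichlet r f (\<lambda>x. p x - w x) = ?l (Suc d) * sphere_inner r f (\<lambda>x. p x - w x)"
      unfolding pw dirichlet_lin[OF r U f sp] sphere_inner_lin[OF r U f sp] E[OF f U] by (simp add: algebra_simps)
  qed
  moreover have "ridge_poly (Suc d) (\<lambda>x. p x - w x)"
    unfolding pw by (intro ridge_poly.add ridge_poly_cmult Suc.prems rw)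
  moreover have "weak_eigenfunction r (?l j) (\<lambda>x. c j * h j x)" if j: "j \<le> d" for j
    unfolding weak_eigenfunction_def
  proof (intro allI impI)
    fix U and f :: "real^'n option \<Rightarrow> real" assume f: "Cinf_on U f" and U: "sphere 0 r \<subseteq> U"
    have sh: "Cinf_on U (h j)" using h(1)[OF j] ridge_poly_Cinf_on Cinf_on_open[OF f] by blast
    show "dirichlet r f (\<lambda>x. c j * h j x) = ?l j * sphere_inner r f (\<lambda>x. c j * h j x)"
      using dirichlet_lin[OF r U f sh sh, of "c j" 0] sphere_inner_lin[OF r U f sh sh, of "c j" 0] h(2)[OF j] f U
      by (simp add: weak_eigenfunction_def)
  qed
  ultimately have "\<forall>j\<le>Suc d. ridge_poly j (h' j) \<and> weak_eigenfunction r (?l j) (h' j)"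
    using h(1) by (auto simp: h'_def le_Suc_eq intro: ridge_poly_cmult)
  moreover have "p = (\<lambda>x. \<Sum>j\<le>Suc d. h' j x)"
  proof
    fix x
    have "(\<Sum>j\<le>d. h' j x) = w x" unfolding w_def by (intro sum.cong) (auto simp: h'_def)
    then show "p x = (\<Sum>j\<le>Suc d. h' j x)" by (simp add: h'_def)
  qed
  ultimately show ?case by blast
qed


text \<open>Exponentials of linear forms are closed under products, so the Stone-Weierstrass theorem applies to their span, and
  their power series consists of powers of linear forms.\<close>

inductive exp_poly :: "(real^'m::finite \<Rightarrow> real) \<Rightarrow> bool" where
  exp: "exp_poly (\<lambda>x. c * exp (a \<bullet> x))"
| add: "exp_poly p \<Longrightarrow> exp_poly q \<Longrightarrow> exp_poly (\<lambda>x. p x + q x)"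

lemma exp_poly_mult:
  assumes "exp_poly p" "exp_poly q" shows "exp_poly (\<lambda>x. p x * q x)"
  using assms(1)
proof induction
  case (exp c a)
  show ?case using assms(2)
  proof induction
    case (exp d b)
    then show ?case using exp_poly.exp[of "c * d" "a + b"] by (simp add: inner_add_left exp_add mult_ac)
  next
    case (add p q) then show ?case using exp_poly.add[OF add.IH] by (simp add: distrib_left)
  qed
next
  case (add p1 p2) then show ?case using exp_poly.add[OF add.IH] by (simp add: distrib_right)
qed

lemma exp_poly_approx_ridge:
  assumes "exp_poly g" "e > 0"
  shows "\<exists>d p. ridge_poly d p \<and> (\<forall>x\<in>sphere 0 r. \<bar>g x - p x\<bar> < e)"
  using assms
proof (induction arbitrary: e)
  case (exp c a)
  define B where "B = norm a * \<bar>r\<bar>"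
  have "(\<lambda>N. inverse (fact N) * B ^ N) \<longlonglongrightarrow> 0" by (rule summable_LIMSEQ_zero[OF summable_exp])
  then have "(\<lambda>N. \<bar>c\<bar> * Transcendental.exp B * (inverse (fact N) * B ^ N)) \<longlonglongrightarrow> 0" by (rule tendsto_mult_right_zero)
  then have "eventually (\<lambda>N. \<bar>c\<bar> * Transcendental.exp B * (inverse (fact N) * B ^ N) < e) sequentially"
    using exp by (rule order_tendstoD(2))
  then obtain N where N: "\<bar>c\<bar> * Transcendental.exp B * (inverse (fact N) * B ^ N) < e"
    using eventually_happens'[OF sequentially_bot] by blast
  let ?p = "\<lambda>x. \<Sum>m<N. (c / fact m) * (a \<bullet> x) ^ m"
  have "ridge_poly N ?p" by (intro ridge_poly_sum ridge_poly.ridge) auto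
  moreover have "\<bar>c * exp (a \<bullet> x) - ?p x\<bar> < e" if "x \<in> sphere 0 r" for x
  proof -
    have u: "\<bar>a \<bullet> x\<bar> \<le> B" using Cauchy_Schwarz_ineq2[of a x] that by (auto simp: B_def)
    obtain t where t: "\<bar>t\<bar> \<le> \<bar>a \<bullet> x\<bar>" "exp (a \<bullet> x) = (\<Sum>m<N. (a \<bullet> x) ^ m / fact m) + exp t / fact N * (a \<bullet> x) ^ N"
      using Maclaurin_exp_le by blast
    have "c * exp (a \<bullet> x) - ?p x = c * (exp t / fact N * (a \<bullet> x) ^ N)"
      unfolding t(2) by (simp add: distrib_left sum_distrib_left)
    then have "\<bar>c * exp (a \<bullet> x) - ?p x\<bar> = \<bar>c * (exp t / fact N * (a \<bullet> x) ^ N)\<bar>" by (rule arg_cong)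
    also have "\<dots> = \<bar>c\<bar> * exp t * (inverse (fact N) * \<bar>a \<bullet> x\<bar> ^ N)"
      by (simp add: abs_mult power_abs divide_inverse)
    also have "\<dots> \<le> \<bar>c\<bar> * exp B * (inverse (fact N) * B ^ N)"
      using t(1) u by (intro mult_mono mult_left_mono power_mono) auto
    finally show ?thesis using N by simp
  qed
  ultimately show ?case by blast
next
  case (add p q)
  obtain d1 p1 d2 p2 where 1: "ridge_poly d1 p1" "\<And>x. x\<in>sphere 0 r \<Longrightarrow> \<bar>p x - p1 x\<bar> < e/2"
    and 2: "ridge_poly d2 p2" "\<And>x. x\<in>sphere 0 r \<Longrightarrow> \<bar>q x - p2 x\<bar> < e/2"
    using add.IH(1)[of "e/2"] add.IH(2)[of "e/2"] add.prems by auto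
  have "ridge_poly (max d1 d2) (\<lambda>x. p1 x + p2 x)"
    using 1 2 by (intro ridge_poly.add) (auto intro: ridge_poly_mono)
  moreover have "\<bar>p x + q x - (p1 x + p2 x)\<bar> < e" if "x \<in> sphere 0 r" for x
    using 1(2)[OF that] 2(2)[OF that] by linarith
  ultimately show ?case by blast
qed

lemma ridge_poly_dense:
  fixes f :: "real^'m::finite \<Rightarrow> real"
  assumes "continuous_on (sphere 0 r) f" "e > 0"
  shows "\<exists>d p. ridge_poly d p \<and> (\<forall>x\<in>sphere 0 r. \<bar>f x - p x\<bar> < e)"
proof -
  interpret function_ring_on "Collect exp_poly" "sphere 0 r :: (real^'m) set"
  proof
    show "continuous_on (sphere 0 r) f" if "f \<in> Collect exp_poly" for f :: "real^'m \<Rightarrow> real"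
    proof -
      have "exp_poly f" using that by simp
      then show ?thesis by induction (auto intro!: continuous_intros)
    qed
    show "(\<lambda>_. c) \<in> Collect (exp_poly :: (real^'m \<Rightarrow> real) \<Rightarrow> bool)" for c
      using exp_poly.exp[of c 0] by simp
    show "\<exists>f\<in>Collect exp_poly. f x \<noteq> f y" if "x \<noteq> y" for x y :: "real^'m"
    proof -
      have "(x - y) \<bullet> x \<noteq> (x - y) \<bullet> y" 
        using that by (metis eq_iff_diff_eq_0 inner_diff_right inner_eq_zero_iff)
      then show ?thesis using exp_poly.exp[of 1 "x - y"] 
        by (intro bexI[of _ "\<lambda>z. 1 * exp ((x - y) \<bullet> z)"]) simp_all
    qed
  qed (auto intro: exp_poly.add exp_poly_mult)
  obtain g where g: "exp_poly g" "\<And>x. x \<in> sphere 0 r \<Longrightarrow> \<bar>f x - g x\<bar> < e/2"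
    using Stone_Weierstrass_basic[OF assms(1), of "e/2"] assms(2) by auto
  obtain d p where p: "ridge_poly d p" "\<And>x. x\<in>sphere 0 r \<Longrightarrow> \<bar>g x - p x\<bar> < e/2"
    using exp_poly_approx_ridge[OF g(1), of "e/2" r] assms(2) by auto
  have "\<bar>f x - p x\<bar> < e" if "x \<in> sphere 0 r" for x using g(2)[OF that] p(2)[OF that] by linarith
  with p(1) show ?thesis by blast
qed

text \<open>Approximate \<open>f\<close> uniformly by \<open>p = \<Sum> h\<^sub>j\<close> with eigenfunctions \<open>h\<^sub>j\<close> of degree at most \<open>j\<close>. The terms with
  \<open>j \<le> 1\<close> are affine and hence orthogonal to \<open>f\<close>. Expand \<open>0 \<le> E(f - u)\<close> for \<open>u = \<Sum> (\<mu> / \<lambda>\<^sub>j) h\<^sub>j\<close>, summed over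
  \<open>j \<ge> 2\<close>, where \<open>\<mu> = \<lambda>\<^sub>2\<close>. Since \<open>E(f, u) = \<mu> \<langle>f, p\<rangle>\<close> and \<open>E(u) \<le> \<mu> \<langle>p, p\<rangle>\<close>, this gives
  \<open>E(f) \<ge> \<mu> (\<langle>f, f\<rangle> - \<langle>f - p, f - p\<rangle>)\<close>, and the last term is arbitrarily small. The function \<open>f\<close> itself is never expanded, so
  no convergence of a series in the Dirichlet norm is involved.\<close>

theorem sphere_spectral_gap:
  fixes f :: "real^'n::finite option \<Rightarrow> real"
  assumes r: "r > 0" and f: "Cinf_on U f" and U: "sphere 0 r \<subseteq> U"
    and f0: "(\<integral>p. f p \<partial>sphere_measure r) = 0"
    and f1: "\<And>a. (\<integral>p. f p * (a \<bullet> p) \<partial>sphere_measure r) = 0"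
  shows "2 * (real CARD('n) + 1) * sphere_inner r f f \<le> dirichlet r f f"
proof -
  let ?l = "sphere_eigenvalue TYPE('n)"
  let ?M = "sphere_measure r :: (real^'n option) measure"
  interpret finite_measure ?M by (rule sphere_measure_finite_pos[OF r])
  define \<mu> where "\<mu> = 2 * (real CARD('n) + 1)"
  define V where "V = measure ?M (sphere 0 r)"
  note o = Cinf_on_open[OF f]
  have \<mu>0: "\<mu> > 0" by (simp add: \<mu>_def)
  have V: "V > 0" unfolding V_def using sphere_measure_finite_pos(2)[OF r] .
  have \<mu>l: "\<mu> \<le> ?l j" if "j \<ge> 2" for j
  proof -
    have "?l 2 \<le> ?l j" using sphere_eigenvalue_strict_mono[of 2 j, where 'n='n] that by (cases "j = 2") auto
    then show ?thesis by (simp add: sphere_eigenvalue_def \<mu>_def)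
  qed
  have low: "sphere_inner r f p = 0" if "ridge_poly j p" "j \<le> 1" for j p
    using that
  proof induction
    case (ridge i c a)
    then have "i = 0 \<or> i = 1" by auto
    then show ?case using f0 f1[of a] by (auto simp: sphere_inner_def mult.left_commute[of _ c])
  next
    case (add p q)
    then show ?case
      using sphere_inner_lin[OF r U f ridge_poly_Cinf_on[OF add.hyps(1) o] ridge_poly_Cinf_on[OF add.hyps(2) o], of 1 1] by simp
  qed
  have "\<mu> * sphere_inner r f f \<le> dirichlet r f f + e" if e: "e > 0" for e
  proof -
    \<comment> \<open>A uniform error \<open>\<epsilon>\<close> costs at most \<open>\<mu> \<epsilon>\<^sup>2 V = e\<close>.\<close>
    define \<epsilon> where "\<epsilon> = sqrt (e / (\<mu> * V))"
    have \<epsilon>: "\<epsilon> > 0" "\<mu> * (\<epsilon>\<^sup>2 * V) = e" using e \<mu>0 V by (simp_all add: \<epsilon>_def)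
    obtain d0 p where p0: "ridge_poly d0 p" and fp: "\<And>x. x \<in> sphere 0 r \<Longrightarrow> \<bar>f x - p x\<bar> < \<epsilon>"
      using ridge_poly_dense[OF Cinf_on_cont_sphere[OF r U f] \<epsilon>(1)] by blast
    \<comment> \<open>Degree at least two allows splitting off the terms of degree zero and one.\<close>
    define d where "d = max d0 2"
    have p: "ridge_poly d p" using p0 by (rule ridge_poly_mono) (simp add: d_def)
    obtain h where h: "\<And>j. j \<le> d \<Longrightarrow> ridge_poly j (h j)" "\<And>j. j \<le> d \<Longrightarrow> weak_eigenfunction r (?l j) (h j)"
      and ph: "p = (\<lambda>x. \<Sum>j\<le>d. h j x)" using ridge_poly_eigen_decomposition[OF r p] by blast
    have sh: "Cinf_on U (h j)" if "j \<le> d" for j using h(1)[OF that] ridge_poly_Cinf_on o by blast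
    have wk: "dirichlet r g (h j) = ?l j * sphere_inner r g (h j)" if "Cinf_on U g" "j \<le> d" for g j
      using h(2)[OF that(2)] that(1) U unfolding weak_eigenfunction_def by blast
    have orth: "sphere_inner r (h i) (h j) = 0" if "i \<le> d" "j \<le> d" "i \<noteq> j" for i j
    proof -
      have "?l j * sphere_inner r (h i) (h j) = ?l i * sphere_inner r (h i) (h j)"
        using wk[OF sh[OF that(1)] that(2)] wk[OF sh[OF that(2)] that(1)] 
        by (metis dirichlet_commute sphere_inner_commute)
      moreover have "?l i \<noteq> ?l j"
        using sphere_eigenvalue_strict_mono[of i j, where 'n='n] sphere_eigenvalue_strict_mono[of j i, where 'n='n] that(3) 
        by (cases "i < j") auto
      ultimately show ?thesis by simp
    qed
    have sq: "sphere_inner r g g \<ge> 0" for g :: "real^'n option \<Rightarrow> real" by (simp add: sphere_inner_def)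
    let ?J = "{2..d}"
    define c where "c j = \<mu> / ?l j" for j
    have cl: "c j * ?l j = \<mu>" and c1: "0 \<le> c j" "c j \<le> 1" if "j \<in> ?J" for j
      using \<mu>l[of j] \<mu>0 that by (auto simp: c_def)
    define u where "u = (\<lambda>x. \<Sum>j\<in>?J. c j * h j x)"
    have shJ: "Cinf_on U (h j)" if "j \<in> ?J" for j using sh that by auto
    have su: "Cinf_on U u" unfolding u_def by (intro Cinf_on_sum o Cinf_on_cmult shJ)
    have sp: "Cinf_on U p" by (rule ridge_poly_Cinf_on[OF p o])
    have split: "(\<Sum>j\<le>d. F j) = F 0 + F 1 + (\<Sum>j\<in>?J. F j)" for F :: "nat \<Rightarrow> real"
    proof -
      have "{..d} = insert 0 (insert 1 ?J)" by (auto simp: d_def)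
      then show ?thesis by (simp add: add.assoc)
    qed
    have Efu: "dirichlet r f u = \<mu> * sphere_inner r f p"
    proof -
      have "dirichlet r f u = (\<Sum>j\<in>?J. c j * dirichlet r f (h j))"
        unfolding u_def by (rule dirichlet_sum[OF r U f shJ]) auto
      also have "\<dots> = (\<Sum>j\<in>?J. \<mu> * sphere_inner r f (h j))"
        by (intro sum.cong refl) (use wk[OF f] cl in \<open>auto simp: mult.assoc[symmetric]\<close>)
      also have "\<dots> = \<mu> * (\<Sum>j\<le>d. sphere_inner r f (h j))"
        unfolding split using low[OF h(1)[of 0]] low[OF h(1)[of 1]] by (simp add: d_def sum_distrib_left)
      also have "(\<Sum>j\<le>d. sphere_inner r f (h j)) = sphere_inner r f p"
        using sphere_inner_sum[OF r U f sh, of "{..d}" "\<lambda>j. j" "\<lambda>_. 1"] by (simp add: ph)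
      finally show ?thesis .
    qed
    have pp: "sphere_inner r p p = (\<Sum>j\<le>d. sphere_inner r (h j) (h j))"
    proof -
      have "sphere_inner r p p = (\<Sum>j\<le>d. sphere_inner r p (h j))"
        using sphere_inner_sum[OF r U sp sh, of "{..d}" "\<lambda>j. j" "\<lambda>_. 1"] by (simp add: ph)
      also have "\<dots> = (\<Sum>j\<le>d. \<Sum>i\<le>d. sphere_inner r (h j) (h i))"
      proof (intro sum.cong refl)
        fix j assume "j \<in> {..d}"
        then show "sphere_inner r p (h j) = (\<Sum>i\<le>d. sphere_inner r (h j) (h i))"
          using sphere_inner_sum[OF r U sh sh, of j "{..d}" "\<lambda>j. j" "\<lambda>_. 1"]
          by (simp add: ph sphere_inner_commute[of r _ "h j"])
      qed
      also have "\<dots> = (\<Sum>j\<le>d. \<Sum>i\<le>d. if i = j then sphere_inner r (h j) (h j) else 0)"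
        by (intro sum.cong refl) (use orth in auto)
      finally show ?thesis by (simp add: sum.delta')
    qed
    have Euu: "dirichlet r u u \<le> \<mu> * sphere_inner r p p"
    proof -
      have "dirichlet r u u = (\<Sum>j\<in>?J. c j * dirichlet r u (h j))"
        by (subst (2) u_def, rule dirichlet_sum[OF r U su shJ]) auto
      also have "\<dots> = (\<Sum>j\<in>?J. \<mu> * sphere_inner r u (h j))"
        by (intro sum.cong refl) (use wk[OF su] cl in \<open>auto simp: mult.assoc[symmetric]\<close>)
      also have "\<dots> \<le> (\<Sum>j\<in>?J. \<mu> * sphere_inner r (h j) (h j))"
      proof (intro sum_mono mult_left_mono)
        fix j assume j: "j \<in> ?J"
        have "sphere_inner r u (h j) = (\<Sum>i\<in>?J. c i * sphere_inner r (h j) (h i))"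

          by (subst sphere_inner_commute, subst u_def) (rule sphere_inner_sum[OF r U shJ[OF j] shJ], auto)
        also have "\<dots> = (\<Sum>i\<in>?J. if i = j then c j * sphere_inner r (h j) (h j) else 0)"
          by (intro sum.cong refl) (use orth j in auto)
        also have "\<dots> = c j * sphere_inner r (h j) (h j)" using j by (simp add: sum.delta')
        also have "\<dots> \<le> 1 * sphere_inner r (h j) (h j)" using c1[OF j] sq by (intro mult_right_mono)
        finally show "sphere_inner r u (h j) \<le> sphere_inner r (h j) (h j)" by simp
      qed (use \<mu>0 in simp)
      also have "\<dots> \<le> \<mu> * sphere_inner r p p"
        unfolding pp split using sq[of "h 0"] sq[of "h 1"] \<mu>0 by (simp add: sum_distrib_left[symmetric])
      finally show ?thesis .
    qed
    have sfu: "Cinf_on U (\<lambda>x. 1 * f x + (-1) * u x)" by (rule Cinf_on_lin[OF f su])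
    have "0 \<le> dirichlet r (\<lambda>x. 1 * f x + (-1) * u x) (\<lambda>x. 1 * f x + (-1) * u x)"
      unfolding dirichlet_def
      by (intro Bochner_Integration.integral_nonneg_AE AE_I2 grad_pairing_nonneg Cinf_on_frechet_linear[OF sfu]) (use U in auto)
    also have "\<dots> = dirichlet r f f - 2 * dirichlet r f u + dirichlet r u u"
      
      unfolding dirichlet_lin[OF r U sfu f su, of 1 "-1"] dirichlet_commute[of r "\<lambda>x. 1 * f x + (-1) * u x"]
        dirichlet_lin[OF r U f f su, of 1 "-1"] dirichlet_lin[OF r U su f su, of 1 "-1"] dirichlet_commute[of r u f] by simp
    finally have *: "2 * \<mu> * sphere_inner r f p - \<mu> * sphere_inner r p p \<le> dirichlet r f f" using Efu Euu by linarith
    have sfp: "Cinf_on U (\<lambda>x. 1 * f x + (-1) * p x)" by (rule Cinf_on_lin[OF f sp])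
    have "sphere_inner r f f - 2 * sphere_inner r f p + sphere_inner r p p = 
      sphere_inner r (\<lambda>x. 1 * f x + (-1) * p x) (\<lambda>x. 1 * f x + (-1) * p x)"
      
      unfolding sphere_inner_lin[OF r U sfp f sp, of 1 "-1"] sphere_inner_commute[of r "\<lambda>x. 1 * f x + (-1) * p x"]
        sphere_inner_lin[OF r U f f sp, of 1 "-1"] sphere_inner_lin[OF r U sp f sp, of 1 "-1"] sphere_inner_commute[of r p f] by simp
    also have "\<dots> \<le> (\<integral>p. \<epsilon>\<^sup>2 \<partial>?M)"
      unfolding sphere_inner_def
    proof (rule integral_mono)
      show "integrable ?M (\<lambda>x. (1 * f x + (-1) * p x) * (1 * f x + (-1) * p x))"
        by (intro sphere_integrable_continuous r continuous_intros Cinf_on_cont_sphere[OF r U] f sp)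
      fix x assume "x \<in> space ?M"
      then have "\<bar>f x - p x\<bar> \<le> \<epsilon>" using fp[of x] by simp
      then have "(f x - p x)\<^sup>2 \<le> \<epsilon>\<^sup>2" using power_mono[of "\<bar>f x - p x\<bar>" \<epsilon> 2] by simp
      then show "(1 * f x + (-1) * p x) * (1 * f x + (-1) * p x) \<le> \<epsilon>\<^sup>2" by (simp add: power2_eq_square)
    qed simp
    also have "\<dots> = \<epsilon>\<^sup>2 * V" by (simp add: V_def)
    finally have "\<mu> * (sphere_inner r f f - 2 * sphere_inner r f p + sphere_inner r p p) \<le> e"
      using \<epsilon>(2) \<mu>0 by (metis mult_left_mono less_imp_le)
    with * show ?thesis by (simp add: algebra_simps)
  qed
  then show ?thesis unfolding \<mu>_def[symmetric] by (rule field_le_epsilon)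
qed

section \<open>Jets of order two\<close>

text \<open>Value, first and second derivative at \<open>0\<close>. Computing with these triples replaces iterated
  symbolic differentiation.\<close>

definition jet2 :: "(real \<Rightarrow> 'a::real_normed_vector) \<Rightarrow> 'a \<Rightarrow> 'a \<Rightarrow> 'a \<Rightarrow> bool" where
  "jet2 \<phi> a b c \<longleftrightarrow> \<phi> 0 = a \<and>
     (\<exists>\<phi>'. (\<forall>\<^sub>F s in nhds 0. (\<phi> has_vector_derivative \<phi>' s) (at s)) \<and> \<phi>' 0 = b \<and>
           (\<phi>' has_vector_derivative c) (at 0))"

lemma jet2_const: "jet2 (\<lambda>s. a) a 0 0"
  unfolding jet2_def by (auto intro!: exI[of _ "\<lambda>_. 0"])

lemma jet2_add:
  assumes "jet2 f a b c" "jet2 g a' b' c'" shows "jet2 (\<lambda>s. f s + g s) (a + a') (b + b') (c + c')"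
proof -
  obtain f' g' where 1: "\<forall>\<^sub>F s in nhds 0. (f has_vector_derivative f' s) (at s)" "f' 0 = b" "(f' has_vector_derivative c) (at 0)"
    and 2: "\<forall>\<^sub>F s in nhds 0. (g has_vector_derivative g' s) (at s)" "g' 0 = b'" "(g' has_vector_derivative c') (at 0)"
    using assms unfolding jet2_def by blast
  have "\<forall>\<^sub>F s in nhds 0. ((\<lambda>s. f s + g s) has_vector_derivative f' s + g' s) (at s)"
    using 1(1) 2(1) by eventually_elim (rule has_vector_derivative_add)
  moreover have "((\<lambda>s. f' s + g' s) has_vector_derivative c + c') (at 0)"
    using 1(3) 2(3) by (rule has_vector_derivative_add)
  ultimately show ?thesis using assms 1(2) 2(2) unfolding jet2_def by (intro conjI exI[of _ "\<lambda>s. f' s + g' s"]) auto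
qed

lemma jet2_bilinear:
  assumes B: "bounded_bilinear B" and "jet2 f a b c" "jet2 g a' b' c'"
  shows "jet2 (\<lambda>s. B (f s) (g s)) (B a a') (B a b' + B b a') (B a c' + B b b' + (B b b' + B c a'))"
proof -
  obtain f' g' where 1: "\<forall>\<^sub>F s in nhds 0. (f has_vector_derivative f' s) (at s)" "f' 0 = b" "(f' has_vector_derivative c) (at 0)"
    and 2: "\<forall>\<^sub>F s in nhds 0. (g has_vector_derivative g' s) (at s)" "g' 0 = b'" "(g' has_vector_derivative c') (at 0)"
    using assms unfolding jet2_def by blast
  have 0: "f 0 = a" "g 0 = a'" using assms unfolding jet2_def by auto
  have d: "(f has_vector_derivative b) (at 0)" "(g has_vector_derivative b') (at 0)"
    using eventually_nhds_x_imp_x[OF 1(1)] eventually_nhds_x_imp_x[OF 2(1)] 1(2) 2(2) by auto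
  note H = bounded_bilinear.has_vector_derivative[OF B]
  have "\<forall>\<^sub>F s in nhds 0. ((\<lambda>s. B (f s) (g s)) has_vector_derivative B (f s) (g' s) + B (f' s) (g s)) (at s)"
    using 1(1) 2(1) by eventually_elim (rule H)
  moreover have "((\<lambda>s. B (f s) (g' s) + B (f' s) (g s)) has_vector_derivative (B (f 0) c' + B b (g' 0)) + (B (f' 0) b' + B c (g 0))) (at 0)"
    by (intro has_vector_derivative_add H d 1(3) 2(3))
  ultimately show ?thesis using 0 1(2) 2(2) unfolding jet2_def
    by (intro conjI exI[of _ "\<lambda>s. B (f s) (g' s) + B (f' s) (g s)"]) auto
qed

lemma jet2_mult:
  fixes f g :: "real \<Rightarrow> real"
  shows "jet2 f a b c \<Longrightarrow> jet2 g a' b' c' \<Longrightarrow> jet2 (\<lambda>s. f s * g s) (a * a') (a * b' + b * a') (a * c' + b * b' + (b * b' + c * a'))"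
  by (rule jet2_bilinear[OF bounded_bilinear_mult])

lemma jet2_inner:
  "jet2 f a b c \<Longrightarrow> jet2 g a' b' c' \<Longrightarrow> jet2 (\<lambda>s. f s \<bullet> g s) (a \<bullet> a') (a \<bullet> b' + b \<bullet> a') (a \<bullet> c' + b \<bullet> b' + (b \<bullet> b' + c \<bullet> a'))"
  by (rule jet2_bilinear[OF bounded_bilinear_inner])

lemma jet2_diff:
  assumes "jet2 f a b c" "jet2 g a' b' c'" shows "jet2 (\<lambda>s. f s - g s) (a - a') (b - b') (c - c')"
  using jet2_add[OF assms(1) jet2_bilinear[OF bounded_bilinear_scaleR jet2_const[of "-1"] assms(2)]] by simp

lemma jet2_cmult:
  "jet2 f a b c \<Longrightarrow> jet2 (\<lambda>s. k * f s :: real) (k * a) (k * b) (k * c)"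
  using jet2_mult[OF jet2_const[of k]] by fastforce

lemma jet2_compose:
  fixes \<phi> :: "real \<Rightarrow> real"
  assumes \<phi>: "jet2 \<phi> a b c" and g: "\<forall>\<^sub>F x in nhds a. (g has_real_derivative g' x) (at x)"
    and g2: "(g' has_real_derivative g2) (at a)"
  shows "jet2 (\<lambda>s. g (\<phi> s)) (g a) (g' a * b) (g2 * b * b + g' a * c)"
proof -
  obtain \<phi>' where 1: "\<forall>\<^sub>F s in nhds 0. (\<phi> has_vector_derivative \<phi>' s) (at s)" "\<phi>' 0 = b" "(\<phi>' has_vector_derivative c) (at 0)"
    and 0: "\<phi> 0 = a"
    using assms unfolding jet2_def by blast
  have d: "(\<phi> has_real_derivative b) (at 0)"
    using eventually_nhds_x_imp_x[OF 1(1)] 1(2) by (simp add: has_real_derivative_iff_has_vector_derivative)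
  have d2: "(\<phi>' has_real_derivative c) (at 0)"
    using 1(3) by (simp add: has_real_derivative_iff_has_vector_derivative)
  have "(\<phi> \<longlongrightarrow> a) (nhds 0)"
    using DERIV_isCont[OF d] unfolding isCont_def tendsto_at_iff_tendsto_nhds by (simp add: 0)
  then have "\<forall>\<^sub>F s in nhds 0. (g has_real_derivative g' (\<phi> s)) (at (\<phi> s))"
    by (rule eventually_compose_filterlim[OF g])
  with 1(1) have "\<forall>\<^sub>F s in nhds 0. ((\<lambda>s. g (\<phi> s)) has_vector_derivative g' (\<phi> s) * \<phi>' s) (at s)"
  proof eventually_elim
    case (elim s)
    then show ?case using DERIV_chain2[of g "g' (\<phi> s)" \<phi> s "\<phi>' s"]
      by (simp add: has_real_derivative_iff_has_vector_derivative)
  qed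
  moreover have "((\<lambda>s. g' (\<phi> s) * \<phi>' s) has_vector_derivative (g2 * b * b + g' a * c)) (at 0)"
  proof -
    have "((\<lambda>s. g' (\<phi> s)) has_real_derivative g2 * b) (at 0)"
      using DERIV_chain2[OF _ d, of g' g2] g2 0 by simp
    from DERIV_mult[OF this d2] show ?thesis 
      by (simp add: has_real_derivative_iff_has_vector_derivative 0 1(2) algebra_simps)
  qed
  ultimately show ?thesis unfolding jet2_def using 0 1(2)
    by (intro conjI exI[of _ "\<lambda>s. g' (\<phi> s) * \<phi>' s"]) auto
qed

lemma jet2_exp:
  assumes "jet2 \<phi> a b c" shows "jet2 (\<lambda>s. exp (\<phi> s :: real)) (exp a) (exp a * b) (exp a * b * b + exp a * c)"
  by (rule jet2_compose[OF assms]) (auto intro!: derivative_eq_intros always_eventually)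

lemma jet2_powr:
  assumes "jet2 \<phi> 1 b c"
  shows "jet2 (\<lambda>s. \<phi> s powr (k::real)) 1 (k * b) (k * (k - 1) * b * b + k * c)"
proof -
  have "\<forall>\<^sub>F x in nhds (1::real). x \<in> {0<..}" by (intro eventually_nhds_in_open) auto
  then have "\<forall>\<^sub>F x in nhds (1::real). ((\<lambda>x. x powr k) has_real_derivative k * x powr (k - 1)) (at x)"
    by eventually_elim (auto intro!: derivative_eq_intros simp: powr_diff)
  moreover have "((\<lambda>x. k * x powr (k - 1)) has_real_derivative k * (k - 1)) (at 1)"
    by (auto intro!: derivative_eq_intros)
  ultimately show ?thesis using jet2_compose[OF assms, of "\<lambda>x. x powr k"] by fastforce
qed

lemma jet2_sum:
  "(\<And>i. i \<in> I \<Longrightarrow> jet2 (f i) (a i) (b i) (c i)) \<Longrightarrow>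
   jet2 (\<lambda>s. \<Sum>i\<in>I. f i s) (\<Sum>i\<in>I. a i) (\<Sum>i\<in>I. b i) (\<Sum>i\<in>I. c i)"
  by (induction I rule: infinite_finite_induct) (auto intro: jet2_const jet2_add)

lemma jet2_prod_exists:
  fixes f :: "'i \<Rightarrow> real \<Rightarrow> real"
  assumes "\<And>i. i \<in> I \<Longrightarrow> \<exists>a b c. jet2 (f i) a b c"
  shows "\<exists>a b c. jet2 (\<lambda>s. \<Prod>i\<in>I. f i s) a b c"
  using assms
proof (induction I rule: infinite_finite_induct)
  case (insert i I)
  obtain a b c a' b' c' where "jet2 (f i) a b c" "jet2 (\<lambda>s. \<Prod>i\<in>I. f i s) a' b' c'"
    using insert by blast
  from jet2_mult[OF this] show ?case using insert by auto
qed (auto intro!: exI jet2_const)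

lemma jet2_prod_unit:
  fixes f :: "'i \<Rightarrow> real \<Rightarrow> real"
  assumes "finite I" "\<And>i. i \<in> I \<Longrightarrow> jet2 (f i) 1 c (k i)"
  shows "jet2 (\<lambda>s. \<Prod>i\<in>I. f i s) 1 (real (card I) * c) (real (card I) * (real (card I) - 1) * c\<^sup>2 + (\<Sum>i\<in>I. k i))"
  using assms
proof (induction I)
  case empty then show ?case using jet2_const[of "1::real"] by simp
next
  case (insert i I)
  have A: "jet2 (\<lambda>s. f i s * (\<Prod>i\<in>I. f i s)) (1 * 1) (1 * (real (card I) * c) + c * 1)
    (1 * (real (card I) * (real (card I) - 1) * c\<^sup>2 + (\<Sum>i\<in>I. k i)) + c * (real (card I) * c) + (c * (real (card I) * c) + k i * 1))"
    using insert by (intro jet2_mult) auto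
  have b: "1 * (real (card I) * c) + c * 1 = real (card (insert i I)) * c"
    using insert.hyps by (simp add: algebra_simps)
  have c: "1 * (real (card I) * (real (card I) - 1) * c\<^sup>2 + (\<Sum>i\<in>I. k i)) + c * (real (card I) * c) + (c * (real (card I) * c) + k i * 1)
     = real (card (insert i I)) * (real (card (insert i I)) - 1) * c\<^sup>2 + (\<Sum>i\<in>insert i I. k i)"
    using insert.hyps by (simp add: algebra_simps power2_eq_square)
  show ?case using A unfolding b c using insert.hyps by simp
qed

text \<open>In the Leibniz formula a permutation other than the identity moves at least two indices, so its term has two factors whose
  value and first derivative vanish at \<open>0\<close>. Only the product of the diagonal entries contributes.\<close>

lemma jet2_det:
  fixes G :: "real \<Rightarrow> real^'n::finite^'n"
  assumes G: "\<And>i j. jet2 (\<lambda>s. G s $ i $ j) (if i = j then 1 else 0) (if i = j then c else 0) (k i j)"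
  shows "jet2 (\<lambda>s. det (G s)) 1 (real CARD('n) * c)
     (real CARD('n) * (real CARD('n) - 1) * c\<^sup>2 + (\<Sum>i\<in>UNIV. k i i))"
proof -
  let ?P = "{\<pi>. \<pi> permutes (UNIV :: 'n set)}"
  let ?t = "\<lambda>\<pi> s. of_int (sign \<pi>) * (\<Prod>i\<in>UNIV. G s $ i $ \<pi> i)"
  let ?b = "real CARD('n) * c" and ?c = "real CARD('n) * (real CARD('n) - 1) * c\<^sup>2 + (\<Sum>i\<in>UNIV. k i i)"
  have T: "jet2 (?t \<pi>) (if \<pi> = id then 1 else 0) (if \<pi> = id then ?b else 0) (if \<pi> = id then ?c else 0)"
    if "\<pi> \<in> ?P" for \<pi>
  proof (cases "\<pi> = id")
    case True
    have "jet2 (\<lambda>s. \<Prod>i\<in>UNIV. G s $ i $ i) 1 ?b ?c"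

    proof (rule jet2_prod_unit)
      show "jet2 (\<lambda>s. G s $ i $ i) 1 c (k i i)" for i using G[of i i] by simp
    qed simp
    then show ?thesis using True by (simp add: sign_id)
  next
    case False
    then obtain i where i: "\<pi> i \<noteq> i" by (auto simp: fun_eq_iff)
    \<comment> \<open>By injectivity, the image of a moved index is moved as well.\<close>
    define j where "j = \<pi> i"
    have j: "\<pi> j \<noteq> j" "j \<noteq> i" using i that permutes_inj[of \<pi> UNIV] by (auto simp: j_def inj_eq)
    let ?I = "UNIV - {i, j}"
    have split: "(\<Prod>l\<in>UNIV. G s $ l $ \<pi> l) = G s $ i $ \<pi> i * (G s $ j $ \<pi> j * (\<Prod>l\<in>?I. G s $ l $ \<pi> l))" for s
    proof -
      have "(UNIV :: 'n set) = insert i (insert j ?I)" by auto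
      then show ?thesis using j(2) by (metis (no_types, lifting) Diff_iff finite insert_iff prod.insert)
    qed
    obtain a' b' c' where rest: "jet2 (\<lambda>s. \<Prod>l\<in>?I. G s $ l $ \<pi> l) a' b' c'"
      using jet2_prod_exists[of ?I "\<lambda>l s. G s $ l $ \<pi> l"] G by blast
    have 1: "jet2 (\<lambda>s. G s $ i $ \<pi> i) 0 0 (k i (\<pi> i))" using G[of i "\<pi> i"] i by simp
    have 2: "jet2 (\<lambda>s. G s $ j $ \<pi> j) 0 0 (k j (\<pi> j))" using G[of j "\<pi> j"] j by simp
    have "jet2 (\<lambda>s. \<Prod>l\<in>UNIV. G s $ l $ \<pi> l) 0 0 0"
      unfolding split using jet2_mult[OF 1 jet2_mult[OF 2 rest]] by simp
    from jet2_cmult[OF this, of "of_int (sign \<pi>)"] show ?thesis using False by simp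
  qed
  have "jet2 (\<lambda>s. \<Sum>\<pi>\<in>?P. ?t \<pi> s) (\<Sum>\<pi>\<in>?P. if \<pi> = id then 1 else 0)
      (\<Sum>\<pi>\<in>?P. if \<pi> = id then ?b else 0) (\<Sum>\<pi>\<in>?P. if \<pi> = id then ?c else 0)"
    by (rule jet2_sum) (rule T)
  moreover have "finite ?P" "id \<in> ?P" by (simp_all add: permutes_id finite_permutations)
  ultimately show ?thesis by (simp only: sum.delta if_True det_def)
qed

lemma jet2_cong_ev:
  assumes ev: "\<forall>\<^sub>F s in nhds 0. \<phi> s = \<psi> s" and \<phi>: "jet2 \<phi> a b c"
  shows "jet2 \<psi> a b c"
proof -
  obtain \<phi>' where 1: "\<forall>\<^sub>F s in nhds 0. (\<phi> has_vector_derivative \<phi>' s) (at s)" "\<phi>' 0 = b" "(\<phi>' has_vector_derivative c) (at 0)"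
    using \<phi> unfolding jet2_def by blast
  have "\<forall>\<^sub>F s in nhds 0. \<forall>\<^sub>F u in nhds s. \<phi> u = \<psi> u" using ev by (simp add: eventually_eventually)
  with 1(1) have "\<forall>\<^sub>F s in nhds 0. (\<psi> has_vector_derivative \<phi>' s) (at s)"
  proof eventually_elim
    case (elim s)
    have "\<forall>\<^sub>F u in at s. \<phi> u = \<psi> u" "\<phi> s = \<psi> s"
      using elim(2) eventually_nhds_x_imp_x by (auto simp: eventually_at_filter elim: eventually_mono)
    then show ?case using elim(1) has_derivative_transform_eventually[of \<phi> _ s UNIV \<psi>]
      unfolding has_vector_derivative_def by blast
  qed
  then show ?thesis using \<phi> 1 eventually_nhds_x_imp_x[OF ev] unfolding jet2_def by auto
qed

lemma jet2_Cinf_on: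
  assumes f: "Cinf_on U f" and p: "(0, p) \<in> U"
  shows "jet2 (\<lambda>s. f (s, p)) (f (0, p)) (diff_at f (0, p) (1, 0))
     (diff_at (\<lambda>q. diff_at f q (1, 0)) (0, p) (1, 0))"
proof -
  have "open ((\<lambda>s. (s, p)) -` U)"
    by (rule open_vimage[OF Cinf_on_open[OF f]]) (auto intro!: continuous_intros)
  then have "\<forall>\<^sub>F s in nhds 0. s \<in> (\<lambda>s. (s, p)) -` U" using p by (intro eventually_nhds_in_open) auto
  then have "\<forall>\<^sub>F s in nhds 0. ((\<lambda>s. f (s, p)) has_vector_derivative diff_at f (s, p) (1, 0)) (at s)"
    by eventually_elim (auto intro: Cinf_on_time_derivative[OF f])
  moreover have "((\<lambda>s. diff_at f (s, p) (1, 0)) has_vector_derivative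
      diff_at (\<lambda>q. diff_at f q (1, 0)) (0, p) (1, 0)) (at 0)"
    using Cinf_on_time_derivative[OF Cinf_on_frechet[OF f, of "(1, 0)"] p] by simp
  ultimately show ?thesis unfolding jet2_def
    by (intro conjI exI[of _ "\<lambda>s. diff_at f (s, p) (1, 0)"]) auto
qed

lemma jet2_Cinf_on_real:
  fixes f :: "real \<Rightarrow> 'b::real_normed_vector"
  assumes f: "Cinf_on U f" and p: "0 \<in> U"
  shows "jet2 f (f 0) (diff_at f 0 1) (diff_at (\<lambda>q. diff_at f q 1) 0 1)"
proof -
  have D: "(g has_vector_derivative diff_at g s 1) (at s)" if "Cinf_on U g" "s \<in> U" for g :: "real \<Rightarrow> 'b" and s

  proof -
    have "diff_at g s = (\<lambda>x. x *\<^sub>R diff_at g s 1)"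
    proof
      show "diff_at g s x = x *\<^sub>R diff_at g s 1" for x
        using linear_scale[OF Cinf_on_frechet_linear[OF that], of x 1] by simp
    qed
    then show ?thesis using Cinf_on_has_derivative[OF that] unfolding has_vector_derivative_def by (simp only:)
  qed
  have "\<forall>\<^sub>F s in nhds 0. s \<in> U" using p Cinf_on_open[OF f] by (intro eventually_nhds_in_open) auto
  then have "\<forall>\<^sub>F s in nhds 0. (f has_vector_derivative diff_at f s 1) (at s)"
    by eventually_elim (rule D[OF f])
  then show ?thesis unfolding jet2_def using D[OF Cinf_on_frechet[OF f] p]
    by (intro conjI exI[of _ "\<lambda>s. diff_at f s 1"]) auto
qed

lemma jet2_unique:
  fixes \<phi> :: "real \<Rightarrow> real"
  assumes "jet2 \<phi> a b c" "jet2 \<phi> a' b' c'" shows "a = a'" "b = b'" "c = c'"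
proof -
  obtain f g where 1: "\<forall>\<^sub>F s in nhds 0. (\<phi> has_real_derivative f s) (at s)" "f 0 = b" "(f has_real_derivative c) (at 0)"
    and 2: "\<forall>\<^sub>F s in nhds 0. (\<phi> has_real_derivative g s) (at s)" "g 0 = b'" "(g has_real_derivative c') (at 0)"
    using assms unfolding jet2_def has_real_derivative_iff_has_vector_derivative by blast
  from 1(1) 2(1) have e: "\<forall>\<^sub>F s in nhds 0. f s = g s" by eventually_elim (rule DERIV_unique)
  show "a = a'" using assms by (simp add: jet2_def)
  show "b = b'" using eventually_nhds_x_imp_x[OF e] 1(2) 2(2) by simp
  have "(g has_real_derivative c) (at 0)" using 1(3) DERIV_cong_ev[OF refl e refl] by blast
  then show "c = c'" using 2(3) DERIV_unique by blast
qed

lemma jet2_has_derivative: "jet2 \<phi> a b c \<Longrightarrow> (\<phi> has_vector_derivative b) (at 0)"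
  unfolding jet2_def using eventually_nhds_x_imp_x by blast

text \<open>The tube lemma for the compact sphere.\<close>

lemma eventually_sphere_tube:
  fixes W :: "(real \<times> (real^'n::finite option)) set"
  assumes "open W" "{0} \<times> sphere 0 r \<subseteq> W"
  shows "\<exists>\<delta>>0. \<forall>s p. \<bar>s\<bar> < \<delta> \<longrightarrow> p \<in> sphere 0 r \<longrightarrow> (s, p) \<in> W"
proof -
  have "compact ({0::real} \<times> sphere (0::real^'n option) r)" by (intro compact_Times) auto
  then obtain \<delta> where "\<delta> > 0" "(\<Union>x\<in>{0} \<times> sphere 0 r. ball x \<delta>) \<subseteq> W"
    using compact_subset_open_imp_ball_epsilon_subset[OF _ assms] by blast
  then show ?thesis by (intro exI[of _ \<delta>]) (force simp: dist_Pair_Pair dist_real_def)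
qed

text \<open>The jets of the integrand at each point of the sphere may be computed by any means. They agree with the
  derivatives of the jointly smooth integrand, which can be integrated.\<close>

theorem sphere_integral_second_derivative:
  fixes \<Phi> :: "real \<times> (real^'n::finite option) \<Rightarrow> real"
  assumes r: "r > 0" and \<Phi>: "Cinf_on W \<Phi>" and W: "{0} \<times> sphere 0 r \<subseteq> W"
    and F: "\<forall>\<^sub>F s in nhds 0. F s = (\<integral>p. \<Phi> (s, p) \<partial>sphere_measure r)"
    and jet: "\<And>p. p \<in> sphere 0 r \<Longrightarrow> jet2 (\<lambda>s. \<Phi> (s, p)) (a p) (b p) (c p)"
  shows "(F has_real_derivative (\<integral>p. b p \<partial>sphere_measure r)) (at 0)"
    and "has_second_derivative F (\<integral>p. c p \<partial>sphere_measure r) 0"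
proof -
  let ?M = "sphere_measure r :: (real^'n option) measure"
  obtain \<delta> where \<delta>: "\<delta> > 0" and inW: "\<And>s p. \<bar>s\<bar> < \<delta> \<Longrightarrow> p \<in> sphere 0 r \<Longrightarrow> (s, p) \<in> W"
    using eventually_sphere_tube[OF Cinf_on_open[OF \<Phi>] W] by blast
  have sub: "{-\<delta><..<\<delta>} \<times> sphere 0 r \<subseteq> W" using inW by auto
  have DI: "((\<lambda>s. \<integral>p. \<Psi> (s, p) \<partial>?M) has_real_derivative (\<integral>p. diff_at \<Psi> (s, p) (1, 0) \<partial>?M)) (at s)"
    if \<Psi>: "Cinf_on W \<Psi>" and s: "\<bar>s\<bar> < \<delta>" for \<Psi> s
  proof (rule sphere_integral_has_derivative[OF r s, of "\<lambda>s p. \<Psi> (s, p)" "\<lambda>s p. diff_at \<Psi> (s, p) (1, 0)"])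
    show "continuous_on (sphere 0 r) (\<lambda>p. \<Psi> (s, p))" if "\<bar>s\<bar> < \<delta>" for s
      by (rule continuous_on_compose2[OF Cinf_on_continuous[OF \<Psi>]]) (use inW that in \<open>auto intro!: continuous_intros\<close>)
    show "continuous_on ({-\<delta><..<\<delta>} \<times> sphere 0 r) (\<lambda>(s, p). diff_at \<Psi> (s, p) (1, 0))"
      using continuous_on_subset[OF Cinf_on_continuous[OF Cinf_on_frechet[OF \<Psi>]] sub] by (simp add: case_prod_beta')
    show "((\<lambda>s. \<Psi> (s, p)) has_real_derivative diff_at \<Psi> (s, p) (1, 0)) (at s)"
      if "\<bar>s\<bar> < \<delta>" "p \<in> sphere 0 r" for s p
      using Cinf_on_time_derivative[OF \<Psi> inW[OF that]] by (simp add: has_real_derivative_iff_has_vector_derivative)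
  qed
  define \<Phi>1 where "\<Phi>1 = (\<lambda>q. diff_at \<Phi> q (1, 0))"
  have s1: "Cinf_on W \<Phi>1" unfolding \<Phi>1_def by (rule Cinf_on_frechet[OF \<Phi>])
  have b: "b p = \<Phi>1 (0, p)" and c: "c p = diff_at \<Phi>1 (0, p) (1, 0)" if "p \<in> sphere 0 r" for p
    using jet2_unique[OF jet[OF that] jet2_Cinf_on[OF \<Phi>]] inW[of 0 p] that \<delta> by (auto simp: \<Phi>1_def)
  let ?G = "\<lambda>s. \<integral>p. \<Phi> (s, p) \<partial>?M" and ?G' = "\<lambda>s. \<integral>p. \<Phi>1 (s, p) \<partial>?M"
  have ev: "\<forall>\<^sub>F s in nhds 0. \<bar>s\<bar> < \<delta>"
    using \<delta> eventually_nhds_in_open[of "{-\<delta><..<\<delta>}" 0] by (auto elim!: eventually_mono)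
  have "\<forall>\<^sub>F s in nhds 0. \<forall>\<^sub>F u in nhds s. F u = ?G u" using F by (simp add: eventually_eventually)
  with ev have FD: "\<forall>\<^sub>F s in nhds 0. (F has_real_derivative ?G' s) (at s)"
  proof eventually_elim
    case (elim s)
    then show ?case using DI[OF \<Phi> elim(1)] DERIV_cong_ev[OF refl elim(2) refl] by (simp add: \<Phi>1_def)
  qed
  have b0: "?G' 0 = (\<integral>p. b p \<partial>?M)" by (rule Bochner_Integration.integral_cong) (use b in auto)
  show "(F has_real_derivative (\<integral>p. b p \<partial>?M)) (at 0)" using eventually_nhds_x_imp_x[OF FD] b0 by simp
  have "(?G' has_real_derivative (\<integral>p. diff_at \<Phi>1 (0, p) (1, 0) \<partial>?M)) (at 0)"
    using DI[OF s1] \<delta> by simp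
  also have "(\<integral>p. diff_at \<Phi>1 (0, p) (1, 0) \<partial>?M) = (\<integral>p. c p \<partial>?M)"
    by (rule Bochner_Integration.integral_cong) (use c in auto)
  finally show "has_second_derivative F (\<integral>p. c p \<partial>?M) 0"
    unfolding has_second_derivative_def using FD by (intro exI[of _ ?G'] conjI)
qed

section \<open>The second variation of the functional\<close>

lemma integral_area_measure:
  fixes X :: "real^'n::finite option \<Rightarrow> real^'n option" and g :: "real^'n option \<Rightarrow> real"
  assumes J: "continuous_on (sphere 0 r) J" "\<And>p. p \<in> sphere 0 r \<Longrightarrow> J p \<ge> 0"
    and eq: "\<And>p. p \<in> sphere 0 r \<Longrightarrow> area_density r X p = J p"
    and g: "continuous_on (sphere 0 r) g"
  shows "(\<integral>p. g p \<partial>area_measure r X) = (\<integral>p. J p * g p \<partial>sphere_measure r)"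
proof -
  let ?M = "sphere_measure r :: (real^'n option) measure"
  have mJ: "J \<in> borel_measurable ?M" and mg: "g \<in> borel_measurable ?M"
    by (rule sphere_measurable_continuous, fact)+
  have mA: "area_density r X \<in> borel_measurable ?M"
    using mJ by (subst measurable_cong[of _ _ J]) (use eq in auto)
  have "area_measure r X = density ?M (\<lambda>p. ennreal (J p))"
    unfolding area_measure_def by (rule density_cong) (use mA mJ eq in auto)
  moreover have "AE p in ?M. 0 \<le> J p" using J(2) by (intro AE_I2) auto
  ultimately show ?thesis using integral_density[OF mg mJ] by simp
qed

text \<open>By the symmetry of second derivatives, the time derivatives of the differential of \<open>G\<close> are the differentials of its
  time derivatives.\<close>

lemma jet2_space_derivative:
  fixes G :: "real \<times> 'a::real_normed_vector \<Rightarrow> 'b::real_normed_vector"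
  assumes G: "Cinf_on U G" and p: "(0, p) \<in> U"
    and G1: "G1 = (\<lambda>q. diff_at G q (1, 0))"
    and G2: "G2 = (\<lambda>q. diff_at G1 q (1, 0))"
  shows "jet2 (\<lambda>s. diff_at G (s, p) (0, v)) (diff_at G (0, p) (0, v))
     (diff_at G1 (0, p) (0, v)) (diff_at G2 (0, p) (0, v))"
proof -
  have s1: "Cinf_on U G1" unfolding G1 by (rule Cinf_on_frechet[OF G])
  have "open ((\<lambda>s. (s, p)) -` U)"
    by (rule open_vimage[OF Cinf_on_open[OF G]]) (auto intro!: continuous_intros)
  then have "\<forall>\<^sub>F s in nhds 0. s \<in> (\<lambda>s. (s, p)) -` U" using p by (intro eventually_nhds_in_open) auto
  then have "\<forall>\<^sub>F s in nhds 0. ((\<lambda>s. diff_at G (s, p) (0, v)) has_vector_derivative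
      diff_at G1 (s, p) (0, v)) (at s)"
  proof eventually_elim
    case (elim s)
    then have q: "(s, p) \<in> U" by simp
    show ?case using Cinf_on_time_derivative[OF Cinf_on_frechet[OF G, of "(0, v)"] q]
      unfolding Cinf_on_derivative_commute[OF G q, of "(0, v)" "(1, 0)"] G1 .
  qed
  moreover have "((\<lambda>s. diff_at G1 (s, p) (0, v)) has_vector_derivative
      diff_at G2 (0, p) (0, v)) (at 0)"
    using Cinf_on_time_derivative[OF Cinf_on_frechet[OF s1, of "(0, v)"] p]
    unfolding Cinf_on_derivative_commute[OF s1 p, of "(0, v)" "(1, 0)"] G2 .
  ultimately show ?thesis unfolding jet2_def
    by (intro conjI exI[of _ "\<lambda>s. diff_at G1 (s, p) (0, v)"]) auto
qed

text \<open>The integrand is the tangential divergence of \<open>Z\<close>. The claim is the sum of the scalar divergence theorem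
  over the coordinates of \<open>Z\<close>.\<close>

lemma sphere_vector_divergence:
  fixes Z :: "real^'n::finite option \<Rightarrow> real^'n option"
  assumes r: "r > 0" and Z: "Cinf_on U Z" and U: "sphere 0 r \<subseteq> U"
  defines "d \<equiv> \<lambda>p. (\<Sum>k\<in>UNIV. diff_at Z p (axis k 1) $ k) - (diff_at Z p p \<bullet> p) / r\<^sup>2"
  shows "integrable (sphere_measure r) d"
    and "(\<integral>p. d p \<partial>sphere_measure r) = real CARD('n) / r\<^sup>2 * (\<integral>p. p \<bullet> Z p \<partial>sphere_measure r)"
proof -
  let ?M = "sphere_measure r :: (real^'n option) measure"
  have sk: "Cinf_on U (\<lambda>p. Z p $ k)" for k
    using Cinf_on_inner[OF Z Cinf_on_const[OF Cinf_on_open[OF Z], of "axis k 1"]] by (simp add: inner_axis)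
  have Dk: "diff_at (\<lambda>p. Z p $ k) p v = diff_at Z p v $ k" if "p \<in> U" for k p v
    by (rule frechet_derivative_eq[OF bounded_linear.has_derivative[OF bounded_linear_vec_nth Cinf_on_has_derivative[OF Z that]]])
  let ?h = "\<lambda>k p. r\<^sup>2 * diff_at (\<lambda>p. Z p $ k) p (axis k 1) - p $ k * diff_at (\<lambda>p. Z p $ k) p p"
  have int: "integrable ?M (?h k)" "integrable ?M (\<lambda>p. Z p $ k * p $ k)" for k
    by (intro sphere_integrable_continuous r continuous_intros sphere_integrable_derivative(2)[OF r sk U] Cinf_on_cont_sphere[OF r U sk])+
  have d: "d p = (\<Sum>k\<in>UNIV. ?h k p) / r\<^sup>2" if "p \<in> sphere 0 r" for p
  proof -
    have "p \<in> U" using that U by blast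
    then show ?thesis
      using r by (simp add: Dk d_def inner_vec_def sum_subtractf sum_distrib_left[symmetric] diff_divide_distrib mult.commute)
  qed
  have i: "integrable ?M (\<lambda>p. (\<Sum>k\<in>UNIV. ?h k p) / r\<^sup>2)" using int(1) by (intro integrable_divide Bochner_Integration.integrable_sum)
  show "integrable ?M d"
    using i by (rule Bochner_Integration.integrable_cong[THEN iffD1, rotated -1]) (use d in auto)
  have "(\<integral>p. d p \<partial>?M) = (\<integral>p. (\<Sum>k\<in>UNIV. ?h k p) / r\<^sup>2 \<partial>?M)"
    by (rule Bochner_Integration.integral_cong) (use d in auto)
  also have "\<dots> = (\<Sum>k\<in>UNIV. \<integral>p. ?h k p \<partial>?M) / r\<^sup>2"
    using int(1) by (simp only: integral_divide_zero Bochner_Integration.integral_sum)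
  also have "\<dots> = (\<Sum>k\<in>UNIV. real CARD('n) * (\<integral>p. Z p $ k * p $ k \<partial>?M)) / r\<^sup>2"
    by (simp only: sphere_divergence_axis[OF r sk U])
  also have "\<dots> = real CARD('n) / r\<^sup>2 * (\<integral>p. (\<Sum>k\<in>UNIV. Z p $ k * p $ k) \<partial>?M)"
    using int(2) by (simp add: Bochner_Integration.integral_sum sum_distrib_left[symmetric])
  also have "(\<lambda>p. \<Sum>k\<in>UNIV. Z p $ k * p $ k) = (\<lambda>p. p \<bullet> Z p)"
    by (simp add: inner_vec_def mult.commute)
  finally show "(\<integral>p. d p \<partial>?M) = real CARD('n) / r\<^sup>2 * (\<integral>p. p \<bullet> Z p \<partial>?M)" .
qed

text \<open>In a tangent frame \<open>e\<^sub>i\<close> the Gram matrix has the first derivative \<open>- (2 f / r) \<delta>\<^sub>i\<^sub>j\<close>, because the initial velocity is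
  normal, and the trace of its second derivative consists of the squared differential of the velocity
  and of the divergence of the acceleration.\<close>

lemma jet2_squared_density:
  fixes G :: "real \<times> (real^'n::finite option) \<Rightarrow> real^'n option" and f :: "real^'n option \<Rightarrow> real"
  assumes r: "r > 0" and G: "Cinf_on U G" and U: "{0} \<times> sphere 0 r \<subseteq> U" and p: "p \<in> sphere 0 r"
    and id: "\<And>p. p \<in> sphere 0 r \<Longrightarrow> G (0, p) = p"
    and f: "Cinf_on V f" "sphere 0 r \<subseteq> V"
    and G1: "G1 = (\<lambda>q. diff_at G q (1, 0))"
    and G2: "G2 = (\<lambda>q. diff_at G1 q (1, 0))"
    and fG: "\<And>p. p \<in> sphere 0 r \<Longrightarrow> G1 (0, p) = - (f p / r) *\<^sub>R p"
  shows "jet2 (\<lambda>s. det (gram_matrix r (\<lambda>v. diff_at G (s, p) (0, v)) p)) 1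
     (real CARD('n) * (- 2 * f p / r))
     (real CARD('n) * (real CARD('n) - 1) * (- 2 * f p / r)\<^sup>2
       + (2 * (grad_pairing r f f p / r\<^sup>2) + 2 * real CARD('n) * (f p)\<^sup>2 / r\<^sup>2 
       + 2 * ((\<Sum>k\<in>UNIV. diff_at G2 (0, p) (0, axis k 1) $ k) - (diff_at G2 (0, p) (0, p) \<bullet> p) / r\<^sup>2)))"
proof -
  have p0: "p \<noteq> 0" and np: "norm p = r" using p r by auto
  have pp: "p \<bullet> p = r\<^sup>2" by (rule sphere_inner_self[OF p])
  have pU: "(0, p) \<in> U" using p U by auto
  obtain e where e: "tangent_frame p e" using tangent_frame_exists[OF p0] by blast
  have ep: "e i \<bullet> p = 0" "p \<bullet> e i = 0" and ee: "e i \<bullet> e j = (if i = j then 1 else 0)" for i j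
    using e by (auto simp: tangent_frame_def inner_commute[of p])
  have s1: "Cinf_on U G1" unfolding G1 by (rule Cinf_on_frechet[OF G])
  have s2: "Cinf_on U G2" unfolding G2 by (rule Cinf_on_frechet[OF s1])
  let ?A = "\<lambda>s v. diff_at G (s, p) (0, v)"
  let ?Df = "diff_at f p"
  have pV: "p \<in> V" using p f(2) by blast
  have A0: "?A 0 v = v" if v: "v \<bullet> p = 0" for v
  proof (rule tangential_derivative_unique[OF r p v, of "\<lambda>p. G (0, p)" _ "\<lambda>v. v"])
    show "((\<lambda>p. G (0, p)) has_derivative ?A 0) (at p within sphere 0 r)"
      by (rule has_derivative_at_withinI[OF Cinf_on_space_derivative[OF G pU]])
    show "((\<lambda>p. G (0, p)) has_derivative (\<lambda>v. v)) (at p within sphere 0 r)"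
      by (rule has_derivative_transform[OF p id has_derivative_ident])
  qed
  have A1: "diff_at G1 (0, p) (0, v) = - (?Df v / r) *\<^sub>R p - (f p / r) *\<^sub>R v" if v: "v \<bullet> p = 0" for v
  proof (rule tangential_derivative_unique[OF r p v, of "\<lambda>p. G1 (0, p)" _ "\<lambda>v. - (?Df v / r) *\<^sub>R p - (f p / r) *\<^sub>R v"])
    show "((\<lambda>p. G1 (0, p)) has_derivative (\<lambda>v. diff_at G1 (0, p) (0, v))) (at p within sphere 0 r)"
      by (rule has_derivative_at_withinI[OF Cinf_on_space_derivative[OF s1 pU]])
    have "((\<lambda>p. - (f p / r) *\<^sub>R p) has_derivative (\<lambda>v. - (?Df v / r) *\<^sub>R p - (f p / r) *\<^sub>R v)) (at p within sphere 0 r)"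
      using has_derivative_at_withinI[OF Cinf_on_has_derivative[OF f(1) pV]] r
      by (auto intro!: derivative_eq_intros simp: algebra_simps)
    then show "((\<lambda>p. G1 (0, p)) has_derivative (\<lambda>v. - (?Df v / r) *\<^sub>R p - (f p / r) *\<^sub>R v)) (at p within sphere 0 r)"
      by (rule has_derivative_transform[OF p, rotated]) (rule fG)
  qed
  let ?C = "\<lambda>i. diff_at G2 (0, p) (0, e i)"
  let ?B = "\<lambda>i. - (?Df (e i) / r) *\<^sub>R p - (f p / r) *\<^sub>R e i"
  have jA: "jet2 (\<lambda>s. ?A s (e i)) (e i) (?B i) (?C i)" for i
    using jet2_space_derivative[OF G pU G1 G2, of "e i"] A0[of "e i"] A1[of "e i"] ep by simp
  have eB: "e i \<bullet> ?B j = (if i = j then - f p / r else 0)" "?B j \<bullet> e i = (if i = j then - f p / r else 0)" for i j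
    using ee[of i j] ee[of j i] ep by (auto simp: inner_simps)
  have BB: "?B i \<bullet> ?B i = (?Df (e i))\<^sup>2 + (f p)\<^sup>2 / r\<^sup>2" for i
    using r ee[of i i] ep by (simp add: inner_simps pp power2_eq_square)
  let ?k = "\<lambda>i j. e i \<bullet> ?C j + ?B i \<bullet> ?B j + (?B i \<bullet> ?B j + ?C i \<bullet> e j)"
  have "jet2 (\<lambda>s. (\<chi> i j. ?A s (e i) \<bullet> ?A s (e j)) $ i $ j) (if i = j then 1 else 0) (if i = j then - 2 * f p / r else 0) (?k i j)" for i j
    using jet2_inner[OF jA[of i] jA[of j]] unfolding ee eB by (auto split: if_splits)
  from jet2_det[OF this]
  have 1: "jet2 (\<lambda>s. det (\<chi> i j. ?A s (e i) \<bullet> ?A s (e j))) 1 (real CARD('n) * (- 2 * f p / r))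
     (real CARD('n) * (real CARD('n) - 1) * (- 2 * f p / r)\<^sup>2 + (\<Sum>i\<in>UNIV. ?k i i))" .
  have t1: "(\<Sum>i\<in>UNIV. (?Df (e i))\<^sup>2) = grad_pairing r f f p / r\<^sup>2"
  proof -
    have l: "linear ?Df" by (rule Cinf_on_frechet_linear[OF f(1) pV])
    have "bilinear (\<lambda>v w. ?Df v * ?Df w)"
      unfolding bilinear_def by (auto intro!: linearI simp: linear_add[OF l] linear_scale[OF l] algebra_simps)
    from frame_trace[OF e p0 this] show ?thesis
      using r by (simp add: grad_pairing_def np diff_divide_distrib power2_eq_square)
  qed
  have t2: "(\<Sum>i\<in>UNIV. ?C i \<bullet> e i) = (\<Sum>k\<in>UNIV. diff_at G2 (0, p) (0, axis k 1) $ k) - (diff_at G2 (0, p) (0, p) \<bullet> p) / r\<^sup>2"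
  proof -
    have l: "linear (\<lambda>v. diff_at G2 (0, p) (0, v))"
      by (rule has_derivative_linear[OF Cinf_on_space_derivative[OF s2 pU]])
    have "bilinear (\<lambda>v w. diff_at G2 (0, p) (0, v) \<bullet> w)"
      unfolding bilinear_def by (auto intro!: linearI simp: linear_add[OF l] linear_scale[OF l] inner_simps)
    from frame_trace[OF e p0 this] show ?thesis by (simp add: np inner_axis)
  qed
  have ki: "?k i i = 2 * (?C i \<bullet> e i) + 2 * (?Df (e i))\<^sup>2 + 2 * (f p)\<^sup>2 / r\<^sup>2" for i
    unfolding BB by (simp add: inner_commute)
  have "(\<Sum>i\<in>UNIV. ?k i i) = (\<Sum>i\<in>UNIV. 2 * (?C i \<bullet> e i) + 2 * (?Df (e i))\<^sup>2 + 2 * (f p)\<^sup>2 / r\<^sup>2)"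
    by (rule sum.cong[OF refl ki])
  also have "\<dots> = 2 * (\<Sum>i\<in>UNIV. (?Df (e i))\<^sup>2) + 2 * real CARD('n) * (f p)\<^sup>2 / r\<^sup>2 + 2 * (\<Sum>i\<in>UNIV. ?C i \<bullet> e i)"
    by (simp add: sum.distrib sum_distrib_left)
  finally have tr: "(\<Sum>i\<in>UNIV. ?k i i) = 2 * (\<Sum>i\<in>UNIV. (?Df (e i))\<^sup>2) + 2 * real CARD('n) * (f p)\<^sup>2 / r\<^sup>2 + 2 * (\<Sum>i\<in>UNIV. ?C i \<bullet> e i)" .
  note 2 = 1[unfolded tr t1 t2]
  have "open ((\<lambda>s. (s, p)) -` U)"
    by (rule open_vimage[OF Cinf_on_open[OF G]]) (auto intro!: continuous_intros)
  then have "\<forall>\<^sub>F s in nhds 0. s \<in> (\<lambda>s. (s, p)) -` U" using pU by (intro eventually_nhds_in_open) auto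
  then have "\<forall>\<^sub>F s in nhds 0. det (\<chi> i j. ?A s (e i) \<bullet> ?A s (e j)) = det (gram_matrix r (?A s) p)"
  proof eventually_elim
    case (elim s)
    then have "linear (?A s)" using has_derivative_linear[OF Cinf_on_space_derivative[OF G, of s p]] by simp
    from det_gram_matrix[OF r p this e] show ?case by simp
  qed
  from jet2_cong_ev[OF this 2] show ?thesis .
qed

lemma jet2_weaken: "jet2 \<phi> a b c \<Longrightarrow> a = a' \<Longrightarrow> b = b' \<Longrightarrow> c = c' \<Longrightarrow> jet2 \<phi> a' b' c'"
  by simp

text \<open>The pointwise computation behind the second variation. Here \<open>f\<close> is the speed, \<open>w = \<langle>y,p\<rangle>\<close>, \<open>yy = |y|\<^sup>2\<close>, \<open>w2\<close> and \<open>z\<close> are the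
  inner products of \<open>p\<close> with the accelerations of the base point and of the surface, \<open>g\<close> is the squared gradient of \<open>f\<close> and \<open>d\<close>
  the divergence of the acceleration. The last terms integrate to zero.\<close>

lemma jet2_integrand:
  fixes r f w w2 z yy h h2 g d n lam \<kappa> :: real
  assumes r: "r > 0" and lam: "lam = n / r - r"
    and q: "jet2 q (r\<^sup>2) (2 * (- f * r - w)) (2 * (z - w2) + 2 * (f\<^sup>2 + 2 * f * w / r + yy))"
    and \<tau>: "jet2 \<tau> 1 h h2"
    and J: "jet2 J 1 (n * (- 2 * f / r)) (n * (n - 1) * (- 2 * f / r)\<^sup>2 + (2 * g + 2 * n * f\<^sup>2 / r\<^sup>2 + 2 * d))"
    and v: "jet2 v (- r) (f + w / r) (w2 / r - z / r)"
  shows "jet2 (\<lambda>s. \<kappa> * (\<tau> s powr (- n / 2) * (exp ((- 1 / 2) * (q s * \<tau> s powr (- 1))) * J s powr (1 / 2)))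
       + lam * \<kappa> * exp (- r\<^sup>2 / 2) * (\<tau> s powr (- 1 / 2) * v s))
     (\<kappa> * exp (- r\<^sup>2 / 2) * (1 - lam * r))
     (\<kappa> * exp (- r\<^sup>2 / 2) * (n / r\<^sup>2 * w))
     (\<kappa> * exp (- r\<^sup>2 / 2) * (g + (lam\<^sup>2 - 1 - n / r\<^sup>2) * f\<^sup>2 + (((n - r\<^sup>2)\<^sup>2 - r\<^sup>2 - n) / r) * h * f
        - 2 * (lam + 1 / r) * (f * w) + w\<^sup>2 - yy + ((n - r\<^sup>2)\<^sup>2 - r\<^sup>2 - n) / 4 * h\<^sup>2
        + n / r\<^sup>2 * w2 - (r * lam + 2 + lam / r) * h * w + (d - n / r\<^sup>2 * z)))"
proof -
  define E where "E = exp (- r\<^sup>2 / 2)"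
  have E: "exp (- 1 / 2 * (r\<^sup>2 * 1)) = E" by (simp add: E_def)
  note 1 = jet2_mult[OF q jet2_powr[OF \<tau>, of "- 1"]]
  note 2 = jet2_exp[OF jet2_cmult[OF 1, of "- 1 / 2"]]
  note 3 = jet2_mult[OF jet2_powr[OF \<tau>, of "- n / 2"] jet2_mult[OF 2 jet2_powr[OF J, of "1 / 2"]]]
  note 4 = jet2_mult[OF jet2_powr[OF \<tau>, of "- 1 / 2"] v]
  note 5 = jet2_add[OF jet2_cmult[OF 3, of \<kappa>] jet2_cmult[OF 4, of "lam * \<kappa> * E"], unfolded E]
  define i where "i = 1 / r"
  \<comment> \<open>With \<open>i\<close> for \<open>1 / r\<close> the claims are polynomial identities modulo \<open>r i = 1\<close>.\<close>
  have ri: "r * i = 1" using r by (simp add: i_def)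
  have dv: "x / r = x * i" "x / r\<^sup>2 = x * i * i" for x by (simp_all add: i_def power2_eq_square)
  have lam': "lam = n * i - r" using lam by (simp add: i_def)
  show ?thesis
    unfolding E_def[symmetric]
  proof (rule jet2_weaken[OF 5])
  qed (use ri lam' in \<open>simp_all only: dv, algebra+\<close>)
qed

lemma Cinf_on_compose_fst: "Cinf_on V g \<Longrightarrow> Cinf_on (fst -` V) (\<lambda>q. g (fst q))"
  by (rule Cinf_on_compose_linear[OF _ bounded_linear_fst])

lemma Cinf_on_open_positive:
  fixes u :: "'a::real_normed_vector \<Rightarrow> real"
  assumes "Cinf_on W u" shows "open {q \<in> W. u q > 0}"
proof -
  have "open (W \<inter> u -` {0<..})"
    by (rule continuous_open_preimage[OF Cinf_on_continuous[OF assms] Cinf_on_open[OF assms]]) simp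
  moreover have "W \<inter> u -` {0<..} = {q \<in> W. u q > 0}" by auto
  ultimately show ?thesis by simp
qed

text \<open>Expressing the projected vectors through coordinate directions reduces the entries to directional derivatives in fixed
  directions.\<close>

lemma Cinf_on_gram_matrix:
  fixes G :: "real \<times> (real^'n::finite option) \<Rightarrow> real^'n option"
  assumes G: "Cinf_on U G"
  shows "Cinf_on U (\<lambda>q. gram_matrix r (\<lambda>v. diff_at G q (0, v)) (snd q) $ k $ l)"
proof -
  note o = Cinf_on_open[OF G]
  have sn: "Cinf_on U (\<lambda>q. snd q $ m)" for m :: "'n option"
    by (intro Cinf_on_linear o bounded_linear_compose[OF bounded_linear_vec_nth bounded_linear_snd])
  define A where "A m q = diff_at G q (0, axis m 1) 
     - (snd q $ m / r\<^sup>2) *\<^sub>R (\<Sum>j\<in>UNIV. snd q $ j *\<^sub>R diff_at G q (0, axis j 1))" for m q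
  have sA: "Cinf_on U (A m)" for m
    unfolding A_def divide_inverse
    by (intro Cinf_on_diff Cinf_on_scaleR Cinf_on_sum Cinf_on_mult Cinf_on_const Cinf_on_frechet[OF G] sn o)
  have A: "A m q = diff_at G q (0, axis m 1 - (snd q $ m / r\<^sup>2) *\<^sub>R snd q)" if "q \<in> U" for m q
  proof -
    have "(fst q, snd q) \<in> U" using that by simp
    then have l: "linear (\<lambda>v. diff_at G q (0, v))"
      using has_derivative_linear[OF Cinf_on_space_derivative[OF G]] by fastforce
    have "diff_at G q (0, snd q) = diff_at G q (0, \<Sum>j\<in>UNIV. snd q $ j *\<^sub>R axis j 1)"
      by (simp add: basis_expansion scalar_mult_eq_scaleR[symmetric])
    also have "\<dots> = (\<Sum>j\<in>UNIV. snd q $ j *\<^sub>R diff_at G q (0, axis j 1))"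
      using linear_sum[OF l, of "\<lambda>j. snd q $ j *\<^sub>R axis j 1" UNIV] linear_scale[OF l] by simp
    finally show ?thesis
      using linear_diff[OF l, of "axis m 1" "(snd q $ m / r\<^sup>2) *\<^sub>R snd q"] linear_scale[OF l, of "snd q $ m / r\<^sup>2" "snd q"]
      by (simp add: A_def)
  qed
  have "Cinf_on U (\<lambda>q. A k q \<bullet> A l q + snd q $ k * snd q $ l / r\<^sup>2)"
    unfolding divide_inverse by (intro Cinf_on_add Cinf_on_inner sA Cinf_on_mult sn Cinf_on_const o)
  then show ?thesis by (rule Cinf_on_cong) (simp add: gram_matrix_def A)
qed

text \<open>What the second variation uses of a normal variation: it starts at the identity, and its velocity at \<open>s = 0\<close>, but not
  necessarily later, is a multiple of the normal. The speed \<open>f\<close> is given on a neighbourhood \<open>V\<close> of the sphere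
  so that ambient derivatives of it make sense.\<close>

definition initial_normal_speed ::
    "real \<Rightarrow> (real \<Rightarrow> real^'n::finite option \<Rightarrow> real^'n option) \<Rightarrow> (real^'n option) set \<Rightarrow> (real^'n option \<Rightarrow> real) \<Rightarrow> bool" where
  "initial_normal_speed r Xs V f \<longleftrightarrow>
     (\<exists>\<epsilon>>0. smooth_on ({-\<epsilon><..<\<epsilon>} \<times> sphere 0 r) (\<lambda>(s, p). Xs s p)) \<and> (\<forall>p\<in>sphere 0 r. Xs 0 p = p) \<and>
     Cinf_on V f \<and> sphere 0 r \<subseteq> V \<and>
     (\<forall>p\<in>sphere 0 r. ((\<lambda>s. Xs s p) has_vector_derivative f p *\<^sub>R (- (1 / r) *\<^sub>R p)) (at 0))"

definition second_variation_form :: "real \<Rightarrow> (real^'n::finite option \<Rightarrow> real) \<Rightarrow> real^'n option \<Rightarrow> real \<Rightarrow> real" where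
  "second_variation_form r f y h = (let n = real CARD('n); lam = n / r - r; Q = (n - r\<^sup>2)\<^sup>2 - r\<^sup>2 - n;
       vol = measure (sphere_measure r :: (real^'n option) measure) (sphere 0 r)
     in dirichlet r f f / r\<^sup>2 + (lam\<^sup>2 - 1 - n / r\<^sup>2) * sphere_inner r f f
          + (Q / r) * h * (\<integral>p. f p \<partial>sphere_measure r) - 2 * (lam + 1 / r) * (\<integral>p. f p * (y \<bullet> p) \<partial>sphere_measure r)
          + (r\<^sup>2 / (n + 1) - 1) * (y \<bullet> y) * vol + Q / 4 * h\<^sup>2 * vol)"

abbreviation sphere_F ::
    "real \<Rightarrow> (real \<Rightarrow> real^'n::finite option \<Rightarrow> real^'n option) \<Rightarrow> (real \<Rightarrow> real^'n option) \<Rightarrow> (real \<Rightarrow> real) \<Rightarrow> real \<Rightarrow> real" where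
  "sphere_F r Xs x t \<equiv> F_functional r (\<lambda>p. p) (\<lambda>p. - (1 / r) *\<^sub>R p) 0 1 (real CARD('n) / r - r) Xs x t"

text \<open>Near \<open>s = 0\<close> the functional is the integral over the fixed round sphere of one jointly smooth function, so only its
  jets at each point have to be integrated. Terms linear in \<open>p\<close> have mean zero, and the divergence of the
  acceleration cancels against its normal component.\<close>

theorem second_variation:
  fixes Xs :: "real \<Rightarrow> real^'n::finite option \<Rightarrow> real^'n option"
  assumes r: "r > 0" and speed: "initial_normal_speed r Xs V f"
    and x: "point_variation 0 x" "(x has_vector_derivative y) (at 0)"
    and t: "scale_variation 1 t" "(t has_real_derivative h) (at 0)"
  shows "(sphere_F r Xs x t has_real_derivative 0) (at 0)"
    and "has_second_derivative (sphere_F r Xs x t)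
           ((4 * pi) powr (- real CARD('n) / 2) * exp (- r\<^sup>2 / 2) * second_variation_form r f y h) 0"
proof -
  define lam where "lam = real CARD('n) / r - r"
  define F where "F = sphere_F r Xs x t"
  define K where "K = (4 * pi) powr (- real CARD('n) / 2) * exp (- r\<^sup>2 / 2)"
  define Q where "Q = (real CARD('n) - r\<^sup>2)\<^sup>2 - r\<^sup>2 - real CARD('n)"
  define vol where "vol = measure (sphere_measure r :: (real^'n option) measure) (sphere 0 r)"
  obtain \<epsilon> where \<epsilon>: "\<epsilon> > 0" and Xs: "smooth_on ({-\<epsilon><..<\<epsilon>} \<times> sphere 0 r) (\<lambda>(s, p). Xs s p)"
    and X0: "\<And>p. p \<in> sphere 0 r \<Longrightarrow> Xs 0 p = p"
    and f: "Cinf_on V f" "sphere 0 r \<subseteq> V"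
    and X1: "\<And>p. p \<in> sphere 0 r \<Longrightarrow> ((\<lambda>s. Xs s p) has_vector_derivative f p *\<^sub>R (- (1 / r) *\<^sub>R p)) (at 0)"
    using speed unfolding initial_normal_speed_def by blast
  let ?M = "sphere_measure r :: (real^'n option) measure" and ?S = "sphere 0 r :: (real^'n option) set"
  let ?n = "real CARD('n)"
  interpret finite_measure ?M by (rule sphere_measure_finite_pos[OF r])
  obtain U G where G: "Cinf_on U G" and US: "{-\<epsilon><..<\<epsilon>} \<times> ?S \<subseteq> U" and GX: "\<And>q. q \<in> {-\<epsilon><..<\<epsilon>} \<times> ?S \<Longrightarrow> G q = (case q of (s, p) \<Rightarrow> Xs s p)"
    using smooth_on_E[OF Xs] by metis
  have GXs: "G (s, p) = Xs s p" if "\<bar>s\<bar> < \<epsilon>" "p \<in> ?S" for s p using GX[of "(s, p)"] that by (auto simp: abs_less_iff)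
  obtain \<epsilon>x Ux gx where \<epsilon>x: "\<epsilon>x > 0" and gx: "Cinf_on Ux gx" "{-\<epsilon>x<..<\<epsilon>x} \<subseteq> Ux" and gxx: "\<And>s. s \<in> {-\<epsilon>x<..<\<epsilon>x} \<Longrightarrow> gx s = x s" and x0: "x 0 = 0"
    using x(1) smooth_on_E unfolding point_variation_def by metis
  obtain \<epsilon>t Ut gt where \<epsilon>t: "\<epsilon>t > 0" and gt: "Cinf_on Ut gt" "{-\<epsilon>t<..<\<epsilon>t} \<subseteq> Ut" and gtt: "\<And>s. s \<in> {-\<epsilon>t<..<\<epsilon>t} \<Longrightarrow> gt s = t s" and t0: "t 0 = 1"
    using t(1) smooth_on_E unfolding scale_variation_def by metis
  have ev_small: "\<forall>\<^sub>F s in nhds 0. \<bar>s\<bar> < \<delta>" if "\<delta> > 0" for \<delta> :: real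
    using that eventually_nhds_in_open[of "{-\<delta><..<\<delta>}" 0] by (auto elim!: eventually_mono)
  have evx: "\<forall>\<^sub>F s in nhds 0. gx s = x s" using ev_small[OF \<epsilon>x] by eventually_elim (auto simp: abs_less_iff intro!: gxx)
  have evt: "\<forall>\<^sub>F s in nhds 0. gt s = t s" using ev_small[OF \<epsilon>t] by eventually_elim (auto simp: abs_less_iff intro!: gtt)

  define D where "D q = det (gram_matrix r (\<lambda>v. diff_at G q (0, v)) (snd q))" for q
  have sD: "Cinf_on U D" unfolding D_def by (intro Cinf_on_det Cinf_on_open[OF G] Cinf_on_gram_matrix[OF G])
  define W0 where "W0 = U \<inter> fst -` Ux \<inter> fst -` Ut"
  have oW0: "open W0" unfolding W0_def
    using Cinf_on_open[OF G] Cinf_on_open[OF Cinf_on_compose_fst[OF gx(1)]] Cinf_on_open[OF Cinf_on_compose_fst[OF gt(1)]] by (intro open_Int) auto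
  have W0s: "Cinf_on W0 G" "Cinf_on W0 D" "Cinf_on W0 (\<lambda>q. gx (fst q))" "Cinf_on W0 (\<lambda>q. gt (fst q))"
    using Cinf_on_subset[OF G oW0] Cinf_on_subset[OF sD oW0] Cinf_on_subset[OF Cinf_on_compose_fst[OF gx(1)] oW0]
      Cinf_on_subset[OF Cinf_on_compose_fst[OF gt(1)] oW0] by (auto simp: W0_def)
  \<comment> \<open>Away from \<open>s = 0\<close> the extensions may degenerate, so the scale and the squared density are forced to stay positive.\<close>
  define W where "W = {q \<in> W0. D q > 0} \<inter> {q \<in> W0. gt (fst q) > 0}"
  have oW: "open W" unfolding W_def using Cinf_on_open_positive W0s by (intro open_Int) auto
  have WW0: "W \<subseteq> W0" by (auto simp: W_def)
  note Ws = W0s[THEN Cinf_on_subset, OF oW WW0]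
  have Wpos: "D q > 0" "gt (fst q) > 0" if "q \<in> W" for q using that by (auto simp: W_def)

  define G1 where "G1 = (\<lambda>q. diff_at G q (1, 0))"
  define G2 where "G2 = (\<lambda>q. diff_at G1 q (1, 0))"
  have s1: "Cinf_on U G1" and s2: "Cinf_on U G2" unfolding G1_def G2_def by (intro Cinf_on_frechet G)+
  have S0: "{0} \<times> ?S \<subseteq> U" using US \<epsilon> by auto
  have SU: "(0, p) \<in> U" if "p \<in> ?S" for p using S0 that by auto
  have G0: "G (0, p) = p" if "p \<in> ?S" for p using GXs[of 0 p] X0 that \<epsilon> by simp
  have G1f: "G1 (0, p) = - (f p / r) *\<^sub>R p" if p: "p \<in> ?S" for p
  proof -
    have "((\<lambda>s. G (s, p)) has_vector_derivative G1 (0, p)) (at 0)"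
      unfolding G1_def by (rule Cinf_on_time_derivative[OF G SU[OF p]])
    then have "((\<lambda>s. Xs s p) has_vector_derivative G1 (0, p)) (at 0)"
      by (rule has_vector_derivative_transform_within_open[of _ _ _ "{-\<epsilon><..<\<epsilon>}"]) (use \<epsilon> GXs p in auto)
    then show ?thesis using vector_derivative_unique_at[OF _ X1[OF p]] by fastforce
  qed
  have gx0: "gx 0 = 0" using gxx[of 0] x0 \<epsilon>x by simp
  have gt0: "gt 0 = 1" using gtt[of 0] t0 \<epsilon>t by simp

  obtain y2 where jx: "jet2 gx 0 y y2"
  proof -
    have "jet2 gx (gx 0) (diff_at gx 0 1) (diff_at (\<lambda>q. diff_at gx q 1) 0 1)"
      by (rule jet2_Cinf_on_real[OF gx(1)]) (use gx(2) \<epsilon>x in auto)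
    moreover from jet2_has_derivative[OF this] have "diff_at gx 0 1 = y"
    proof -
      assume "(gx has_vector_derivative diff_at gx 0 1) (at 0)"
      then have "(x has_vector_derivative diff_at gx 0 1) (at 0)"
        by (rule has_vector_derivative_transform_within_open[of _ _ _ "{-\<epsilon>x<..<\<epsilon>x}"]) (use \<epsilon>x gxx in auto)
      then show ?thesis using vector_derivative_unique_at[OF _ x(2)] by fastforce
    qed
    ultimately show ?thesis using that gx0 by simp
  qed
  obtain h2 where jt: "jet2 gt 1 h h2"
  proof -
    have "jet2 gt (gt 0) (diff_at gt 0 1) (diff_at (\<lambda>q. diff_at gt q 1) 0 1)"
      by (rule jet2_Cinf_on_real[OF gt(1)]) (use gt(2) \<epsilon>t in auto)
    moreover from jet2_has_derivative[OF this] have "diff_at gt 0 1 = h"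
    proof -
      assume "(gt has_vector_derivative diff_at gt 0 1) (at 0)"
      then have "(t has_vector_derivative diff_at gt 0 1) (at 0)"
        by (rule has_vector_derivative_transform_within_open[of _ _ _ "{-\<epsilon>t<..<\<epsilon>t}"]) (use \<epsilon>t gtt in auto)
      then show ?thesis using vector_derivative_unique_at[OF _ t(2)[unfolded has_real_derivative_iff_has_vector_derivative]] by fastforce
    qed
    ultimately show ?thesis using that gt0 by simp
  qed

  define \<kappa> where "\<kappa> = (4 * pi) powr (- ?n / 2)"
  define q where "q z = (G z - gx (fst z)) \<bullet> (G z - gx (fst z))" for z
  define v where "v z = (G z - gx (fst z)) \<bullet> (- (1 / r) *\<^sub>R snd z)" for z
  define \<Phi> where "\<Phi> z = \<kappa> * (gt (fst z) powr (- ?n / 2) * (exp ((- 1 / 2) * (q z * gt (fst z) powr (- 1))) * D z powr (1 / 2)))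
       + lam * \<kappa> * exp (- r\<^sup>2 / 2) * (gt (fst z) powr (- 1 / 2) * v z)" for z
  have sq: "Cinf_on W q" unfolding q_def by (intro Cinf_on_inner Cinf_on_diff Ws)
  have sv: "Cinf_on W v" unfolding v_def
    by (intro Cinf_on_inner Cinf_on_diff Ws Cinf_on_scaleR Cinf_on_const Cinf_on_linear oW bounded_linear_snd)
  have sP: "Cinf_on W (\<lambda>z. gt (fst z) powr a)" for a by (rule Cinf_on_powr[OF Ws(4) Wpos(2)])
  have sA: "Cinf_on W (\<lambda>z. \<kappa> * (gt (fst z) powr (- ?n / 2) * (exp ((- 1 / 2) * (q z * gt (fst z) powr (- 1))) * D z powr (1 / 2))))"
    by (intro Cinf_on_cmult Cinf_on_mult Cinf_on_exp sP sq Cinf_on_powr[OF Ws(2) Wpos(1)])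
  have sB: "Cinf_on W (\<lambda>z. lam * \<kappa> * exp (- r\<^sup>2 / 2) * (gt (fst z) powr (- 1 / 2) * v z))"
    by (intro Cinf_on_cmult Cinf_on_mult sP sv)
  have s\<Phi>: "Cinf_on W \<Phi>" unfolding \<Phi>_def by (rule Cinf_on_add[OF sA sB])

  let ?div = "\<lambda>p. (\<Sum>k\<in>UNIV. diff_at G2 (0, p) (0, axis k 1) $ k) - (diff_at G2 (0, p) (0, p) \<bullet> p) / r\<^sup>2"
  let ?z = "\<lambda>p. p \<bullet> G2 (0, p)"
  have jD: "jet2 (\<lambda>s. D (s, p)) 1 (?n * (- 2 * f p / r)) (?n * (?n - 1) * (- 2 * f p / r)\<^sup>2
       + (2 * (grad_pairing r f f p / r\<^sup>2) + 2 * ?n * (f p)\<^sup>2 / r\<^sup>2 + 2 * ?div p))" if "p \<in> ?S" for p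
    using jet2_squared_density[OF r G S0 that G0 f G1_def G2_def G1f] by (simp add: D_def)
  have jX: "jet2 (\<lambda>s. G (s, p)) p (- (f p / r) *\<^sub>R p) (G2 (0, p))" if "p \<in> ?S" for p
    using jet2_Cinf_on[OF G SU[OF that]] G0[OF that] G1f[OF that] by (simp add: G1_def G2_def)
  have jet: "jet2 (\<lambda>s. \<Phi> (s, p)) (\<kappa> * exp (- r\<^sup>2 / 2) * (1 - lam * r)) (K * (?n / r\<^sup>2 * (y \<bullet> p)))
     (K * (grad_pairing r f f p / r\<^sup>2 + (lam\<^sup>2 - 1 - ?n / r\<^sup>2) * (f p)\<^sup>2 + (Q / r) * h * f p
        - 2 * (lam + 1 / r) * (f p * (y \<bullet> p)) + (y \<bullet> p)\<^sup>2 - y \<bullet> y + Q / 4 * h\<^sup>2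
        + ?n / r\<^sup>2 * (y2 \<bullet> p) - (r * lam + 2 + lam / r) * h * (y \<bullet> p) + (?div p - ?n / r\<^sup>2 * ?z p)))"
    if p: "p \<in> ?S" for p
  proof -
    have pp: "p \<bullet> p = r\<^sup>2" by (rule sphere_inner_self[OF p])
    let ?B = "- (f p / r) *\<^sub>R p - y" and ?C = "G2 (0, p) - y2"
    have jd: "jet2 (\<lambda>s. G (s, p) - gx s) p ?B ?C"
      using jet2_diff[OF jX[OF p] jx] by simp
    have pB: "p \<bullet> ?B = - f p * r - y \<bullet> p"
      using r by (simp add: inner_diff_right pp inner_commute[of p y] power2_eq_square)
    have pC: "p \<bullet> ?C = ?z p - y2 \<bullet> p" by (simp add: inner_diff_right inner_commute[of p y2])
    have "?B \<bullet> ?B = (f p / r)\<^sup>2 * (p \<bullet> p) + 2 * (f p / r) * (y \<bullet> p) + y \<bullet> y"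
      using r by (simp add: inner_diff_right inner_diff_left inner_commute[of p y] power2_eq_square field_simps)
    then have BB: "?B \<bullet> ?B = (f p)\<^sup>2 + 2 * f p * (y \<bullet> p) / r + y \<bullet> y"
      unfolding pp using r by (simp add: power_divide)
    have jq: "jet2 (\<lambda>s. q (s, p)) (r\<^sup>2) (2 * (- f p * r - y \<bullet> p)) (2 * (?z p - y2 \<bullet> p) + 2 * ((f p)\<^sup>2 + 2 * f p * (y \<bullet> p) / r + y \<bullet> y))"
      unfolding q_def fst_conv
      by (rule jet2_weaken[OF jet2_inner[OF jd jd]], unfold inner_commute[of ?B p] inner_commute[of ?C p] pB pC BB pp) simp_all
    have jv: "jet2 (\<lambda>s. v (s, p)) (- r) (f p + y \<bullet> p / r) (y2 \<bullet> p / r - ?z p / r)"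
      unfolding v_def fst_conv snd_conv
    proof (rule jet2_weaken[OF jet2_inner[OF jd jet2_const]])
      show "p \<bullet> (- (1 / r) *\<^sub>R p) = - r" using r by (simp add: pp power2_eq_square)
      show "p \<bullet> 0 + ?B \<bullet> (- (1 / r) *\<^sub>R p) = f p + y \<bullet> p / r"
        unfolding inner_scaleR_right inner_commute[of ?B p] pB using r by (simp add: field_simps)
      show "p \<bullet> 0 + ?B \<bullet> 0 + (?B \<bullet> 0 + ?C \<bullet> (- (1 / r) *\<^sub>R p)) = y2 \<bullet> p / r - ?z p / r"
        unfolding inner_scaleR_right inner_commute[of ?C p] pC by (simp add: diff_divide_distrib)
    qed
    show ?thesis
      unfolding \<Phi>_def fst_conv K_def Q_def \<kappa>_def[symmetric]
      by (rule jet2_integrand[OF r lam_def jq jt jD[OF p] jv])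
  qed

  have W0S: "{0} \<times> ?S \<subseteq> W"
  proof -
    have "(0, p) \<in> W" if p: "p \<in> ?S" for p
    proof -
      have "D (0, p) = 1" using jD[OF p] by (simp add: jet2_def)
      moreover have "(0, p) \<in> W0" using SU[OF p] gx(2) gt(2) \<epsilon>x \<epsilon>t by (auto simp: W0_def)
      ultimately show ?thesis using gt0 by (simp add: W_def)
    qed
    then show ?thesis by auto
  qed
  obtain \<delta> where \<delta>: "\<delta> > 0" and inW: "\<And>s p. \<bar>s\<bar> < \<delta> \<Longrightarrow> p \<in> ?S \<Longrightarrow> (s, p) \<in> W"
    using eventually_sphere_tube[OF oW W0S] by blast

  have FI: "\<forall>\<^sub>F s in nhds 0. F s = (\<integral>p. \<Phi> (s, p) \<partial>?M)"
    using ev_small[OF \<delta>] ev_small[OF \<epsilon>] evx evt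
  proof eventually_elim
    case (elim s)
    have W: "(s, p) \<in> W" if "p \<in> ?S" for p using inW[OF elim(1) that] .
    have UU: "(s, p) \<in> U" if "p \<in> ?S" for p using W[OF that] WW0 by (auto simp: W0_def)
    have tpos: "t s > 0"
    proof -
      have "axis None r \<in> ?S" using r by (simp add: norm_axis_real)
      from Wpos(2)[OF W[OF this]] show ?thesis using elim(4) by simp
    qed
    have cont: "continuous_on ?S (\<lambda>p. g (s, p))" if "Cinf_on W g" for g :: "real \<times> (real^'n option) \<Rightarrow> real"
      by (rule continuous_on_compose2[OF Cinf_on_continuous[OF that]]) (use W in \<open>auto intro!: continuous_intros\<close>)
    have dens: "area_density r (Xs s) p = D (s, p) powr (1 / 2)" if p: "p \<in> ?S" for p
    proof -
      have "area_density r (Xs s) p = sqrt (D (s, p))"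
        unfolding D_def snd_conv
        by (rule area_density_eq[OF r p Cinf_on_space_derivative[OF G UU[OF p]]]) (use GXs elim(2) in auto)
      then show ?thesis using Wpos(1)[OF W[OF p]] by (simp add: powr_half_sqrt)
    qed
    have dens1: "area_density r (\<lambda>p. p) p = 1" if p: "p \<in> ?S" for p
    proof -
      have "area_density r (\<lambda>p. p) p = sqrt (det (gram_matrix r (\<lambda>v. v) p))"
        by (rule area_density_eq[OF r p has_derivative_ident]) simp
      also have "gram_matrix r (\<lambda>v. v) p = mat 1"
        using r sphere_inner_self[OF p]
        by (simp add: gram_matrix_def vec_eq_iff mat_def inner_diff_left inner_diff_right inner_axis_axis inner_axis inner_axis' power2_eq_square field_simps)
           (simp add: axis_def)
      finally show ?thesis by simp
    qed
    have nq: "(norm (Xs s p - x s))\<^sup>2 = q (s, p)" if "p \<in> ?S" for p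
      using GXs[OF elim(2) that] elim(3) by (simp add: q_def power2_norm_eq_inner)
    have t1: "gt s powr (- 1) = 1 / t s" using tpos elim(4) by (simp add: powr_neg_one)
    have t2: "gt s powr (- 1 / 2) = sqrt (1 / t s)"
      using tpos elim(4) powr_minus_divide[of "t s" "1 / 2"] by (simp add: powr_half_sqrt real_sqrt_divide)
    have I1: "(\<integral>p. exp (- (norm (Xs s p - x s))\<^sup>2 / (2 * t s)) \<partial>area_measure r (Xs s)) =
       (\<integral>p. exp ((- 1 / 2) * (q (s, p) * gt s powr (- 1))) * D (s, p) powr (1 / 2) \<partial>?M)"
    proof -
      let ?g = "\<lambda>z. exp ((- 1 / 2) * (q z * gt (fst z) powr (- 1)))"
      have "Cinf_on W ?g" by (intro Cinf_on_exp Cinf_on_cmult Cinf_on_mult sq sP)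
      from cont[OF this] have cg: "continuous_on ?S (\<lambda>p. ?g (s, p))" .
      have ge: "exp (- (norm (Xs s p - x s))\<^sup>2 / (2 * t s)) = ?g (s, p)" if "p \<in> ?S" for p
        unfolding nq[OF that] fst_conv t1 by simp
      have "(\<integral>p. exp (- (norm (Xs s p - x s))\<^sup>2 / (2 * t s)) \<partial>area_measure r (Xs s)) = 
         (\<integral>p. D (s, p) powr (1 / 2) * exp (- (norm (Xs s p - x s))\<^sup>2 / (2 * t s)) \<partial>?M)"
      proof (rule integral_area_measure[OF _ _ dens])
        show "continuous_on ?S (\<lambda>p. D (s, p) powr (1 / 2))" by (rule cont[OF Cinf_on_powr[OF Ws(2) Wpos(1)]])
        show "continuous_on ?S (\<lambda>p. exp (- (norm (Xs s p - x s))\<^sup>2 / (2 * t s)))"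
          using cg by (rule continuous_on_eq) (use ge in auto)
      qed auto
      also have "\<dots> = (\<integral>p. exp ((- 1 / 2) * (q (s, p) * gt s powr (- 1))) * D (s, p) powr (1 / 2) \<partial>?M)"
        by (rule Bochner_Integration.integral_cong) (use ge in auto)
      finally show ?thesis .
    qed
    have I2: "(\<integral>p. ((Xs s p - x s) \<bullet> (- (1 / r) *\<^sub>R p)) * exp (- (norm (p - 0))\<^sup>2 / (2 * 1)) \<partial>area_measure r (\<lambda>p::real^'n option. p)) =
       (\<integral>p. exp (- r\<^sup>2 / 2) * v (s, p) \<partial>?M)"
    proof -
      have ge: "((Xs s p - x s) \<bullet> (- (1 / r) *\<^sub>R p)) * exp (- (norm (p - 0))\<^sup>2 / (2 * 1)) = exp (- r\<^sup>2 / 2) * v (s, p)" if "p \<in> ?S" for p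
        using GXs[OF elim(2) that] elim(3) that by (simp add: v_def)
      have "(\<integral>p. ((Xs s p - x s) \<bullet> (- (1 / r) *\<^sub>R p)) * exp (- (norm (p - 0))\<^sup>2 / (2 * 1)) \<partial>area_measure r (\<lambda>p::real^'n option. p)) =
        (\<integral>p. 1 * (((Xs s p - x s) \<bullet> (- (1 / r) *\<^sub>R p)) * exp (- (norm (p - 0))\<^sup>2 / (2 * 1))) \<partial>?M)"
      proof (rule integral_area_measure[OF _ _ dens1])
        have "continuous_on ?S (\<lambda>p. exp (- r\<^sup>2 / 2) * v (s, p))" by (rule cont[OF Cinf_on_cmult[OF sv]])
        then show "continuous_on ?S (\<lambda>p. ((Xs s p - x s) \<bullet> (- (1 / r) *\<^sub>R p)) * exp (- (norm (p - 0))\<^sup>2 / (2 * 1)))"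
          by (rule continuous_on_eq) (use ge in auto)
      qed auto
      also have "\<dots> = (\<integral>p. exp (- r\<^sup>2 / 2) * v (s, p) \<partial>?M)"
        by (rule Bochner_Integration.integral_cong) (use ge in auto)
      finally show ?thesis .
    qed
    have c1: "(4 * pi * t s) powr (- ?n / 2) = \<kappa> * gt s powr (- ?n / 2)"
      using tpos elim(4) by (simp add: \<kappa>_def powr_mult)
    have c2: "lam * (4 * pi * 1) powr (- ?n / 2) * sqrt (1 / t s) = lam * \<kappa> * gt s powr (- 1 / 2)"
      unfolding t2 \<kappa>_def by simp
    have "F s = \<kappa> * gt s powr (- ?n / 2) * (\<integral>p. exp ((- 1 / 2) * (q (s, p) * gt s powr (- 1))) * D (s, p) powr (1 / 2) \<partial>?M)
       + lam * \<kappa> * gt s powr (- 1 / 2) * (\<integral>p. exp (- r\<^sup>2 / 2) * v (s, p) \<partial>?M)"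
      unfolding F_def F_functional_def lam_def[symmetric] I1 I2 c1 c2 ..
    also have "\<dots> = (\<integral>p. \<kappa> * (gt s powr (- ?n / 2) * (exp ((- 1 / 2) * (q (s, p) * gt s powr (- 1))) * D (s, p) powr (1 / 2))) \<partial>?M)
       + (\<integral>p. lam * \<kappa> * exp (- r\<^sup>2 / 2) * (gt s powr (- 1 / 2) * v (s, p)) \<partial>?M)"
      by simp
    also have "\<dots> = (\<integral>p. \<Phi> (s, p) \<partial>?M)"
      unfolding \<Phi>_def fst_conv
      using sphere_integrable_continuous[OF r cont[OF sA]] sphere_integrable_continuous[OF r cont[OF sB]]
      by (subst Bochner_Integration.integral_add) auto
    finally show ?case .
  qed

  note main = sphere_integral_second_derivative[OF r s\<Phi> W0S FI jet]
  have i0: "(\<integral>p. K * (?n / r\<^sup>2 * (y \<bullet> p)) \<partial>?M) = 0" using sphere_first_moment[OF r, of y] by simp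
  show "(sphere_F r Xs x t has_real_derivative 0) (at 0)" using main(1) unfolding i0 F_def .

  have cf: "continuous_on ?S f" by (rule Cinf_on_cont_sphere[OF r f(2,1)])
  define Z where "Z p = G2 (0, p)" for p
  define U1 where "U1 = (\<lambda>p. (0::real, p)) -` U"
  have bl: "bounded_linear (\<lambda>p::real^'n option. (0::real, p))"
    by (intro bounded_linear_Pair bounded_linear_zero bounded_linear_ident)
  have sZ: "Cinf_on U1 Z" unfolding Z_def U1_def by (rule Cinf_on_compose_linear[OF s2 bl])
  have SU1: "?S \<subseteq> U1" using SU by (auto simp: U1_def)
  have DZ: "diff_at Z p w = diff_at G2 (0, p) (0, w)" if "p \<in> ?S" for p w
    unfolding Z_def by (rule frechet_derivative_eq[OF Cinf_on_space_derivative[OF s2 SU[OF that]]])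
  note dv = sphere_vector_divergence[OF r sZ SU1]
  let ?dZ = "\<lambda>p. (\<Sum>k\<in>UNIV. diff_at Z p (axis k 1) $ k) - diff_at Z p p \<bullet> p / r\<^sup>2"
  have cz: "continuous_on ?S Z" using continuous_on_subset[OF Cinf_on_continuous[OF sZ] SU1] .
  let ?c = "lam\<^sup>2 - 1 - ?n / r\<^sup>2" and ?e = "(r * lam + 2 + lam / r) * h"
  have ints: "integrable ?M (grad_pairing r f f)" "integrable ?M (\<lambda>p. f p * f p)" "integrable ?M f" 
    "integrable ?M (\<lambda>p. f p * (y \<bullet> p))" "integrable ?M (\<lambda>p. (y \<bullet> p) * (y \<bullet> p))" "integrable ?M (\<lambda>p. y2 \<bullet> p)"
    "integrable ?M (\<lambda>p. y \<bullet> p)" "integrable ?M ?dZ" "integrable ?M (\<lambda>p. p \<bullet> Z p)"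
    using grad_pairing_integrable[OF r f(2) f(1) f(1)] dv(1)
    by (auto intro!: sphere_integrable_continuous r continuous_intros cf cz)
  have "(\<integral>p. K * (grad_pairing r f f p / r\<^sup>2 + ?c * (f p)\<^sup>2 + (Q / r) * h * f p
        - 2 * (lam + 1 / r) * (f p * (y \<bullet> p)) + (y \<bullet> p)\<^sup>2 - y \<bullet> y + Q / 4 * h\<^sup>2
        + ?n / r\<^sup>2 * (y2 \<bullet> p) - ?e * (y \<bullet> p) + (?div p - ?n / r\<^sup>2 * ?z p)) \<partial>?M) =
     (\<integral>p. K * (grad_pairing r f f p / r\<^sup>2 + ?c * (f p * f p) + (Q / r) * h * f p
        - 2 * (lam + 1 / r) * (f p * (y \<bullet> p)) + (y \<bullet> p) * (y \<bullet> p) - y \<bullet> y + Q / 4 * h\<^sup>2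
        + ?n / r\<^sup>2 * (y2 \<bullet> p) - ?e * (y \<bullet> p) + (?dZ p - ?n / r\<^sup>2 * (p \<bullet> Z p))) \<partial>?M)"
    by (rule Bochner_Integration.integral_cong) (use DZ in \<open>auto simp: Z_def power2_eq_square\<close>)
  also have "\<dots> = K * (dirichlet r f f / r\<^sup>2 + ?c * sphere_inner r f f
          + (Q / r) * h * (\<integral>p. f p \<partial>?M) - 2 * (lam + 1 / r) * (\<integral>p. f p * (y \<bullet> p) \<partial>?M)
          + (\<integral>p. (y \<bullet> p) * (y \<bullet> p) \<partial>?M) - (y \<bullet> y) * vol + Q / 4 * h\<^sup>2 * vol
          + ?n / r\<^sup>2 * (\<integral>p. y2 \<bullet> p \<partial>?M) - ?e * (\<integral>p. y \<bullet> p \<partial>?M) + ((\<integral>p. ?dZ p \<partial>?M) - ?n / r\<^sup>2 * (\<integral>p. p \<bullet> Z p \<partial>?M)))"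
    using ints by (simp add: dirichlet_def sphere_inner_def vol_def mult.commute)
  also have "\<dots> = K * (dirichlet r f f / r\<^sup>2 + ?c * sphere_inner r f f
          + (Q / r) * h * (\<integral>p. f p \<partial>?M) - 2 * (lam + 1 / r) * (\<integral>p. f p * (y \<bullet> p) \<partial>?M)
          + (r\<^sup>2 / (?n + 1) - 1) * (y \<bullet> y) * vol + Q / 4 * h\<^sup>2 * vol)"
    unfolding dv(2) sphere_first_moment[OF r] sphere_second_moment[OF r] vol_def[symmetric] by (simp add: algebra_simps)
  also have "\<dots> = K * second_variation_form r f y h"
    unfolding second_variation_form_def Let_def lam_def[symmetric] Q_def[symmetric] vol_def[symmetric] ..
  finally show "has_second_derivative (sphere_F r Xs x t) ((4 * pi) powr (- ?n / 2) * exp (- r\<^sup>2 / 2) * second_variation_form r f y h) 0"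
    using main(2) unfolding F_def[symmetric] K_def[symmetric] by (simp only:)
qed

section \<open>A normal variation with affine initial speed\<close>

definition reflection :: "'a::real_inner \<Rightarrow> 'a \<Rightarrow> 'a" where
  "reflection u v = v - (2 * (u \<bullet> v) / (u \<bullet> u)) *\<^sub>R u"

text \<open>The inversion in the sphere with centre \<open>a\<close> and squared radius \<open>k\<close>.\<close>

definition inversion :: "'a::real_inner \<Rightarrow> real \<Rightarrow> 'a \<Rightarrow> 'a" where
  "inversion a k y = a + (k / ((y - a) \<bullet> (y - a))) *\<^sub>R (y - a)"

lemma reflection_inner: "reflection u v \<bullet> reflection u w = v \<bullet> w"
proof (cases "u = 0")
  case False
  then have "u \<bullet> u \<noteq> 0" by simp
  then show ?thesis
    by (simp add: reflection_def inner_diff_left inner_diff_right inner_commute[of v u] field_simps)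
qed (simp add: reflection_def)

lemma reflection_involutive: "reflection u (reflection u v) = v"
proof (cases "u = 0")
  case False
  then have "u \<bullet> u \<noteq> 0" by simp
  then show ?thesis
    by (simp add: reflection_def inner_diff_right scaleR_diff_left field_simps)
qed (simp add: reflection_def)

lemma reflection_scaleR: "c \<noteq> 0 \<Longrightarrow> reflection (c *\<^sub>R u) v = reflection u v"
  by (simp add: reflection_def)

lemma reflection_linear: "reflection u (c *\<^sub>R v) = c *\<^sub>R reflection u v"
  by (simp add: reflection_def algebra_simps)

lemma inversion_has_derivative:
  assumes "y \<noteq> a"
  shows "(inversion a k has_derivative (\<lambda>v. (k / ((y - a) \<bullet> (y - a))) *\<^sub>R reflection (y - a) v)) (at y)"
proof -
  let ?d = "(y - a) \<bullet> (y - a)"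
  have d: "?d \<noteq> 0" using assms by simp
  have 1: "((\<lambda>y. (y - a) \<bullet> (y - a)) has_derivative (\<lambda>v. 2 * ((y - a) \<bullet> v))) (at y)"
    by (auto intro!: derivative_eq_intros simp: inner_commute)
  have 2: "((\<lambda>y. k / ((y - a) \<bullet> (y - a))) has_derivative (\<lambda>v. - (k * (2 * ((y - a) \<bullet> v)) / (?d * ?d)))) (at y)"
    by (rule derivative_eq_intros 1 d refl)+ (use d in \<open>auto simp: field_simps\<close>)
  have "((\<lambda>y. a + (k / ((y - a) \<bullet> (y - a))) *\<^sub>R (y - a)) has_derivative
     (\<lambda>v. (k / ?d) *\<^sub>R v + (- (k * (2 * ((y - a) \<bullet> v)) / (?d * ?d))) *\<^sub>R (y - a))) (at y)"
    by (rule derivative_eq_intros 2 refl)+ auto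
  moreover have "(k / ?d) *\<^sub>R v + (- (k * (2 * ((y - a) \<bullet> v)) / (?d * ?d))) *\<^sub>R (y - a) = (k / ?d) *\<^sub>R reflection (y - a) v" for v
    using d by (simp add: reflection_def scaleR_diff_right field_simps)
  ultimately show ?thesis by (simp add: inversion_def[abs_def])
qed

lemma inversion_Cinf_on:
  assumes P: "Cinf_on U P" and ne: "\<And>q. q \<in> U \<Longrightarrow> P q \<noteq> a"
  shows "Cinf_on U (\<lambda>q. inversion a k (P q))"
  unfolding inversion_def divide_inverse
  by (intro Cinf_on_add Cinf_on_const Cinf_on_open[OF P] Cinf_on_scaleR Cinf_on_mult Cinf_on_inverse Cinf_on_inner Cinf_on_diff P)
     (use ne in auto)

lemma Cinf_on_open_neq:
  assumes P: "Cinf_on U (P :: 'a::real_normed_vector \<Rightarrow> 'b::real_inner)" shows "open {q \<in> U. P q \<noteq> a}"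
proof -
  have "Cinf_on U (\<lambda>q. (P q - a) \<bullet> (P q - a))" by (intro Cinf_on_inner Cinf_on_diff P Cinf_on_const Cinf_on_open[OF P])
  from Cinf_on_open_positive[OF this] show ?thesis by simp
qed

text \<open>The inversion maps the spheres around the origin to an Apollonian pencil and the lines through the origin to the circles
  orthogonal to it. A point is moved along its circle so that its inverse moves radially. As the
  inversion is conformal, the velocity stays normal to the moving sphere. Everything is a rational function of \<open>s\<close> and \<open>p\<close>.\<close>

definition pencil :: "'a::real_inner \<Rightarrow> real \<Rightarrow> real \<Rightarrow> 'a \<Rightarrow> 'a" where
  "pencil a k s p = inversion a k ((1 + s) *\<^sub>R inversion a k p)"

definition pencil_radius :: "'a::real_inner \<Rightarrow> real \<Rightarrow> real \<Rightarrow> 'a \<Rightarrow> 'a" where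
  "pencil_radius a k s p = (1 + s) *\<^sub>R inversion a k p - a"

definition pencil_normal :: "real \<Rightarrow> 'a::real_inner \<Rightarrow> real \<Rightarrow> real \<Rightarrow> 'a \<Rightarrow> 'a" where
  "pencil_normal r a k s p = (- 1 / r) *\<^sub>R reflection (pencil_radius a k s p) (inversion a k p)"

definition pencil_speed :: "real \<Rightarrow> 'a::real_inner \<Rightarrow> real \<Rightarrow> real \<Rightarrow> 'a \<Rightarrow> real" where
  "pencil_speed r a k s p = - k * r / (pencil_radius a k s p \<bullet> pencil_radius a k s p)"

context
  fixes r k :: real and a :: "real^'n::finite option"
  assumes r: "r > 0" and a: "a \<bullet> a = 4 * r\<^sup>2" and k: "k = 3 * r\<^sup>2"
begin

lemma k_pos: "k > 0" using r k by simp

lemma sphere_neq_a: "p \<in> sphere 0 r \<Longrightarrow> p \<noteq> a"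
  using a sphere_inner_self[of p r] r by auto

text \<open>The squared radius \<open>k = |a|\<^sup>2 - r\<^sup>2\<close> is the power of the point \<open>a\<close>, so the inversion maps the sphere to itself:
  \<open>2 \<langle>p - a, p\<rangle> = |p - a|\<^sup>2 - k\<close> there.\<close>

lemma inversion_sphere_reflection:
  assumes p: "p \<in> sphere 0 r" shows "inversion a k p = reflection (p - a) p"
proof -
  let ?d = "(p - a) \<bullet> (p - a)"
  have d: "?d \<noteq> 0" using sphere_neq_a[OF p] by simp
  have "2 * ((p - a) \<bullet> p) = ?d - k"
    using sphere_inner_self[OF p] a k by (simp add: inner_diff_left inner_diff_right inner_commute)
  then have "reflection (p - a) p = p - ((?d - k) / ?d) *\<^sub>R (p - a)" by (simp add: reflection_def)
  also have "\<dots> = inversion a k p"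
    using d by (simp add: inversion_def diff_divide_distrib scaleR_diff_left)
  finally show ?thesis by simp
qed

lemma inversion_sphere:
  assumes p: "p \<in> sphere 0 r" shows "inversion a k p \<in> sphere 0 r"
  using reflection_inner[of "p - a" p p] sphere_inner_self[OF p] r inversion_sphere_reflection[OF p]
  by (simp add: norm_eq_sqrt_inner)

lemma pencil_radius_nonzero:
  assumes p: "p \<in> sphere 0 r" and s: "\<bar>s\<bar> < 1/2"
  shows "pencil_radius a k s p \<noteq> 0" "(1 + s) *\<^sub>R inversion a k p \<noteq> a"
proof -
  show *: "(1 + s) *\<^sub>R inversion a k p \<noteq> a"
  proof
    assume "(1 + s) *\<^sub>R inversion a k p = a"
    then have "(1 + s)\<^sup>2 * r\<^sup>2 = 4 * r\<^sup>2"
      using sphere_inner_self[OF inversion_sphere[OF p]] a by (metis (no_types, lifting) inner_scaleR_left inner_scaleR_right mult.assoc power2_eq_square)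
    then have "(1 + s)\<^sup>2 = 2\<^sup>2" using r by simp
    then have "\<bar>1 + s\<bar> = 2" using abs_square_eq_1 by (metis abs_numeral power2_eq_iff abs_minus_cancel)
    then show False using s by linarith
  qed
  then show "pencil_radius a k s p \<noteq> 0" by (simp add: pencil_radius_def)
qed

text \<open>At \<open>s = 0\<close> the vectors from \<open>a\<close> to \<open>p\<close> and to its inverse are parallel, so the two reflections agree and undo each
  other. The speed is proportional to \<open>|p - a|\<^sup>2\<close>, which is affine on the sphere.\<close>

lemma pencil_zero:
  assumes p: "p \<in> sphere 0 r"
  shows "pencil_radius a k 0 p = (k / ((p - a) \<bullet> (p - a))) *\<^sub>R (p - a)" "pencil a k 0 p = p"
    "pencil_normal r a k 0 p = - (1 / r) *\<^sub>R p" "pencil_speed r a k 0 p = - (r / k) * (5 * r\<^sup>2 - 2 * (a \<bullet> p))"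
proof -
  let ?d = "(p - a) \<bullet> (p - a)"
  have d: "?d \<noteq> 0" using sphere_neq_a[OF p] by simp
  have d2: "?d = 5 * r\<^sup>2 - 2 * (a \<bullet> p)"
    using sphere_inner_self[OF p] a by (simp add: inner_diff_left inner_diff_right inner_commute)
  show 1: "pencil_radius a k 0 p = (k / ?d) *\<^sub>R (p - a)" by (simp add: pencil_radius_def inversion_def)
  have 2: "pencil_radius a k 0 p \<bullet> pencil_radius a k 0 p = k * k / ?d" unfolding 1 using d by simp
  have "pencil a k 0 p = a + (k / (pencil_radius a k 0 p \<bullet> pencil_radius a k 0 p)) *\<^sub>R pencil_radius a k 0 p"
    by (simp add: pencil_def pencil_radius_def inversion_def[of a k "inversion a k p"])
  also have "\<dots> = p" unfolding 2 unfolding 1 using d k_pos by simp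
  finally show "pencil a k 0 p = p" .
  show "pencil_normal r a k 0 p = - (1 / r) *\<^sub>R p"
    unfolding pencil_normal_def 1 inversion_sphere_reflection[OF p]
    using d k_pos by (simp add: reflection_scaleR reflection_involutive)
  show "pencil_speed r a k 0 p = - (r / k) * (5 * r\<^sup>2 - 2 * (a \<bullet> p))"
    unfolding pencil_speed_def 2 d2 using k_pos by (simp add: field_simps)
qed

lemma pencil_velocity:
  assumes p: "p \<in> sphere 0 r" and s: "\<bar>s\<bar> < 1/2"
  shows "((\<lambda>s. pencil a k s p) has_vector_derivative pencil_speed r a k s p *\<^sub>R pencil_normal r a k s p) (at s)"
proof -
  let ?p = "inversion a k p" and ?u = "pencil_radius a k s p"
  have 1: "((\<lambda>s. (1 + s) *\<^sub>R ?p) has_derivative (\<lambda>h. h *\<^sub>R ?p)) (at s)"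
    by (auto intro!: derivative_eq_intros)
  have "((\<lambda>s. pencil a k s p) has_derivative (\<lambda>h. (k / (?u \<bullet> ?u)) *\<^sub>R reflection ?u (h *\<^sub>R ?p))) (at s)"
    unfolding pencil_def
    using has_derivative_compose[OF 1 inversion_has_derivative[OF pencil_radius_nonzero(2)[OF p s]]]
    by (simp add: pencil_radius_def)
  then show ?thesis
    using r by (simp add: has_vector_derivative_def pencil_speed_def pencil_normal_def reflection_linear mult.commute)
qed

lemma pencil_Cinf_on:
  fixes \<sigma> :: "'b::real_normed_vector \<Rightarrow> real" and P :: "'b \<Rightarrow> real^'n option"
  assumes \<sigma>: "Cinf_on UNIV \<sigma>" and P: "Cinf_on UNIV P" and D: "\<And>q. q \<in> D \<Longrightarrow> \<bar>\<sigma> q\<bar> < 1/2 \<and> P q \<in> sphere 0 r"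
  shows "smooth_on D (\<lambda>q. pencil a k (\<sigma> q) (P q))" "smooth_on D (\<lambda>q. pencil_normal r a k (\<sigma> q) (P q))"
    "smooth_on D (\<lambda>q. pencil_speed r a k (\<sigma> q) (P q))"
proof -
  define U1 where "U1 = {q \<in> UNIV. P q \<noteq> a}"
  have o1: "open U1" unfolding U1_def by (rule Cinf_on_open_neq[OF P])
  have s1: "Cinf_on U1 (\<lambda>q. inversion a k (P q))"
    by (rule inversion_Cinf_on[OF Cinf_on_subset[OF P o1]]) (auto simp: U1_def)
  have s2: "Cinf_on U1 (\<lambda>q. (1 + \<sigma> q) *\<^sub>R inversion a k (P q))"
    by (intro Cinf_on_scaleR Cinf_on_add Cinf_on_const o1 s1 Cinf_on_subset[OF \<sigma> o1]) auto
  define U where "U = {q \<in> U1. (1 + \<sigma> q) *\<^sub>R inversion a k (P q) \<noteq> a}"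
  have oU: "open U" unfolding U_def by (rule Cinf_on_open_neq[OF s2])
  have UU1: "U \<subseteq> U1" by (auto simp: U_def)
  have DU: "D \<subseteq> U" using D sphere_neq_a pencil_radius_nonzero(2) by (auto simp: U_def U1_def)
  have "Cinf_on U (\<lambda>q. pencil a k (\<sigma> q) (P q))"
    unfolding pencil_def by (rule inversion_Cinf_on[OF Cinf_on_subset[OF s2 oU UU1]]) (auto simp: U_def)
  then show "smooth_on D (\<lambda>q. pencil a k (\<sigma> q) (P q))" using DU by (rule smooth_on_I) simp
  have su: "Cinf_on U (\<lambda>q. pencil_radius a k (\<sigma> q) (P q))"
    unfolding pencil_radius_def by (intro Cinf_on_diff Cinf_on_const oU Cinf_on_subset[OF s2 oU UU1])
  have si: "Cinf_on U (\<lambda>q. inverse (pencil_radius a k (\<sigma> q) (P q) \<bullet> pencil_radius a k (\<sigma> q) (P q)))"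
    by (intro Cinf_on_inverse Cinf_on_inner su) (auto simp: U_def pencil_radius_def)
  have "Cinf_on U (\<lambda>q. pencil_normal r a k (\<sigma> q) (P q))"
    unfolding pencil_normal_def reflection_def divide_inverse
    by (intro Cinf_on_scaleR Cinf_on_const oU Cinf_on_diff Cinf_on_mult Cinf_on_inner su si Cinf_on_subset[OF s1 oU UU1])
  then show "smooth_on D (\<lambda>q. pencil_normal r a k (\<sigma> q) (P q))" using DU by (rule smooth_on_I) simp
  have "Cinf_on U (\<lambda>q. pencil_speed r a k (\<sigma> q) (P q))"
    unfolding pencil_speed_def divide_inverse by (intro Cinf_on_mult Cinf_on_const oU si)
  then show "smooth_on D (\<lambda>q. pencil_speed r a k (\<sigma> q) (P q))" using DU by (rule smooth_on_I) simp
qed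

text \<open>The differential is a nonzero multiple of a product of two reflections. The normal is the image of the radial direction under
  the same product, hence orthogonal to the images of tangent vectors.\<close>

lemma pencil_immersed:
  assumes s: "\<bar>s\<bar> < 1/2"
  shows "immersed_hypersurface r (pencil a k s) (pencil_normal r a k s)"
  unfolding immersed_hypersurface_def
proof (intro conjI ballI allI impI)
  have c: "Cinf_on UNIV (\<lambda>p::real^'n option. s)" "Cinf_on UNIV (\<lambda>p::real^'n option. p)"
    by (simp_all add: Cinf_on_const Cinf_on_linear bounded_linear_ident)
  show "smooth_on (sphere 0 r) (pencil a k s)" "smooth_on (sphere 0 r) (pencil_normal r a k s)"
    using pencil_Cinf_on(1,2)[OF c, of "sphere 0 r"] s by auto
  fix p :: "real^'n option" assume p: "p \<in> sphere 0 r"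
  let ?p = "inversion a k p" and ?u = "pencil_radius a k s p"
  define c where "c = (k / (?u \<bullet> ?u)) * ((1 + s) * (k / ((p - a) \<bullet> (p - a))))"
  have c0: "c \<noteq> 0" using k_pos s pencil_radius_nonzero(1)[OF p s] sphere_neq_a[OF p] by (auto simp: c_def)
  define A where "A v = c *\<^sub>R reflection ?u (reflection (p - a) v)" for v
  have A: "(pencil a k s has_derivative A) (at p)"
  proof -
    have 1: "((\<lambda>p. (1 + s) *\<^sub>R inversion a k p) has_derivative (\<lambda>v. (1 + s) *\<^sub>R ((k / ((p - a) \<bullet> (p - a))) *\<^sub>R reflection (p - a) v))) (at p)"
      by (intro has_derivative_scaleR_right inversion_has_derivative sphere_neq_a p)
    show ?thesis
      unfolding pencil_def[abs_def] A_def c_def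
      using has_derivative_compose[OF 1 inversion_has_derivative[OF pencil_radius_nonzero(2)[OF p s]]]
      by (simp add: pencil_radius_def reflection_linear mult.assoc)
  qed
  have DA: "sphere_D r (pencil a k s) p v = A v" if "v \<bullet> p = 0" for v
    by (rule sphere_D_eq[OF r p that A]) simp
  show "inj_on (sphere_D r (pencil a k s) p) {v. v \<bullet> p = 0}"
  proof (rule inj_onI)
    fix v w assume v: "v \<in> {v. v \<bullet> p = 0}" "w \<in> {v. v \<bullet> p = 0}" and eq: "sphere_D r (pencil a k s) p v = sphere_D r (pencil a k s) p w"
    then have "A v = A w" using DA by simp
    then have "reflection ?u (reflection (p - a) v) = reflection ?u (reflection (p - a) w)" using c0 by (simp add: A_def)
    then show "v = w" by (metis reflection_involutive)
  qed
  have "reflection ?u ?p \<bullet> reflection ?u ?p = r\<^sup>2"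
    using sphere_inner_self[OF inversion_sphere[OF p]] by (simp add: reflection_inner)
  then show "norm (pencil_normal r a k s p) = 1" using r by (simp add: pencil_normal_def norm_eq_sqrt_inner power2_eq_square)
  fix v assume v: "v \<bullet> p = 0"
  have "reflection ?u ?p \<bullet> reflection ?u (reflection (p - a) v) = 0"
    unfolding reflection_inner inversion_sphere_reflection[OF p] using v by (simp add: inner_commute)
  then show "pencil_normal r a k s p \<bullet> sphere_D r (pencil a k s) p v = 0"
    unfolding DA[OF v] by (simp add: A_def pencil_normal_def)
qed

lemma pencil_normal_variation:
  "normal_variation r (\<lambda>p. p) (\<lambda>p. - (1 / r) *\<^sub>R p) (pencil a k)"
  unfolding normal_variation_def
proof (intro exI conjI ballI)
  let ?D = "{-(1/2)<..<1/2::real} \<times> (sphere 0 r :: (real^'n option) set)"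
  have c: "Cinf_on UNIV (fst :: real \<times> (real^'n option) \<Rightarrow> real)" "Cinf_on UNIV (snd :: real \<times> (real^'n option) \<Rightarrow> real^'n option)"
    by (simp_all add: Cinf_on_linear bounded_linear_fst bounded_linear_snd)
  have D: "\<bar>fst q\<bar> < 1/2 \<and> snd q \<in> sphere 0 r" if "q \<in> ?D" for q using that by (auto simp: abs_less_iff)
  show "smooth_on ?D (\<lambda>(s, p). pencil a k s p)" using pencil_Cinf_on(1)[OF c D] by (simp add: case_prod_beta')
  show "smooth_on ?D (\<lambda>(s, p). pencil_normal r a k s p)" using pencil_Cinf_on(2)[OF c D] by (simp add: case_prod_beta')
  show "smooth_on ?D (\<lambda>(s, p). pencil_speed r a k s p)" using pencil_Cinf_on(3)[OF c D] by (simp add: case_prod_beta')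
  show "((\<lambda>s. pencil a k s p) has_vector_derivative pencil_speed r a k s p *\<^sub>R pencil_normal r a k s p) (at s)"
    if "s \<in> {-(1/2)<..<1/2}" "p \<in> sphere 0 r" for s p
    using that by (intro pencil_velocity) (auto simp: abs_less_iff)
  show "immersed_hypersurface r (pencil a k s) (pencil_normal r a k s)" if "s \<in> {-(1/2)<..<1/2}" for s
    using that by (intro pencil_immersed) (auto simp: abs_less_iff)
qed (simp_all add: pencil_zero)

end

section \<open>Stability and instability of the sphere\<close>

text \<open>At \<open>s = 0\<close> the normal field of the variation is the given normal of the sphere.\<close>

lemma normal_variation_data:
  fixes Xs :: "real \<Rightarrow> real^'n::finite option \<Rightarrow> real^'n option"
  assumes "normal_variation r (\<lambda>p. p) (\<lambda>p. - (1 / r) *\<^sub>R p) Xs"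
  shows "\<exists>V f. initial_normal_speed r Xs V f"
proof -
  obtain \<epsilon> f Ns where \<epsilon>: "\<epsilon> > 0" and X: "smooth_on ({-\<epsilon><..<\<epsilon>} \<times> sphere 0 r) (\<lambda>(s, p). Xs s p)"
    and f: "smooth_on ({-\<epsilon><..<\<epsilon>} \<times> sphere 0 r) (\<lambda>(s, p). f s p :: real)"
    and 0: "\<forall>p\<in>sphere 0 r. Xs 0 p = p \<and> Ns 0 p = - (1 / r) *\<^sub>R p"
    and D: "\<forall>s\<in>{-\<epsilon><..<\<epsilon>}. \<forall>p\<in>sphere 0 r. ((\<lambda>s. Xs s p) has_vector_derivative f s p *\<^sub>R Ns s p) (at s)"
    using assms unfolding normal_variation_def by blast
  obtain U g where g: "Cinf_on U g" and U: "{-\<epsilon><..<\<epsilon>} \<times> sphere 0 r \<subseteq> U" 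
    and gf: "\<And>q. q \<in> {-\<epsilon><..<\<epsilon>} \<times> sphere 0 r \<Longrightarrow> g q = (case q of (s, p) \<Rightarrow> f s p)"
    using smooth_on_E[OF f] by metis
  have bl: "bounded_linear (\<lambda>p::real^'n option. (0::real, p))"
    by (intro bounded_linear_Pair bounded_linear_zero bounded_linear_ident)
  have "initial_normal_speed r Xs (Pair 0 -` U) (\<lambda>p. g (0, p))"
    unfolding initial_normal_speed_def
  proof (intro conjI ballI)
    show "\<exists>\<epsilon>>0. smooth_on ({-\<epsilon><..<\<epsilon>} \<times> sphere 0 r) (\<lambda>(s, p). Xs s p)" using \<epsilon> X by blast
    show "Cinf_on (Pair 0 -` U) (\<lambda>p. g (0, p))" by (rule Cinf_on_compose_linear[OF g bl])
    show "sphere 0 r \<subseteq> Pair 0 -` U" using \<epsilon> by (auto intro!: subsetD[OF U])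
    fix p :: "real^'n option" assume p: "p \<in> sphere 0 r"
    show "Xs 0 p = p" using 0 p by blast
    have "g (0, p) = f 0 p" using gf[of "(0, p)"] p \<epsilon> by simp
    moreover have "Ns 0 p = - (1 / r) *\<^sub>R p" using 0 p by blast
    moreover have "((\<lambda>s. Xs s p) has_vector_derivative f 0 p *\<^sub>R Ns 0 p) (at 0)" using D p \<epsilon> by simp
    ultimately show "((\<lambda>s. Xs s p) has_vector_derivative g (0, p) *\<^sub>R (- (1 / r) *\<^sub>R p)) (at 0)" by simp
  qed
  then show ?thesis by blast
qed

lemma smooth_on_interval_derivative:
  fixes x :: "real \<Rightarrow> 'a::real_normed_vector"
  assumes "\<epsilon> > 0" "smooth_on {-\<epsilon><..<\<epsilon>} x"
  obtains y where "(x has_vector_derivative y) (at 0)"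
proof -
  obtain U g where g: "Cinf_on U g" "{-\<epsilon><..<\<epsilon>} \<subseteq> U" "\<And>s. s \<in> {-\<epsilon><..<\<epsilon>} \<Longrightarrow> g s = x s"
    using smooth_on_E[OF assms(2)] by metis
  have "0 \<in> U" using g(2) assms(1) by (auto intro!: subsetD[OF g(2)])
  then obtain y where "(g has_vector_derivative y) (at 0)"
    using jet2_has_derivative[OF jet2_Cinf_on_real[OF g(1)]] by blast
  then have "(x has_vector_derivative y) (at 0)"
    by (rule has_vector_derivative_transform_within_open[of _ _ _ "{-\<epsilon><..<\<epsilon>}"]) (use assms g in auto)
  then show ?thesis using that by blast
qed

lemma variation_derivatives:
  assumes "point_variation x0 x" "scale_variation t0 t"
  obtains y h where "(x has_vector_derivative y) (at 0)" "(t has_real_derivative h) (at 0)"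
proof -
  obtain \<epsilon>1 where 1: "\<epsilon>1 > 0" "smooth_on {-\<epsilon>1<..<\<epsilon>1} x" using assms(1) unfolding point_variation_def by blast
  obtain \<epsilon>2 where 2: "\<epsilon>2 > 0" "smooth_on {-\<epsilon>2<..<\<epsilon>2} t" using assms(2) unfolding scale_variation_def by blast
  show ?thesis
    using smooth_on_interval_derivative[OF 1] smooth_on_interval_derivative[OF 2] that
    unfolding has_real_derivative_iff_has_vector_derivative by metis
qed

lemma sphere_immersed:
  assumes r: "r > 0"
  shows "immersed_hypersurface r (\<lambda>p::real^'n::finite option. p) (\<lambda>p. - (1 / r) *\<^sub>R p)"
  unfolding immersed_hypersurface_def
proof (intro conjI ballI allI impI)
  have 1: "Cinf_on UNIV (\<lambda>p::real^'n option. p)" by (simp add: Cinf_on_linear bounded_linear_ident)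
  show "smooth_on (sphere 0 r) (\<lambda>p::real^'n option. p)" by (rule smooth_on_I[OF 1]) auto
  show "smooth_on (sphere 0 r) (\<lambda>p::real^'n option. - (1 / r) *\<^sub>R p)"
    by (rule smooth_on_I[OF Cinf_on_scaleR[OF Cinf_on_const[OF open_UNIV, of "- (1 / r)"] 1]]) auto
  fix p :: "real^'n option" assume p: "p \<in> sphere 0 r"
  have D: "sphere_D r (\<lambda>p. p) p v = v" if "v \<bullet> p = 0" for v
    by (rule sphere_D_eq[OF r p that has_derivative_ident]) simp
  show "inj_on (sphere_D r (\<lambda>p. p) p) {v. v \<bullet> p = 0}" using D by (auto intro: inj_onI)
  show "norm (- (1 / r) *\<^sub>R p) = 1" using p r by simp
  show "- (1 / r) *\<^sub>R p \<bullet> sphere_D r (\<lambda>p. p) p v = 0" if "v \<bullet> p = 0" for v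
    using D[OF that] that by (simp add: inner_commute)
qed

lemma sphere_F_critical:
  assumes r: "r > 0"
  shows "F_critical r (\<lambda>p::real^'n::finite option. p) (\<lambda>p. - (1 / r) *\<^sub>R p) 0 1 (real CARD('n) / r - r)"
  unfolding F_critical_def
proof (intro conjI allI impI sphere_immersed r)
  fix Xs :: "real \<Rightarrow> real^'n option \<Rightarrow> real^'n option" and x :: "real \<Rightarrow> real^'n option" and t
  assume a: "normal_variation r (\<lambda>p. p) (\<lambda>p. - (1 / r) *\<^sub>R p) Xs \<and> point_variation 0 x \<and> scale_variation 1 t"
  then obtain V f where v: "initial_normal_speed r Xs V f" using normal_variation_data by blast
  obtain y h where d: "(x has_vector_derivative y) (at 0)" "(t has_real_derivative h) (at 0)"
    using variation_derivatives a by blast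
  show "(sphere_F r Xs x t has_real_derivative 0) (at 0)"
    using second_variation(1)[OF r v _ d(1) _ d(2)] a by blast
qed

lemma linear_point_variation:
  "point_variation 0 (\<lambda>s. s *\<^sub>R y)" "((\<lambda>s. s *\<^sub>R y) has_vector_derivative y) (at 0)"
proof -
  have "Cinf_on UNIV (\<lambda>s. s *\<^sub>R y)" by (intro Cinf_on_linear bounded_linear_scaleR_left) auto
  then have "smooth_on {-1<..<1} (\<lambda>s. s *\<^sub>R y)" by (rule smooth_on_I) auto
  then show "point_variation 0 (\<lambda>s. s *\<^sub>R y)" unfolding point_variation_def by (auto intro!: exI[of _ 1])
  show "((\<lambda>s. s *\<^sub>R y) has_vector_derivative y) (at 0)"
    by (auto intro!: derivative_eq_intros simp: has_vector_derivative_def)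
qed

lemma affine_scale_variation:
  "scale_variation 1 (\<lambda>s. 1 + h * s)" "((\<lambda>s. 1 + h * s) has_real_derivative h) (at 0)"
proof -
  have "Cinf_on UNIV (\<lambda>s::real. 1 + h * s)" by (intro Cinf_on_add Cinf_on_const Cinf_on_linear bounded_linear_mult_right) auto
  then have 1: "smooth_on {-(1 / (\<bar>h\<bar> + 1))<..<1 / (\<bar>h\<bar> + 1)} (\<lambda>s. 1 + h * s)" by (rule smooth_on_I) auto
  have "1 + h * s > 0" if "s \<in> {-(1 / (\<bar>h\<bar> + 1))<..<1 / (\<bar>h\<bar> + 1)}" for s
  proof -
    have "\<bar>s\<bar> < 1 / (\<bar>h\<bar> + 1)" using that by (simp add: abs_less_iff)
    then have "\<bar>s\<bar> * (\<bar>h\<bar> + 1) < 1" by (simp add: pos_less_divide_eq)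
    then have "\<bar>h * s\<bar> < 1" by (simp add: abs_mult algebra_simps)
    then show ?thesis by linarith
  qed
  with 1 show "scale_variation 1 (\<lambda>s. 1 + h * s)"
    unfolding scale_variation_def by (auto intro!: exI[of _ "1 / (\<bar>h\<bar> + 1)"])
  show "((\<lambda>s. 1 + h * s) has_real_derivative h) (at 0)" by (auto intro!: derivative_eq_intros)
qed

text \<open>The coefficients are the moments of \<open>f\<close>, normalised by the first and second moments of the sphere.\<close>

lemma affine_part:
  fixes f :: "real^'n::finite option \<Rightarrow> real"
  assumes r: "r > 0" and f: "Cinf_on V f" and V: "sphere 0 r \<subseteq> V"
  defines "vol \<equiv> measure (sphere_measure r :: (real^'n option) measure) (sphere 0 r)" and "n \<equiv> real CARD('n)"
  obtains m z g where "Cinf_on V g" "f = (\<lambda>p. g p + (m + z \<bullet> p))"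
    "(\<integral>p. g p \<partial>sphere_measure r) = 0" "\<And>a. (\<integral>p. g p * (a \<bullet> p) \<partial>sphere_measure r) = 0"
proof -
  let ?M = "sphere_measure r :: (real^'n option) measure"
  interpret finite_measure ?M by (rule sphere_measure_finite_pos[OF r])
  have vol: "vol > 0" unfolding vol_def by (rule sphere_measure_finite_pos(2)[OF r])
  have n: "n + 1 > 0" by (simp add: n_def)
  note cf = Cinf_on_cont_sphere[OF r V f]
  define m where "m = (\<integral>p. f p \<partial>?M) / vol"
  define q where "q = r\<^sup>2 * vol / (n + 1)"
  have q: "q \<noteq> 0" using r vol n by (simp add: q_def)
  define z :: "real^'n option" where "z = (\<chi> k. (\<integral>p. f p * p $ k \<partial>?M) / q)"
  define g where "g p = f p - (m + z \<bullet> p)" for p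
  have int: "integrable ?M f" "integrable ?M (\<lambda>p. z \<bullet> p)" "integrable ?M (\<lambda>p. a \<bullet> p)" "integrable ?M (\<lambda>p. f p * (a \<bullet> p))" 
    "integrable ?M (\<lambda>p. (z \<bullet> p) * (a \<bullet> p))" "integrable ?M (\<lambda>p. a $ k * (f p * p $ k))" for a k
    by (intro sphere_integrable_continuous r continuous_intros cf)+
  have fa: "(\<integral>p. f p * (a \<bullet> p) \<partial>?M) = q * (a \<bullet> z)" for a
  proof -
    have "(\<integral>p. f p * (a \<bullet> p) \<partial>?M) = (\<integral>p. (\<Sum>k\<in>UNIV. a $ k * (f p * p $ k)) \<partial>?M)"
      by (simp add: inner_vec_def sum_distrib_left mult.left_commute)
    also have "\<dots> = (\<Sum>k\<in>UNIV. a $ k * (\<integral>p. f p * p $ k \<partial>?M))"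
      using int(6) by (subst Bochner_Integration.integral_sum) auto
    also have "\<dots> = (\<Sum>k\<in>UNIV. q * (a $ k * z $ k))"
      using q by (intro sum.cong refl) (simp add: z_def)
    finally show ?thesis by (simp add: inner_vec_def sum_distrib_left)
  qed
  show ?thesis
  proof (rule that[of g m z])
    show "Cinf_on V g" unfolding g_def
      by (intro Cinf_on_diff f Cinf_on_add Cinf_on_const Cinf_on_open[OF f] Cinf_on_linear bounded_linear_inner_right)
    show "f = (\<lambda>p. g p + (m + z \<bullet> p))" by (simp add: g_def fun_eq_iff)
    have "(\<integral>p. g p \<partial>?M) = (\<integral>p. f p \<partial>?M) - (m * vol + (\<integral>p. z \<bullet> p \<partial>?M))"
      unfolding g_def using int by (simp add: vol_def mult.commute)
    then show "(\<integral>p. g p \<partial>?M) = 0" using vol sphere_first_moment[OF r] by (simp add: m_def)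
    fix a :: "real^'n option"
    have "(\<integral>p. g p * (a \<bullet> p) \<partial>?M) = (\<integral>p. f p * (a \<bullet> p) - (m * (a \<bullet> p) + (z \<bullet> p) * (a \<bullet> p)) \<partial>?M)"
      by (simp add: g_def algebra_simps)
    also have "\<dots> = (\<integral>p. f p * (a \<bullet> p) \<partial>?M) - (m * (\<integral>p. a \<bullet> p \<partial>?M) + (\<integral>p. (z \<bullet> p) * (a \<bullet> p) \<partial>?M))"
      using int by simp
    also have "\<dots> = 0"
      unfolding fa sphere_first_moment[OF r] sphere_second_moment[OF r] q_def vol_def n_def by (simp add: inner_commute)
    finally show "(\<integral>p. g p * (a \<bullet> p) \<partial>?M) = 0" .
  qed
qed

text \<open>Constants, linear functions and \<open>g\<close> are orthogonal for both the inner product and the Dirichlet form, linear functions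
  being eigenfunctions for the eigenvalue \<open>n\<close>. The two remaining quadratic forms, in \<open>m\<close>, \<open>h\<close> and in \<open>z\<close>, \<open>y\<close>, are
  written with completed squares.\<close>

lemma second_variation_form_decomposition:
  fixes g :: "real^'n::finite option \<Rightarrow> real" and m :: real and z :: "real^'n option"
  assumes r: "r > 0" and g: "Cinf_on V g" and V: "sphere 0 r \<subseteq> V"
    and g0: "(\<integral>p. g p \<partial>sphere_measure r) = 0" and g1: "\<And>a. (\<integral>p. g p * (a \<bullet> p) \<partial>sphere_measure r) = 0"
  defines "vol \<equiv> measure (sphere_measure r :: (real^'n option) measure) (sphere 0 r)" and "n \<equiv> real CARD('n)"
    and "f \<equiv> \<lambda>p. g p + (m + z \<bullet> p)"
  shows "second_variation_form r f y h = (dirichlet r g g + ((n - r\<^sup>2)\<^sup>2 - r\<^sup>2 - n) * sphere_inner r g g) / r\<^sup>2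
     + vol * (((n - r\<^sup>2)\<^sup>2 - r\<^sup>2 - n) / r\<^sup>2 * (m + h * r / 2)\<^sup>2 - (z \<bullet> z) * n * (r\<^sup>2 - n) / (n + 1)
        - (n + 1 - r\<^sup>2) / (n + 1) * ((y + r *\<^sub>R z) \<bullet> (y + r *\<^sub>R z)))"
proof -
  let ?M = "sphere_measure r :: (real^'n option) measure"
  interpret finite_measure ?M by (rule sphere_measure_finite_pos[OF r])
  have n: "n > 0" by (simp add: n_def)
  note cg = Cinf_on_cont_sphere[OF r V g]
  note o = Cinf_on_open[OF g]
  let ?l = "\<lambda>p. m * 1 + 1 * (z \<bullet> p)"
  let ?A = "r\<^sup>2 / (n + 1) * vol"
  have sl: "Cinf_on V (\<lambda>p. z \<bullet> p)" and s1: "Cinf_on V (\<lambda>p. 1::real)" 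
    by (intro Cinf_on_linear o bounded_linear_inner_right Cinf_on_const)+
  have s2: "Cinf_on V ?l" by (rule Cinf_on_lin[OF s1 sl])
  have fl: "f = (\<lambda>p. 1 * g p + 1 * ?l p)" by (simp add: f_def)
  have sf: "Cinf_on V f" unfolding fl by (rule Cinf_on_lin[OF g s2])
  have D1: "dirichlet r k (\<lambda>p. 1) = 0" for k :: "real^'n option \<Rightarrow> real" 
    by (simp add: dirichlet_def grad_pairing_def)
  have Dz: "dirichlet r k (\<lambda>p. z \<bullet> p) = n * sphere_inner r k (\<lambda>p. z \<bullet> p)" if "Cinf_on V k" for k
    using dirichlet_ridge[OF r V that, of z 1] by (simp add: n_def)
  have gz: "sphere_inner r g (\<lambda>p. z \<bullet> p) = 0" and gc: "sphere_inner r g (\<lambda>p. 1) = 0"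
    using g1[of z] g0 by (simp_all add: sphere_inner_def)
  have zz: "sphere_inner r (\<lambda>p. z \<bullet> p) (\<lambda>p. a \<bullet> p) = ?A * (z \<bullet> a)" for a
    unfolding sphere_inner_def sphere_second_moment[OF r] by (simp add: vol_def n_def)
  have z1: "sphere_inner r (\<lambda>p. z \<bullet> p) (\<lambda>p. 1) = 0" and oo: "sphere_inner r (\<lambda>p. 1) (\<lambda>p::real^'n option. 1) = vol"
    using sphere_first_moment[OF r, of z] by (simp_all add: sphere_inner_def vol_def)
  have gl: "sphere_inner r g ?l = 0" unfolding sphere_inner_lin[OF r V g s1 sl] by (simp add: gz gc)
  have ll: "sphere_inner r ?l ?l = m\<^sup>2 * vol + ?A * (z \<bullet> z)"
    unfolding sphere_inner_lin[OF r V s2 s1 sl] sphere_inner_commute[of r ?l "\<lambda>p. 1"] sphere_inner_commute[of r ?l "\<lambda>p. z \<bullet> p"]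
      sphere_inner_lin[OF r V s1 s1 sl] sphere_inner_lin[OF r V sl s1 sl] sphere_inner_commute[of r "\<lambda>p. 1" "\<lambda>p. z \<bullet> p"]
    by (simp add: z1 oo zz power2_eq_square)
  have ff: "sphere_inner r f f = sphere_inner r g g + (m\<^sup>2 * vol + ?A * (z \<bullet> z))"
  proof -
    have "sphere_inner r f f = sphere_inner r f g + sphere_inner r f ?l"
      using sphere_inner_lin[OF r V sf g s2, of 1 1] by (simp add: fl)
    also have "sphere_inner r f g = sphere_inner r g g + sphere_inner r g ?l"
      using sphere_inner_lin[OF r V g g s2, of 1 1] sphere_inner_commute[of r f g] by (simp add: fl)
    also have "sphere_inner r f ?l = sphere_inner r ?l g + sphere_inner r ?l ?l"
      using sphere_inner_lin[OF r V s2 g s2, of 1 1] sphere_inner_commute[of r f ?l] by (simp add: fl)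
    finally show ?thesis using gl ll sphere_inner_commute[of r ?l g] by simp
  qed
  have Dl: "dirichlet r k ?l = n * sphere_inner r k (\<lambda>p. z \<bullet> p)" if "Cinf_on V k" for k
    unfolding dirichlet_lin[OF r V that s1 sl] by (simp add: D1 Dz[OF that])
  have DF: "dirichlet r f f = dirichlet r g g + n * ?A * (z \<bullet> z)"
  proof -
    have "dirichlet r f f = dirichlet r f g + dirichlet r f ?l"
      using dirichlet_lin[OF r V sf g s2, of 1 1] by (simp add: fl)
    also have "dirichlet r f g = dirichlet r g g + dirichlet r g ?l"
      using dirichlet_lin[OF r V g g s2, of 1 1] dirichlet_commute[of r f g] by (simp add: fl)
    also have "dirichlet r f ?l = dirichlet r ?l g + dirichlet r ?l ?l"
      using dirichlet_lin[OF r V s2 g s2, of 1 1] dirichlet_commute[of r f ?l] by (simp add: fl)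
    also have "sphere_inner r ?l (\<lambda>p. z \<bullet> p) = ?A * (z \<bullet> z)"
      unfolding sphere_inner_commute[of r ?l] sphere_inner_lin[OF r V sl s1 sl] by (simp add: z1 zz)
    then have "dirichlet r ?l ?l = n * (?A * (z \<bullet> z))" unfolding Dl[OF s2] by simp
    finally show ?thesis using Dl[OF g] gz dirichlet_commute[of r ?l g] by simp
  qed
  have If: "(\<integral>p. f p \<partial>?M) = m * vol"
  proof -
    have "integrable ?M g" "integrable ?M (\<lambda>p. z \<bullet> p)" by (intro sphere_integrable_continuous r continuous_intros cg)+
    then show ?thesis using g0 sphere_first_moment[OF r, of z] by (simp add: f_def vol_def mult.commute)
  qed
  have Ify: "(\<integral>p. f p * (y \<bullet> p) \<partial>?M) = ?A * (z \<bullet> y)"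
  proof -
    have sy: "Cinf_on V (\<lambda>p. y \<bullet> p)" by (intro Cinf_on_linear o bounded_linear_inner_right)
    have yc: "sphere_inner r (\<lambda>p. y \<bullet> p) (\<lambda>p. 1) = 0" 
      using sphere_first_moment[OF r, of y] by (simp add: sphere_inner_def)
    have "sphere_inner r (\<lambda>p. y \<bullet> p) f = sphere_inner r (\<lambda>p. y \<bullet> p) g + sphere_inner r (\<lambda>p. y \<bullet> p) ?l"
      using sphere_inner_lin[OF r V sy g s2, of 1 1] by (simp add: fl)
    moreover have "sphere_inner r (\<lambda>p. y \<bullet> p) ?l = ?A * (z \<bullet> y)"
      unfolding sphere_inner_lin[OF r V sy s1 sl] yc sphere_inner_commute[of r "\<lambda>p. y \<bullet> p" "\<lambda>p. z \<bullet> p"] zz by simp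
    moreover have "sphere_inner r (\<lambda>p. y \<bullet> p) g = 0" using g1[of y] by (simp add: sphere_inner_def mult.commute)
    ultimately show ?thesis by (simp add: sphere_inner_def mult.commute)
  qed
  define zz' zy yy G DG i j where "zz' = z \<bullet> z" and "zy = z \<bullet> y" and "yy = y \<bullet> y" and "G = sphere_inner r g g" and "DG = dirichlet r g g"
    and "i = 1 / r" and "j = 1 / (n + 1)"
  have i: "r * i = 1" and j: "(n + 1) * j = 1" using r n by (simp_all add: i_def j_def)
  have dv: "x / r = x * i" "x / r\<^sup>2 = x * i * i" "x / (n + 1) = x * j" for x by (simp_all add: i_def j_def power2_eq_square)
  have in2: "(y + r *\<^sub>R z) \<bullet> (y + r *\<^sub>R z) = yy + 2 * r * zy + r\<^sup>2 * zz'"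
    by (simp add: inner_add_left inner_add_right yy_def zy_def zz'_def inner_commute[of y z] power2_eq_square algebra_simps)
  define Q where "Q = (n - r\<^sup>2)\<^sup>2 - r\<^sup>2 - n"
  have k1: "(n * i - r)\<^sup>2 - 1 - n * i * i = Q * i * i" using i unfolding Q_def by algebra
  have k2: "(n * i - r + i) * r\<^sup>2 = (n + 1 - r\<^sup>2) * r" using i by algebra
  have k3: "r\<^sup>2 * j - 1 = - ((n + 1 - r\<^sup>2) * j)" using j by algebra
  have k4: "r\<^sup>2 * i * i = 1" using i by algebra
  have k5: "Q * i * i * (m + h * r / 2)\<^sup>2 = Q * i * i * m\<^sup>2 + Q * i * h * m + Q / 4 * h\<^sup>2"
  proof -
    have "Q * i * i * (m + h * r / 2)\<^sup>2 = Q * i * i * m\<^sup>2 + Q * i * h * m * (r * i) + Q / 4 * h\<^sup>2 * (r * i) * (r * i)"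
      by (simp add: power2_eq_square algebra_simps)
    then show ?thesis unfolding i by simp
  qed
  have "second_variation_form r f y h = (DG + n * (r\<^sup>2 / (n + 1) * vol) * zz') / r\<^sup>2
      + ((n / r - r)\<^sup>2 - 1 - n / r\<^sup>2) * (G + (m\<^sup>2 * vol + r\<^sup>2 / (n + 1) * vol * zz'))
      + Q / r * h * (m * vol) - 2 * (n / r - r + 1 / r) * (r\<^sup>2 / (n + 1) * vol * zy) + (r\<^sup>2 / (n + 1) - 1) * yy * vol + Q / 4 * h\<^sup>2 * vol"
    unfolding second_variation_form_def Let_def n_def[symmetric] vol_def[symmetric] DF ff If Ify
      zz'_def zy_def yy_def G_def DG_def Q_def ..
  also have "\<dots> = (DG + n * (r\<^sup>2 * j * vol) * zz') * i * i + Q * i * i * (G + (m\<^sup>2 * vol + r\<^sup>2 * j * vol * zz'))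
      + Q * i * h * (m * vol) - 2 * (n * i - r + i) * (r\<^sup>2 * j * vol * zy) + (r\<^sup>2 * j - 1) * yy * vol + Q / 4 * h\<^sup>2 * vol"
    unfolding dv mult_1 k1 ..
  also have "(DG + n * (r\<^sup>2 * j * vol) * zz') * i * i + Q * i * i * (G + (m\<^sup>2 * vol + r\<^sup>2 * j * vol * zz'))
      + Q * i * h * (m * vol) - 2 * (n * i - r + i) * (r\<^sup>2 * j * vol * zy) + (r\<^sup>2 * j - 1) * yy * vol + Q / 4 * h\<^sup>2 * vol
    = (DG + Q * G) * i * i + vol * (Q * i * i * m\<^sup>2 + Q * i * h * m + Q / 4 * h\<^sup>2)
      + (n + Q) * (r\<^sup>2 * i * i) * (j * vol * zz') - 2 * ((n * i - r + i) * r\<^sup>2) * (j * vol * zy) + (r\<^sup>2 * j - 1) * yy * vol"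
    by (simp add: algebra_simps)
  also have "\<dots> = (DG + Q * G) * i * i + vol * (Q * i * i * (m + h * r / 2)\<^sup>2 - zz' * n * (r\<^sup>2 - n) * j
     - (n + 1 - r\<^sup>2) * j * (yy + 2 * r * zy + r\<^sup>2 * zz'))"
    unfolding k4 k2 k3 k5 unfolding Q_def by (simp add: power2_eq_square algebra_simps)
  finally show ?thesis
    unfolding in2 G_def[symmetric] DG_def[symmetric] zz'_def[symmetric] Q_def[symmetric] dv .
qed

lemma quadratic_eventually_nonneg:
  assumes "(a::real) > 0" shows "\<exists>c. A + b * c + a * c\<^sup>2 \<ge> 0"
proof -
  \<comment> \<open>Chosen so that \<open>c \<ge> 1\<close> and \<open>a c\<^sup>2\<close> dominates the other two terms.\<close>
  define c where "c = 1 + (\<bar>A\<bar> + \<bar>b\<bar>) / a"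
  have c1: "c \<ge> 1" using assms by (simp add: c_def)
  have ac: "a * c = a + \<bar>A\<bar> + \<bar>b\<bar>" using assms by (simp add: c_def field_simps)
  have "a * c\<^sup>2 = c * (a + \<bar>A\<bar> + \<bar>b\<bar>)" unfolding ac[symmetric] by (simp add: power2_eq_square)
  also have "\<dots> \<ge> \<bar>A\<bar> + \<bar>b\<bar> * c"
  proof -
    have "1 * \<bar>A\<bar> \<le> c * \<bar>A\<bar>" "0 \<le> c * a" using mult_right_mono[OF c1 abs_ge_zero[of A]] c1 assms by simp_all
    then show ?thesis by (simp add: algebra_simps)
  qed
  finally have "a * c\<^sup>2 \<ge> \<bar>A\<bar> + \<bar>b\<bar> * c" .
  moreover have "(- \<bar>b\<bar>) * c \<le> b * c" using c1 by (intro mult_right_mono) auto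
  ultimately show ?thesis by (intro exI[of _ c]) simp
qed

text \<open>Given the speed, the base point and the scale are moved with constant velocities. Which velocities help depends on the sign of
  the coefficient \<open>n + 1 - R\<close> of the completed square.\<close>

lemma sphere_F_stable:
  assumes r: "r > 0"
    and cs: "r\<^sup>2 \<le> real CARD('n) \<or> r\<^sup>2 > real CARD('n) + 1"
  shows "F_stable r (\<lambda>p::real^'n::finite option. p) (\<lambda>p. - (1 / r) *\<^sub>R p) 0 1 (real CARD('n) / r - r)"
  unfolding F_stable_def
proof (intro conjI allI impI sphere_F_critical r)
  fix Xs :: "real \<Rightarrow> real^'n option \<Rightarrow> real^'n option"
  assume a: "normal_variation r (\<lambda>p. p) (\<lambda>p. - (1 / r) *\<^sub>R p) Xs"
  obtain V f where v: "initial_normal_speed r Xs V f" using normal_variation_data[OF a] by blast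
  have sf: "Cinf_on V f" and SV: "sphere 0 r \<subseteq> V" using v unfolding initial_normal_speed_def by blast+
  let ?K = "(4 * pi) powr (- real CARD('n) / 2) * exp (- r\<^sup>2 / 2)"
  let ?n = "real CARD('n)"
  define vol where "vol = measure (sphere_measure r :: (real^'n option) measure) (sphere 0 r)"
  have vol: "vol > 0" unfolding vol_def by (rule sphere_measure_finite_pos(2)[OF r])
  obtain m z g where g: "Cinf_on V g" and f: "f = (\<lambda>p. g p + (m + z \<bullet> p))"
    and g0: "(\<integral>p. g p \<partial>sphere_measure r) = 0" "\<And>a. (\<integral>p. g p * (a \<bullet> p) \<partial>sphere_measure r) = 0"
    using affine_part[OF r sf SV] by blast
  note dec = second_variation_form_decomposition[OF r g SV g0, of m z, folded f vol_def]
  have "\<exists>y h. second_variation_form r f y h \<ge> 0"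
    using cs
  proof
    assume R: "r\<^sup>2 \<le> ?n"
    define G where "G = sphere_inner r g g"
    have G: "G \<ge> 0" by (simp add: G_def sphere_inner_def)
    have "2 * (?n + 1) * G \<le> dirichlet r g g" unfolding G_def by (rule sphere_spectral_gap[OF r g SV g0])
    moreover have "0 \<le> ((?n - r\<^sup>2)\<^sup>2 + (?n - r\<^sup>2) + 2) * G" using G R by (intro mult_nonneg_nonneg add_nonneg_nonneg) auto
    ultimately have 1: "0 \<le> dirichlet r g g + ((?n - r\<^sup>2)\<^sup>2 - r\<^sup>2 - ?n) * G" by (simp add: algebra_simps)
    have 2: "0 \<le> (z \<bullet> z) * ?n * (?n - r\<^sup>2) / (?n + 1)" using R by simp
    have e: "(z \<bullet> z) * ?n * (r\<^sup>2 - ?n) = - ((z \<bullet> z) * ?n * (?n - r\<^sup>2))" by (simp add: algebra_simps)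
    \<comment> \<open>These velocities make both completed squares vanish.\<close>
    have "second_variation_form r f (- r *\<^sub>R z) (- 2 * m / r) = 
      (dirichlet r g g + ((?n - r\<^sup>2)\<^sup>2 - r\<^sup>2 - ?n) * G) / r\<^sup>2 + vol * ((z \<bullet> z) * ?n * (?n - r\<^sup>2) / (?n + 1))"
      unfolding dec G_def e using r by simp
    then show ?thesis using 1 2 vol by (metis add_nonneg_nonneg divide_nonneg_nonneg less_imp_le mult_nonneg_nonneg zero_le_power2)
  next
    assume R: "r\<^sup>2 > ?n + 1"
    \<comment> \<open>The form is convex in \<open>y\<close> here, so \<open>y\<close> is moved far away from the minimum point \<open>- r z\<close> in an arbitrary direction.\<close>
    define A where "A = second_variation_form r f (- r *\<^sub>R z) 0"
    have q: "(r\<^sup>2 - (?n + 1)) / (?n + 1) = - ((?n + 1 - r\<^sup>2) / (?n + 1))" by (simp add: minus_divide_left)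
    have e: "(c *\<^sub>R axis None 1 - r *\<^sub>R z + r *\<^sub>R z) \<bullet> (c *\<^sub>R axis None 1 - r *\<^sub>R z + r *\<^sub>R z) = c\<^sup>2"
      "(- r *\<^sub>R z + r *\<^sub>R z) \<bullet> (- r *\<^sub>R z + r *\<^sub>R z) = 0" for c
      by (simp_all add: inner_axis_axis power2_eq_square)
    have "second_variation_form r f (c *\<^sub>R axis None 1 - r *\<^sub>R z) 0 = A + 0 * c + (vol * ((r\<^sup>2 - (?n + 1)) / (?n + 1))) * c\<^sup>2" for c
      unfolding A_def unfolding dec e q by (simp add: right_diff_distrib)
    moreover obtain c where "A + 0 * c + (vol * ((r\<^sup>2 - (?n + 1)) / (?n + 1))) * c\<^sup>2 \<ge> 0"
      using quadratic_eventually_nonneg[of "vol * ((r\<^sup>2 - (?n + 1)) / (?n + 1))" A 0] R vol by auto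
    ultimately show ?thesis by metis
  qed
  then obtain y h where yh: "second_variation_form r f y h \<ge> 0" by blast
  have "has_second_derivative (sphere_F r Xs (\<lambda>s. s *\<^sub>R y) (\<lambda>s. 1 + h * s))
     (?K * second_variation_form r f y h) 0"
    by (rule second_variation(2)[OF r v linear_point_variation affine_scale_variation])
  moreover have "?K * second_variation_form r f y h \<ge> 0" using yh by simp
  ultimately show "\<exists>x t. point_variation 0 x \<and> scale_variation 1 t \<and>
     (\<exists>d. has_second_derivative (sphere_F r Xs x t) d 0 \<and> d \<ge> 0)"
    using linear_point_variation(1) affine_scale_variation(1) by blast
qed

text \<open>For the pencil of spheres the speed is affine with nonzero linear part, and all three terms of the completed squares
  are nonpositive, the one in \<open>z\<close> strictly negative.\<close>

lemma sphere_F_unstable: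
  assumes r: "r > 0"
    and R1: "real CARD('n) < r\<^sup>2" and R2: "r\<^sup>2 \<le> real CARD('n) + 1"
  shows "F_unstable r (\<lambda>p::real^'n::finite option. p) (\<lambda>p. - (1 / r) *\<^sub>R p) 0 1 (real CARD('n) / r - r)"
  unfolding F_unstable_def
proof (intro conjI sphere_F_critical r)
  let ?n = "real CARD('n)"
  let ?K = "(4 * pi) powr (- real CARD('n) / 2) * exp (- r\<^sup>2 / 2)"
  define vol where "vol = measure (sphere_measure r :: (real^'n option) measure) (sphere 0 r)"
  have vol: "vol > 0" unfolding vol_def by (rule sphere_measure_finite_pos(2)[OF r])
  have n1: "?n \<ge> 1" using zero_less_card_finite[where 'a='n] by linarith
  \<comment> \<open>Any centre outside the sphere would do; at distance \<open>2 r\<close> from the origin its power is \<open>3 r\<^sup>2\<close>.\<close>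
  define a :: "real^'n option" where "a = axis None (2 * r)"
  define k where "k = 3 * r\<^sup>2"
  have a: "a \<bullet> a = 4 * r\<^sup>2" by (simp add: a_def inner_axis_axis power2_eq_square)
  have k: "k > 0" using r by (simp add: k_def)
  define m where "m = - (r / k) * (5 * r\<^sup>2)"
  define z where "z = (2 * r / k) *\<^sub>R a"
  have zz: "z \<bullet> z > 0" using r k a by (simp add: z_def)
  define f where "f = (\<lambda>p. (0::real) + (m + z \<bullet> p))"
  have sf: "Cinf_on UNIV f" unfolding f_def by (intro Cinf_on_add Cinf_on_const Cinf_on_linear bounded_linear_inner_right) auto
  have s0: "Cinf_on UNIV (\<lambda>p::real^'n option. 0::real)" by (simp add: Cinf_on_const)
  note nv = pencil_normal_variation[OF r a k_def]
  obtain V' f' where v': "initial_normal_speed r (pencil a k) V' f'" using normal_variation_data[OF nv] by blast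
  have vf: "((\<lambda>s. pencil a k s p) has_vector_derivative f p *\<^sub>R (- (1 / r) *\<^sub>R p)) (at 0)" if p: "p \<in> sphere 0 r" for p
  proof -
    have "pencil_speed r a k 0 p = f p" 
      unfolding pencil_zero(4)[OF r a k_def p] f_def m_def z_def using k by (simp add: field_simps)
    then show ?thesis using pencil_velocity[OF r a k_def p, of 0] pencil_zero(3)[OF r a k_def p] by simp
  qed
  have v: "initial_normal_speed r (pencil a k) UNIV f"
    using v' sf vf unfolding initial_normal_speed_def by blast
  have neg: "second_variation_form r f y h < 0" for y h
  proof -
    have "second_variation_form r f y h = vol * (((?n - r\<^sup>2)\<^sup>2 - r\<^sup>2 - ?n) / r\<^sup>2 * (m + h * r / 2)\<^sup>2 - (z \<bullet> z) * ?n * (r\<^sup>2 - ?n) / (?n + 1)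
        - (?n + 1 - r\<^sup>2) / (?n + 1) * ((y + r *\<^sub>R z) \<bullet> (y + r *\<^sub>R z)))"
      using second_variation_form_decomposition[OF r s0, of m z y h, folded f_def vol_def]
      by (simp add: dirichlet_def grad_pairing_def sphere_inner_def)
    also have "\<dots> < 0"
    proof (rule mult_pos_neg[OF vol])
      have "\<bar>?n - r\<^sup>2\<bar> \<le> 1" using R1 R2 by linarith
      then have "(?n - r\<^sup>2)\<^sup>2 \<le> 1" by (simp add: abs_square_le_1)
      then have Q: "(?n - r\<^sup>2)\<^sup>2 - r\<^sup>2 - ?n \<le> 0" using n1 R1 by linarith
      have "((?n - r\<^sup>2)\<^sup>2 - r\<^sup>2 - ?n) / r\<^sup>2 * (m + h * r / 2)\<^sup>2 \<le> 0"
        by (rule mult_nonpos_nonneg[OF divide_nonpos_nonneg[OF Q]]) simp_all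
      moreover have "(z \<bullet> z) * ?n * (r\<^sup>2 - ?n) / (?n + 1) > 0" using zz n1 R1 by (intro divide_pos_pos mult_pos_pos) auto
      moreover have "(?n + 1 - r\<^sup>2) / (?n + 1) * ((y + r *\<^sub>R z) \<bullet> (y + r *\<^sub>R z)) \<ge> 0" using R2 by (intro mult_nonneg_nonneg divide_nonneg_nonneg) auto
      ultimately show "((?n - r\<^sup>2)\<^sup>2 - r\<^sup>2 - ?n) / r\<^sup>2 * (m + h * r / 2)\<^sup>2 - (z \<bullet> z) * ?n * (r\<^sup>2 - ?n) / (?n + 1)
        - (?n + 1 - r\<^sup>2) / (?n + 1) * ((y + r *\<^sub>R z) \<bullet> (y + r *\<^sub>R z)) < 0" by linarith
    qed
    finally show ?thesis .
  qed
  have "\<exists>d. has_second_derivative (sphere_F r (pencil a k) x t) d 0 \<and> d < 0"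
    if xt: "point_variation 0 x \<and> scale_variation 1 t" for x t
  proof -
    obtain y h where d: "(x has_vector_derivative y) (at 0)" "(t has_real_derivative h) (at 0)"
      using variation_derivatives xt by blast
    have "has_second_derivative (sphere_F r (pencil a k) x t)
       (?K * second_variation_form r f y h) 0"
      using second_variation(2)[OF r v _ d(1) _ d(2)] xt by blast
    moreover have "?K * second_variation_form r f y h < 0" using neg by (intro mult_pos_neg mult_pos_pos) auto
    ultimately show ?thesis by blast
  qed
  with nv show "\<exists>Xs. normal_variation r (\<lambda>p::real^'n option. p) (\<lambda>p. - (1 / r) *\<^sub>R p) Xs \<and>
        (\<forall>x t. point_variation 0 x \<and> scale_variation 1 t \<longrightarrow>
           (\<exists>d. has_second_derivative (sphere_F r Xs x t) d 0 \<and> d < 0))"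
    by blast
qed

theorem theorem6p2:
  fixes r lam :: real and n :: nat
    and X N :: "real ^ 'n::finite option \<Rightarrow> real ^ 'n option"
  assumes "r > 0"
    and "n = CARD('n)"
    and "lam = real n / r - r"
    and "X = (\<lambda>p. p)"
    and "N = (\<lambda>p. - (1 / r) *\<^sub>R X p)"
  shows "(r \<le> sqrt (real n) \<or> r > sqrt (real n + 1) \<longrightarrow> F_stable r X N 0 1 lam) \<and>
         (sqrt (real n) < r \<and> r \<le> sqrt (real n + 1) \<longrightarrow> F_unstable r X N 0 1 lam)"
proof -
  have lam: "lam = real CARD('n) / r - r" using assms(2,3) by simp
  have le: "r \<le> sqrt c \<longleftrightarrow> r\<^sup>2 \<le> c" if "c \<ge> 0" for c
    using assms(1) that by (metis abs_of_pos real_sqrt_abs real_sqrt_le_iff)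
  have "r \<le> sqrt (real n) \<longleftrightarrow> r\<^sup>2 \<le> real CARD('n)" "r \<le> sqrt (real n + 1) \<longleftrightarrow> r\<^sup>2 \<le> real CARD('n) + 1"
    using le[of "real n"] le[of "real n + 1"] assms(2) by simp_all
  moreover have N: "N = (\<lambda>p. - (1 / r) *\<^sub>R p)" using assms(4,5) by simp
  ultimately show ?thesis
    using sphere_F_stable[where 'n='n, OF assms(1)] sphere_F_unstable[where 'n='n, OF assms(1)]
    unfolding assms(4) N lam by (auto simp: not_le)
qed

end
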